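(* Let $X=\{X(t),t\in[0,1]\}$ be an $\mathbb{F}$-adapted process and let $\alpha>\frac12$, $\delta>0$ be constants such that, for some positive constants $C$ (not necessarily the same in (i) and (ii)): (i) for every $s,t\in[0,1]$, $|X(t)-X(s)|\le C|t-s|^{\alpha}$; (ii) for every $s,t\in[1-\delta,1]$ with $t=s+\Delta$, $\Delta>0$, and every $\epsilon>0$ with $\epsilon\le\Delta^{\alpha}$, $$P\Big(\sup_{s\le u\le t}|X(u)-X(s)|\le\epsilon\Big)\le\exp\big(-C\Delta\,\epsilon^{-1/\alpha}\big).$$ Let $\xi$ be a random variable and assume that there exists an $\mathbb{F}$-adapted process $\{z(t),t\in[0,1]\}$ having H\"older continuous paths of some order $a>0$ and such that $z(1)=\xi$. Then there exists an $\mathbb{F}$-adapted process $\{\psi(t),t\in[0,1]\}$ such that $\psi\in C[0,1)$ almost surely and $$\int_0^1\psi(s)\,dX(s)=\xi$$ almost surely.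
   Context: $(\Omega,\mathcal{F},\mathbb{F}=\{\mathcal{F}_t,t\in[0,1]\},P)$ is a stochastic basis (filtered probability space). $C[0,1)$ denotes the continuous functions on $[0,1)$. Integrals with respect to $X$ are pathwise generalized Lebesgue--Stieltjes integrals, defined as follows. For $f,g:[a,b]\to\mathbb{R}$ and $\beta\in(0,1)$ put $$(D_{a+}^{\beta}f)(x)=\frac{1}{\Gamma(1-\beta)}\Big(\frac{f(x)}{(x-a)^\beta}+\beta\int_a^x\frac{f(x)-f(u)}{(x-u)^{\beta+1}}du\Big),$$ $$(D_{b-}^{1-\beta}g)(x)=\frac{e^{i\pi(1-\beta)}}{\Gamma(\beta)}\Big(\frac{g(x)}{(b-x)^{1-\beta}}+(1-\beta)\int_x^b\frac{g(x)-g(u)}{(u-x)^{2-\beta}}du\Big),$$ and $g_{b-}(x)=g(x)-g(b)$. If $D_{a+}^\beta f\in L_1[a,b]$ and $D_{b-}^{1-\beta}g_{b-}\in L_\infty[a,b]$, then $$\int_a^b f(x)\,dg(x)=e^{i\pi\beta}\int_a^b(D_{a+}^\beta f)(x)(D_{b-}^{1-\beta}g_{b-})(x)\,dx.$$ If $g$ is $\alpha$-H\"older continuous on $[a,b]$, the admissible integrands are the functions $f$ with $$\|f\|_{\beta;[a,b]}=\int_a^b\Big(\frac{|f(t)|}{(t-a)^\beta}+\int_a^t\frac{|f(t)-f(s)|}{(t-s)^{\beta+1}}ds\Big)dt<\infty$$ for some $\beta\in(1-\alpha,1)$; for these the integral is well defined. The assertion $\int_0^1\psi(s)\,dX(s)=\xi$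 includes that $\psi$ is admissible on $[0,1]$ in this sense, pathwise, almost surely. *)

theory Defs
  imports "HOL-Probability.Probability"
begin

section \<open>Stochastic bases with time set $[0,1]$\<close>

text \<open>Time is the type \<^typ>\<open>real\<close>, but only the values at times in $[0,1]$ are used or constrained.
  No completeness or right-continuity of the filtration is assumed.\<close>

definition stochastic_basis :: "'a measure \<Rightarrow> (real \<Rightarrow> 'a measure) \<Rightarrow> bool" where
  "stochastic_basis M F \<longleftrightarrow>
     prob_space M \<and>
     (\<forall>t\<in>{0..1}. subalgebra M (F t)) \<and>
     (\<forall>s\<in>{0..1}. \<forall>t\<in>{0..1}. s \<le> t \<longrightarrow> sets (F s) \<subseteq> sets (F t))"

definition adapted :: "(real \<Rightarrow> 'a measure) \<Rightarrow> (real \<Rightarrow> 'a \<Rightarrow> real) \<Rightarrow> bool" where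
  "adapted F X \<longleftrightarrow> (\<forall>t\<in>{0..1}. X t \<in> borel_measurable (F t))"

definition holder_on :: "real set \<Rightarrow> real \<Rightarrow> (real \<Rightarrow> real) \<Rightarrow> bool" where
  "holder_on S a f \<longleftrightarrow> (\<exists>K. \<forall>s\<in>S. \<forall>t\<in>S. \<bar>f t - f s\<bar> \<le> K * \<bar>t - s\<bar> powr a)"

section \<open>Generalized Lebesgue--Stieltjes integrals\<close>

text \<open>The derivative $D_{a+}^{\beta} f$. The Lebesgue integral is $0$ when it does not converge,
  so convergence of the inner integral is recorded separately.\<close>

definition left_frac_deriv :: "real \<Rightarrow> real \<Rightarrow> (real \<Rightarrow> real) \<Rightarrow> real \<Rightarrow> real" where
  "left_frac_deriv a \<beta> f x =
     1 / Gamma (1 - \<beta>) *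
       (f x / (x - a) powr \<beta> + \<beta> * (LBINT u:{a..x}. (f x - f u) / (x - u) powr (\<beta> + 1)))"

definition left_frac_deriv_exists :: "real \<Rightarrow> real \<Rightarrow> (real \<Rightarrow> real) \<Rightarrow> real \<Rightarrow> bool" where
  "left_frac_deriv_exists a \<beta> f x \<longleftrightarrow>
     set_integrable lborel {a..x} (\<lambda>u. (f x - f u) / (x - u) powr (\<beta> + 1))"

text \<open>The derivative $D_{b-}^{1-\beta} g$, of order $1 - \beta$ (the parameter is $\beta$), with its complex phase.\<close>

definition right_frac_deriv :: "real \<Rightarrow> real \<Rightarrow> (real \<Rightarrow> real) \<Rightarrow> real \<Rightarrow> complex" where
  "right_frac_deriv b \<beta> g x =
     exp (\<i> * complex_of_real (pi * (1 - \<beta>))) / complex_of_real (Gamma \<beta>) *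
       complex_of_real (g x / (b - x) powr (1 - \<beta>) +
         (1 - \<beta>) * (LBINT u:{x..b}. (g x - g u) / (u - x) powr (2 - \<beta>)))"

definition right_frac_deriv_exists :: "real \<Rightarrow> real \<Rightarrow> (real \<Rightarrow> real) \<Rightarrow> real \<Rightarrow> bool" where
  "right_frac_deriv_exists b \<beta> g x \<longleftrightarrow>
     set_integrable lborel {x..b} (\<lambda>u. (g x - g u) / (u - x) powr (2 - \<beta>))"

definition has_gls_integral ::
    "real \<Rightarrow> real \<Rightarrow> real \<Rightarrow> (real \<Rightarrow> real) \<Rightarrow> (real \<Rightarrow> real) \<Rightarrow> real \<Rightarrow> bool" where
  "has_gls_integral \<beta> a b f g I \<longleftrightarrow>
     (let Df = left_frac_deriv a \<beta> f;
          gb = (\<lambda>x. g x - g b);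
          Dg = right_frac_deriv b \<beta> gb
      in 0 < \<beta> \<and> \<beta> < 1 \<and>
         (AE x in lborel. x \<in> {a..b} \<longrightarrow> left_frac_deriv_exists a \<beta> f x) \<and>
         set_integrable lborel {a..b} Df \<and>
         (AE x in lborel. x \<in> {a..b} \<longrightarrow> right_frac_deriv_exists b \<beta> gb x) \<and>
         set_borel_measurable lborel {a..b} Dg \<and>
         (\<exists>B. AE x in lborel. x \<in> {a..b} \<longrightarrow> norm (Dg x) \<le> B) \<and>
         complex_of_real I =
           exp (\<i> * complex_of_real (pi * \<beta>)) * (LBINT x:{a..b}. complex_of_real (Df x) * Dg x))"

definition gls_norm :: "real \<Rightarrow> real \<Rightarrow> real \<Rightarrow> (real \<Rightarrow> real) \<Rightarrow> ennreal" where
  "gls_norm \<beta> a b f =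
     (\<integral>\<^sup>+t\<in>{a..b}. (ennreal (\<bar>f t\<bar> / (t - a) powr \<beta>) +
        (\<integral>\<^sup>+s\<in>{a..t}. ennreal (\<bar>f t - f s\<bar> / (t - s) powr (\<beta> + 1)) \<partial>lborel)) \<partial>lborel)"

text \<open>Admissibility of f as an integrand for an \<open>\<alpha>\<close>-Hoelder integrator at exponent \<open>\<beta>\<close>. Borel measurability
  is implicit in the finiteness of the norm, but must be stated because \<^const>\<open>nn_integral\<close> is total.\<close>

definition gls_admissible_at :: "real \<Rightarrow> real \<Rightarrow> real \<Rightarrow> real \<Rightarrow> (real \<Rightarrow> real) \<Rightarrow> bool" where
  "gls_admissible_at \<alpha> \<beta> a b f \<longleftrightarrow>
     \<beta> \<in> {1 - \<alpha><..<1} \<and> set_borel_measurable lborel {a..b} f \<and> gls_norm \<beta> a b f < \<infinity>"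

text \<open>\<open>f\<close> is admissible on $[a,b]$ for an \<open>\<alpha>\<close>-Hoelder integrator \<open>g\<close>, and $\int_a^b f\,dg = I$; both with the same \<open>\<beta>\<close>.
  The value does not depend on the choice of an admissible \<open>\<beta>\<close>.\<close>

definition has_pathwise_integral ::
    "real \<Rightarrow> real \<Rightarrow> real \<Rightarrow> (real \<Rightarrow> real) \<Rightarrow> (real \<Rightarrow> real) \<Rightarrow> real \<Rightarrow> bool" where
  "has_pathwise_integral \<alpha> a b f g I \<longleftrightarrow>
     (\<exists>\<beta>. gls_admissible_at \<alpha> \<beta> a b f \<and> has_gls_integral \<beta> a b f g I)"

end

theory Submission
  imports Defs
begin

text \<open>Split $[0,1)$ into blocks $[t_n, t_{n+1}]$ with $t_n = 1 - 2^{-n}$ and let \<open>I\<^sub>n\<close> be the integral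
  realized up to $t_n$. On block \<open>n\<close> the integrand is
  $V_n \varepsilon_n^{-1} h((X - X(t_n)) / \varepsilon_n)$ with $V_n = z(t_n) - I_n$ and an odd polynomial \<open>h\<close>
  vanishing at $\pm 1$, stopped when $|X - X(t_n)|$ first reaches $\varepsilon_n$. The chain rule gives
  the value $V_n$ for the integral over the block whenever $\varepsilon_n$ is reached in the first half of it;
  otherwise the integrand is led linearly to 0 in the second half. By the small deviation bound and
  Borel--Cantelli the level is missed only finitely often, so eventually $I_{n+1} = z(t_n)$, which tends to
  $z(1) = \xi$. With $\varepsilon_n$ slightly smaller than the block length to the power \<open>\<alpha>\<close>, and \<open>\<beta>\<close>
  slightly above $1 - \<alpha>$, the Hoelder continuity of \<open>z\<close> makes the fractional norms of the blocks summable.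

  The chain rule itself is obtained by mollification: for $C^1$ functions the fractional integral is
  $\int f g'$, by integration by parts, Fubini and the Beta integral, and it is continuous under pointwise
  convergence with uniform Hoelder bounds.\<close>

section \<open>Fractional derivatives of Hoelder functions\<close>

text \<open>The exponents: let l be half the length of a block and put \<kappa> = a/5, where a is
  first lowered to at most 2\<alpha> - 1. The level is l^(\<alpha>+\<kappa>), so it is missed with
  probability at most exp(-C l^(-\<kappa>/\<alpha>)), and \<beta> = 1 - \<alpha> + \<kappa>. A block
  with coefficient 1 has \<alpha>-Hoelder constant of order l^(-2\<alpha>-2\<kappa>), hence a norm
  of order l^(-4\<kappa>); with \<kappa> = 0 this exponent would be 0. Four \<kappa> are lost, the
  increments of z of order l^a return five, and the series becomes geometric. The obstacle: the
  hitting time is not stable under smoothing of the path. It is therefore frozen as a plain number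
  while the path is mollified, and the value of a block is written as an expression that is
  continuous in the path whether or not the level is reached. Because the polynomial vanishes at 1
  and -1, the integrand passes continuously through the stopping, as membership in C[0,1) requires.
  Blocks that miss the level need no estimate of their values: almost every path has finitely many,
  and the next successful block corrects the whole accumulated error at once.\<close>

lemma has_bochner_integral_lborel_nonneg:
  fixes f :: "real \<Rightarrow> real"
  assumes "f \<in> borel_measurable borel" "S \<in> sets borel" "\<And>x. x \<in> S \<Longrightarrow> 0 \<le> f x"
    and I: "(f has_integral I) S"
  shows "has_bochner_integral lborel (\<lambda>x. indicator S x * f x) I"
proof (rule has_bochner_integral_nn_integral)
  show "(\<lambda>x. indicator S x * f x) \<in> borel_measurable lborel" using assms(1,2) by measurable
  show "AE x in lborel. 0 \<le> indicator S x * f x" using assms(3) by (auto simp: indicator_def)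
  show "0 \<le> I" using has_integral_nonneg[OF I] assms(3) by auto
  show "(\<integral>\<^sup>+ x. ennreal (indicator S x * f x) \<partial>lborel) = ennreal I"
    by (rule nn_integral_has_integral_lebesgue[OF assms(3) I])
qed

section \<open>Integrals of power kernels\<close>

lemma powr_kernel_0:
  fixes p c :: real
  assumes "p > -1" "c \<ge> 0"
  shows "has_bochner_integral lborel (\<lambda>u. indicator {0..c} u * u powr p) (c powr (p + 1) / (p + 1))"
  by (rule has_bochner_integral_lborel_nonneg) (use has_integral_powr_from_0[OF assms] in auto)

lemma powr_kernel_left:
  fixes p x a :: real
  assumes "p > -1" "a \<le> x"
  shows "has_bochner_integral lborel (\<lambda>u. indicator {a..x} u * (x - u) powr p)
           ((x - a) powr (p + 1) / (p + 1))"
proof -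
  have "has_bochner_integral lborel (\<lambda>u. indicator {0..x - a} (x + (-1) * u) * (x + (-1) * u) powr p)
     (((x - a) powr (p + 1) / (p + 1)) /\<^sub>R \<bar>-1\<bar>)"
    using powr_kernel_0[of p "x - a"] assms
    by (subst lborel_has_bochner_integral_real_affine_iff[of "-1" _ _ x, symmetric]) auto
  moreover have "(\<lambda>u. indicator {0..x - a} (x + (-1) * u) * (x + (-1) * u) powr p)
     = (\<lambda>u. indicator {a..x} u * (x - u) powr p)"
    by (auto simp: fun_eq_iff indicator_def)
  ultimately show ?thesis by simp
qed

lemma powr_kernel_right:
  fixes p x b :: real
  assumes "p > -1" "x \<le> b"
  shows "has_bochner_integral lborel (\<lambda>u. indicator {x..b} u * (u - x) powr p)
           ((b - x) powr (p + 1) / (p + 1))"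
proof -
  have "has_bochner_integral lborel (\<lambda>u. indicator {0..b - x} (-x + 1 * u) * (-x + 1 * u) powr p)
     (((b - x) powr (p + 1) / (p + 1)) /\<^sub>R \<bar>1\<bar>)"
    using powr_kernel_0[of p "b - x"] assms
    by (subst lborel_has_bochner_integral_real_affine_iff[of "1" _ _ "-x", symmetric]) auto
  moreover have "(\<lambda>u. indicator {0..b - x} (-x + 1 * u) * (-x + 1 * u) powr p)
     = (\<lambda>u. indicator {x..b} u * (u - x) powr p)"
    by (auto simp: fun_eq_iff indicator_def)
  ultimately show ?thesis by simp
qed

text \<open>Up to the factor $\Gamma(1-\beta)$ this is $D_{0+}^{\beta} f$; the right-sided derivative on
  $[0,1]$ is obtained from it by the reflection $y \mapsto 1 - y$.\<close>

definition frac_op :: "real \<Rightarrow> (real \<Rightarrow> real) \<Rightarrow> real \<Rightarrow> real" where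
  "frac_op \<beta> f x = f x / x powr \<beta> + \<beta> * (LBINT u:{0..x}. (f x - f u) / (x - u) powr (\<beta> + 1))"

text \<open>Real form of the fractional integral: the phases of orders \<beta> and 1 - \<beta>
  multiply to e^(i pi) = -1, which is the leading sign. \<open>has_gls_integral_gls_val\<close>
  links this total function to the actual notion of integral.\<close>

definition gls_val :: "real \<Rightarrow> (real \<Rightarrow> real) \<Rightarrow> (real \<Rightarrow> real) \<Rightarrow> real" where
  "gls_val \<beta> f g = - (1 / (Gamma \<beta> * Gamma (1 - \<beta>))) *
     (LBINT x:{0..1}. frac_op \<beta> f x * frac_op (1 - \<beta>) (\<lambda>y. g (1 - y) - g 1) (1 - x))"

text \<open>In contrast to \<open>holder_on\<close>, the bound holds on the whole line and its
  constant is explicit: the limit arguments need one constant for a whole sequence, and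
  mollification evaluates f outside [0,1].\<close>

definition holder :: "real \<Rightarrow> real \<Rightarrow> (real \<Rightarrow> real) \<Rightarrow> bool" where
  "holder \<alpha> L f \<longleftrightarrow> 0 \<le> L \<and> (\<forall>u v. \<bar>f u - f v\<bar> \<le> L * \<bar>u - v\<bar> powr \<alpha>)"

lemma holderD: "holder \<alpha> L f \<Longrightarrow> \<bar>f u - f v\<bar> \<le> L * \<bar>u - v\<bar> powr \<alpha>"
  and holder_nonneg: "holder \<alpha> L f \<Longrightarrow> 0 \<le> L"
  by (auto simp: holder_def)

lemma holder_continuous:
  assumes "holder \<alpha> L f" "\<alpha> > 0"
  shows "continuous_on UNIV f"
proof -
  have "isCont f x" for x
  proof -
    have "(\<lambda>u. L * \<bar>u - x\<bar> powr \<alpha>) \<midarrow>x\<rightarrow> L * \<bar>x - x\<bar> powr \<alpha>"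
      using assms(2) by (intro tendsto_intros) auto
    then have "(\<lambda>u. f u - f x) \<midarrow>x\<rightarrow> 0"
      by (intro Lim_null_comparison[of "\<lambda>u. f u - f x" "\<lambda>u. L * \<bar>u - x\<bar> powr \<alpha>"])
        (use assms holderD[OF assms(1)] in auto)
    then show ?thesis by (simp add: isCont_def LIM_zero_iff)
  qed
  then show ?thesis by (simp add: continuous_on_eq_continuous_at)
qed

lemma holder_borel:
  assumes "holder \<alpha> L f" "\<alpha> > 0"
  shows "f \<in> borel_measurable borel"
  by (rule borel_measurable_continuous_onI[OF holder_continuous[OF assms]])

lemma frac_op_borel [measurable]:
  assumes [measurable]: "f \<in> borel_measurable borel"
  shows "frac_op \<beta> f \<in> borel_measurable borel"
proof -
  \<comment> \<open>The interval of integration depends on x; writing its indicator as a condition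
    on the pair (x, u) makes joint measurability visible.\<close>
  have eq: "frac_op \<beta> f = (\<lambda>x. f x / x powr \<beta> + \<beta> *
     (\<integral>u. (if 0 \<le> u \<and> u \<le> x then 1 else 0) * ((f x - f u) / (x - u) powr (\<beta> + 1)) \<partial>lborel))"
    by (auto simp: frac_op_def fun_eq_iff set_lebesgue_integral_def indicator_def intro!: Bochner_Integration.integral_cong)
  show ?thesis unfolding eq by measurable
qed

lemma holder_quotient_le:
  assumes "holder \<alpha> L f" "u \<le> x"
  shows "\<bar>(f x - f u) / (x - u) powr (\<beta> + 1)\<bar> \<le> L * (x - u) powr (\<alpha> - \<beta> - 1)"
proof (cases "u = x")
  \<comment> \<open>On the diagonal both sides are 0, since \<open>0 powr p = 0\<close> and division
    by 0 gives 0.\<close>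
  case True then show ?thesis using holder_nonneg[OF assms(1)] by simp
next
  case False
  then have "x - u > 0" using assms by simp
  then have "\<bar>(f x - f u) / (x - u) powr (\<beta> + 1)\<bar> = \<bar>f x - f u\<bar> / (x - u) powr (\<beta> + 1)"
    by simp
  also have "\<dots> \<le> L * (x - u) powr \<alpha> / (x - u) powr (\<beta> + 1)"
    using holderD[OF assms(1), of x u] assms(2) by (intro divide_right_mono) auto
  also have "\<dots> = L * (x - u) powr (\<alpha> - \<beta> - 1)"
    using \<open>x - u > 0\<close> by (simp add: powr_diff powr_add)
  finally show ?thesis .
qed

lemma holder_quotient_integrable:
  assumes f: "holder \<alpha> L f" and ab: "0 < \<beta>" "\<beta> < \<alpha>" and x: "0 \<le> x"
  shows "set_integrable lborel {0..x} (\<lambda>u. (f x - f u) / (x - u) powr (\<beta> + 1))"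
    and "\<bar>LBINT u:{0..x}. (f x - f u) / (x - u) powr (\<beta> + 1)\<bar> \<le> L * (x powr (\<alpha> - \<beta>) / (\<alpha> - \<beta>))"
proof -
  have [measurable]: "f \<in> borel_measurable borel" by (rule holder_borel[OF f]) (use ab in auto)
  have k: "has_bochner_integral lborel (\<lambda>u. L * (indicator {0..x} u * (x - u) powr (\<alpha> - \<beta> - 1)))
           (L * (x powr (\<alpha> - \<beta>) / (\<alpha> - \<beta>)))"
    using powr_kernel_left[of "\<alpha> - \<beta> - 1" 0 x] ab x by (intro has_bochner_integral_mult_right) auto
  have bd: "norm (indicator {0..x} u *\<^sub>R ((f x - f u) / (x - u) powr (\<beta> + 1)))
      \<le> L * (indicator {0..x} u * (x - u) powr (\<alpha> - \<beta> - 1))" for u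
    using holder_quotient_le[OF f, of u x \<beta>] by (auto simp: indicator_def simp del: abs_divide)
  show i: "set_integrable lborel {0..x} (\<lambda>u. (f x - f u) / (x - u) powr (\<beta> + 1))"
    unfolding set_integrable_def
  proof (rule Bochner_Integration.integrable_bound[OF integrable.intros[OF k]])
    show "AE u in lborel. norm (indicator {0..x} u *\<^sub>R ((f x - f u) / (x - u) powr (\<beta> + 1)))
      \<le> norm (L * (indicator {0..x} u * (x - u) powr (\<alpha> - \<beta> - 1)))"
      by (rule AE_I2, rule order_trans[OF bd]) (simp add: abs_ge_self del: abs_mult)
  qed measurable
  have "norm (LBINT u:{0..x}. (f x - f u) / (x - u) powr (\<beta> + 1))
     \<le> (\<integral>u. L * (indicator {0..x} u * (x - u) powr (\<alpha> - \<beta> - 1)) \<partial>lborel)"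
    unfolding set_lebesgue_integral_def
    using integrable_norm[OF i[unfolded set_integrable_def]] integrable.intros[OF k]
    by (rule order_trans[OF integral_norm_bound integral_mono[OF _ _ bd]])
  then show "\<bar>LBINT u:{0..x}. (f x - f u) / (x - u) powr (\<beta> + 1)\<bar> \<le> L * (x powr (\<alpha> - \<beta>) / (\<alpha> - \<beta>))"
    using k by (simp add: has_bochner_integral_iff)
qed

lemma frac_op_bound:
  assumes f: "holder \<alpha> L f" and ab: "0 < \<beta>" "\<beta> < \<alpha>" "\<beta> < 1" and x: "0 \<le> x" "x \<le> 1"
  shows "\<bar>frac_op \<beta> f x\<bar> \<le> \<bar>f x\<bar> * x powr (-\<beta>) + L / (\<alpha> - \<beta>)"
proof -
  let ?I = "LBINT u:{0..x}. (f x - f u) / (x - u) powr (\<beta> + 1)"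
  have "\<bar>frac_op \<beta> f x\<bar> \<le> \<bar>f x / x powr \<beta>\<bar> + \<bar>\<beta> * ?I\<bar>"
    unfolding frac_op_def by (rule abs_triangle_ineq)
  moreover have "\<bar>f x / x powr \<beta>\<bar> = \<bar>f x\<bar> * x powr (-\<beta>)" by (simp add: powr_minus divide_inverse abs_mult)
  moreover have "\<bar>\<beta> * ?I\<bar> \<le> 1 * \<bar>?I\<bar>" unfolding abs_mult using ab by (intro mult_right_mono) auto
  moreover have "\<bar>?I\<bar> \<le> L * (x powr (\<alpha> - \<beta>) / (\<alpha> - \<beta>))"
    using holder_quotient_integrable[OF f] ab x by auto
  moreover have "x powr (\<alpha> - \<beta>) \<le> 1 powr (\<alpha> - \<beta>)" using ab x by (intro powr_mono2) auto
  then have "L * (x powr (\<alpha> - \<beta>) / (\<alpha> - \<beta>)) \<le> L * (1 / (\<alpha> - \<beta>))" 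
    using holder_nonneg[OF f] ab by (intro mult_left_mono divide_right_mono) auto
  ultimately show ?thesis by simp
qed

text \<open>With f(0) = 0 the boundary term is at most L x^(\<alpha>-\<beta>) and its singularity
  disappears. Applied to the reflected integrator, this is the source of the L-infinity
  condition.\<close>

lemma frac_op_bound_0:
  assumes f: "holder \<alpha> L f" and ab: "0 < \<beta>" "\<beta> < \<alpha>" "\<beta> < 1" and x: "0 \<le> x" "x \<le> 1" and f0: "f 0 = 0"
  shows "\<bar>frac_op \<beta> f x\<bar> \<le> L + L / (\<alpha> - \<beta>)"
proof -
  have "\<bar>f x\<bar> * x powr (-\<beta>) \<le> (L * x powr \<alpha>) * x powr (-\<beta>)"
    using holderD[OF f, of x 0] f0 x by (intro mult_right_mono) auto
  also have "\<dots> = L * x powr (\<alpha> - \<beta>)" by (simp add: powr_diff powr_minus divide_inverse)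
  also have "\<dots> \<le> L * 1 powr (\<alpha> - \<beta>)"
    using holder_nonneg[OF f] ab x by (intro mult_left_mono powr_mono2) auto
  finally show ?thesis using frac_op_bound[OF f ab x] by simp
qed

lemma frac_op_tendsto:
  assumes f: "\<And>k. holder \<alpha> L (F k)" "holder \<alpha> L f" and lim: "\<And>u. (\<lambda>k. F k u) \<longlonglongrightarrow> f u"
    and ab: "0 < \<beta>" "\<beta> < \<alpha>" and x: "0 \<le> x"
  shows "(\<lambda>k. frac_op \<beta> (F k) x) \<longlonglongrightarrow> frac_op \<beta> f x"
proof -
  have [measurable]: "f \<in> borel_measurable borel" "F k \<in> borel_measurable borel" for k
    using ab holder_borel[OF f(1)] holder_borel[OF f(2)] by auto
  have k: "integrable lborel (\<lambda>u. L * (indicator {0..x} u * (x - u) powr (\<alpha> - \<beta> - 1)))"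
    using powr_kernel_left[of "\<alpha> - \<beta> - 1" 0 x] ab x by (intro integrable_mult_right) (auto simp: has_bochner_integral_iff)
  have "(\<lambda>k. LBINT u:{0..x}. (F k x - F k u) / (x - u) powr (\<beta> + 1)) \<longlonglongrightarrow>
        (LBINT u:{0..x}. (f x - f u) / (x - u) powr (\<beta> + 1))"
    unfolding set_lebesgue_integral_def
  proof (rule integral_dominated_convergence[OF _ _ k])
    show "AE u in lborel. (\<lambda>i. indicator {0..x} u *\<^sub>R ((F i x - F i u) / (x - u) powr (\<beta> + 1)))
       \<longlonglongrightarrow> indicator {0..x} u *\<^sub>R ((f x - f u) / (x - u) powr (\<beta> + 1))"
      unfolding divide_inverse by (intro AE_I2 tendsto_scaleR tendsto_mult tendsto_diff tendsto_const lim)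
    show "AE u in lborel. norm (indicator {0..x} u *\<^sub>R ((F i x - F i u) / (x - u) powr (\<beta> + 1)))
      \<le> L * (indicator {0..x} u * (x - u) powr (\<alpha> - \<beta> - 1))" for i
      using holder_quotient_le[OF f(1), of _ x i \<beta>] by (auto simp: indicator_def simp del: abs_divide)
  qed auto
  moreover have "(\<lambda>k. F k x / x powr \<beta>) \<longlonglongrightarrow> f x / x powr \<beta>"
    unfolding divide_inverse by (intro tendsto_mult lim tendsto_const)
  ultimately show ?thesis unfolding frac_op_def by (intro tendsto_add tendsto_mult tendsto_const)
qed

lemma holder_reflect: "holder \<alpha> L g \<Longrightarrow> holder \<alpha> L (\<lambda>y. g (1 - y) - g 1)"
proof -
  assume g: "holder \<alpha> L g"
  have "\<bar>g (1 - u) - g 1 - (g (1 - v) - g 1)\<bar> \<le> L * \<bar>u - v\<bar> powr \<alpha>" for u v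
    using holderD[OF g, of "1 - u" "1 - v"] by (simp add: abs_minus_commute)
  then show ?thesis using holder_nonneg[OF g] by (simp add: holder_def)
qed

lemma holder_bounded_01:
  assumes "holder \<alpha> L f" "\<bar>f 0\<bar> \<le> c" "\<alpha> > 0" "0 \<le> x" "x \<le> 1"
  shows "\<bar>f x\<bar> \<le> c + L"
proof -
  have "L * \<bar>x - 0\<bar> powr \<alpha> \<le> L * 1 powr \<alpha>"
    using assms holder_nonneg[OF assms(1)] by (intro mult_left_mono powr_mono2) auto
  then show ?thesis using holderD[OF assms(1), of x 0] assms by simp
qed

text \<open>Integrand and integrator may vary together: common Hoelder constants give one dominating
  function for the inner quotients and one for the outer product, whose only singularity is
  x^(-\<beta>) at 0.\<close>

lemma gls_val_tendsto:
  assumes f: "\<And>k. holder \<alpha> L (F k)" "holder \<alpha> L f" "\<And>u. (\<lambda>k. F k u) \<longlonglongrightarrow> f u"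
    and g: "\<And>k. holder \<alpha>' L' (G k)" "holder \<alpha>' L' g" "\<And>u. (\<lambda>k. G k u) \<longlonglongrightarrow> g u"
    and ab: "0 < \<beta>" "\<beta> < \<alpha>" "\<beta> < 1" "1 - \<beta> < \<alpha>'"
  shows "(\<lambda>k. gls_val \<beta> (F k) (G k)) \<longlonglongrightarrow> gls_val \<beta> f g"
proof -
  have [measurable]: "f \<in> borel_measurable borel" "F k \<in> borel_measurable borel"
     "g \<in> borel_measurable borel" "G k \<in> borel_measurable borel" for k
    using ab holder_borel[OF f(1)] holder_borel[OF f(2)] holder_borel[OF g(1)] holder_borel[OF g(2)] by auto
  let ?R = "\<lambda>g y. g (1 - y) - g 1 :: real"
  \<comment> \<open>A convergent sequence is bounded; \<open>c + L\<close> then bounds every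
    \<open>F k\<close> on [0,1].\<close>
  obtain c where c: "\<And>k. \<bar>F k 0\<bar> \<le> c"
  proof -
    have "Bseq (\<lambda>k. F k 0)" using f(3)[of 0] by (intro convergent_imp_Bseq) (auto simp: convergent_def)
    then show ?thesis using that by (auto simp: Bseq_def)
  qed
  define w where "w x = ((c + L) * (indicator {0..1} x * x powr (-\<beta>)) + L / (\<alpha> - \<beta>) * indicator {0..1} x) * (L' + L' / (\<alpha>' - (1 - \<beta>)))" for x
  have k: "integrable lborel w"
    using powr_kernel_0[of "- \<beta>" 1] ab unfolding w_def
    by (intro integrable_mult_left integrable_mult_right Bochner_Integration.integrable_add) (auto simp: has_bochner_integral_iff)
  have L': "L' \<ge> 0" using holder_nonneg[OF g(2)] .
  have "(\<lambda>k. LBINT x:{0..1}. frac_op \<beta> (F k) x * frac_op (1 - \<beta>) (?R (G k)) (1 - x)) \<longlonglongrightarrow>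
       (LBINT x:{0..1}. frac_op \<beta> f x * frac_op (1 - \<beta>) (?R g) (1 - x))"
    unfolding set_lebesgue_integral_def
  proof (rule integral_dominated_convergence[OF _ _ k])
    have "(\<lambda>k. frac_op \<beta> (F k) x * frac_op (1 - \<beta>) (?R (G k)) (1 - x))
        \<longlonglongrightarrow> frac_op \<beta> f x * frac_op (1 - \<beta>) (?R g) (1 - x)" if x: "0 \<le> x" "x \<le> 1" for x
      using ab x
      by (intro tendsto_mult frac_op_tendsto[of \<alpha> L] frac_op_tendsto[of \<alpha>' L'] f holder_reflect g tendsto_diff) auto
    then show "AE x in lborel. (\<lambda>k. indicator {0..1} x *\<^sub>R (frac_op \<beta> (F k) x * frac_op (1 - \<beta>) (?R (G k)) (1 - x)))
        \<longlonglongrightarrow> indicator {0..1} x *\<^sub>R (frac_op \<beta> f x * frac_op (1 - \<beta>) (?R g) (1 - x))"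
      by (intro AE_I2) (auto simp: indicator_def)
    fix k
    have "\<bar>frac_op \<beta> (F k) x * frac_op (1 - \<beta>) (?R (G k)) (1 - x)\<bar> \<le> w x" if x: "0 \<le> x" "x \<le> 1" for x
      unfolding abs_mult
    proof -
      have "\<bar>frac_op \<beta> (F k) x\<bar> \<le> (c + L) * x powr (-\<beta>) + L / (\<alpha> - \<beta>)"
        using frac_op_bound[OF f(1) ab(1-3) x, of k] mult_right_mono[OF holder_bounded_01[OF f(1) c _ x], of "x powr (-\<beta>)" k] ab
        by auto
      moreover have "\<bar>frac_op (1 - \<beta>) (?R (G k)) (1 - x)\<bar> \<le> L' + L' / (\<alpha>' - (1 - \<beta>))"
        using ab x by (intro frac_op_bound_0[OF holder_reflect[OF g(1)]]) auto
      moreover have "L' + L' / (\<alpha>' - (1 - \<beta>)) \<ge> 0" using L' ab by auto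
      ultimately have "\<bar>frac_op \<beta> (F k) x\<bar> * \<bar>frac_op (1 - \<beta>) (?R (G k)) (1 - x)\<bar> \<le>
        ((c + L) * x powr (-\<beta>) + L / (\<alpha> - \<beta>)) * (L' + L' / (\<alpha>' - (1 - \<beta>)))"
        by (smt (verit) abs_ge_zero mult_mono)
      then show "\<bar>frac_op \<beta> (F k) x\<bar> * \<bar>frac_op (1 - \<beta>) (?R (G k)) (1 - x)\<bar> \<le> w x"
        using x by (simp add: w_def)
    qed
    then show "AE x in lborel. norm (indicator {0..1} x *\<^sub>R (frac_op \<beta> (F k) x * frac_op (1 - \<beta>) (?R (G k)) (1 - x))) \<le> w x"
      by (intro AE_I2) (auto simp: indicator_def w_def)
  qed auto
  then show ?thesis unfolding gls_val_def by (intro tendsto_mult tendsto_const)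
qed

section \<open>The integral of smooth functions\<close>

lemma set_integrable_powr_kernel:
  fixes \<phi> :: "real \<Rightarrow> real"
  assumes [measurable]: "\<phi> \<in> borel_measurable borel" and K: "\<And>u. \<bar>\<phi> u\<bar> \<le> K"
    and p: "p > -1" "a \<le> x"
  shows "set_integrable lborel {a..x} (\<lambda>u. \<phi> u * (x - u) powr p)"
  unfolding set_integrable_def
proof (rule Bochner_Integration.integrable_bound)
  show "integrable lborel (\<lambda>u. K * (indicator {a..x} u * (x - u) powr p))"
    using powr_kernel_left[OF p] by (intro integrable_mult_right) (auto simp: has_bochner_integral_iff)
  have "\<bar>\<phi> u * (x - u) powr p\<bar> \<le> \<bar>K * (x - u) powr p\<bar>" for u
    using K[of u] unfolding abs_mult by (intro mult_right_mono) auto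
  then show "AE u in lborel. norm (indicator {a..x} u *\<^sub>R (\<phi> u * (x - u) powr p))
     \<le> norm (K * (indicator {a..x} u * (x - u) powr p))"
    by (intro AE_I2) (auto simp: indicator_def)
qed measurable

text \<open>Integration by parts: the difference quotient of Marchaud type is exchanged for the
  Caputo form, a boundary term plus the fractional integral of f'.\<close>

lemma frac_op_smooth:
  assumes f: "holder 1 K f" and f': "\<And>u. (f has_real_derivative f' u) (at u)"
    and c: "continuous_on UNIV f'" and K: "\<And>u. \<bar>f' u\<bar> \<le> K"
    and b: "0 < \<beta>" "\<beta> < 1" and x: "0 \<le> x"
  shows "frac_op \<beta> f x = f 0 * x powr (-\<beta>) + (LBINT u:{0..x}. f' u * (x - u) powr (-\<beta>))"
proof (cases "x = 0")
  case True
  \<comment> \<open>At x = 0 both sides are 0: powers of 0 and quotients by 0 are 0, and the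
    integrals run over a single point.\<close>
  have "(LBINT u:{0..0}. h u) = 0" if "h 0 = 0" for h :: "real \<Rightarrow> real"
    unfolding set_lebesgue_integral_def using that by (intro integral_eq_zero_AE AE_I2) (simp add: indicator_def)
  then show ?thesis using True by (simp add: frac_op_def)
next
  case False
  then have x: "0 < x" using x by simp
  define q where "q u = (f x - f u) / (x - u) powr (\<beta> + 1)" for u
  \<comment> \<open>The boundary term of the integration by parts. Its derivative is the difference
    of the two integrands, and it tends to 0 at u = x because f is Lipschitz and \<beta> <
    1.\<close>
  define F where "F u = (f x - f u) * (x - u) powr (-\<beta>)" for u
  have i1: "set_integrable lborel {0..x} q"
    using holder_quotient_integrable(1)[OF f b] x unfolding q_def by simp
  have i2: "set_integrable lborel {0..x} (\<lambda>u. f' u * (x - u) powr (-\<beta>))"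
    using b x by (intro set_integrable_powr_kernel[OF _ K] borel_measurable_continuous_onI[OF c]) auto
  have "isCont F u" if "u < x" for u
    unfolding F_def using that f' by (intro continuous_intros DERIV_isCont) auto
  moreover have "(F \<longlongrightarrow> F x) (at x within {0..x})"
  proof -
    have "(F \<longlongrightarrow> 0) (at x within {0..x})"
    proof (rule Lim_null_comparison)
      have "norm (F u) \<le> K * \<bar>x - u\<bar> powr (1 - \<beta>)" if "u < x" for u
      proof -
        have "\<bar>F u\<bar> = \<bar>f x - f u\<bar> * (x - u) powr (-\<beta>)" unfolding F_def abs_mult by simp
        also have "\<dots> \<le> (K * \<bar>x - u\<bar> powr 1) * (x - u) powr (-\<beta>)"
          by (intro mult_right_mono holderD[OF f]) auto
        also have "\<dots> = K * \<bar>x - u\<bar> powr (1 - \<beta>)"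
          using that by (simp add: powr_diff powr_minus divide_inverse)
        finally show ?thesis by simp
      qed
      then show "\<forall>\<^sub>F u in at x within {0..x}. norm (F u) \<le> K * \<bar>x - u\<bar> powr (1 - \<beta>)"
        by (auto simp: eventually_at_filter)
      have "((\<lambda>u. K * \<bar>x - u\<bar> powr (1 - \<beta>)) \<longlongrightarrow> K * \<bar>x - x\<bar> powr (1 - \<beta>)) (at x within {0..x})"
        using b by (intro tendsto_intros) auto
      then show "((\<lambda>u. K * \<bar>x - u\<bar> powr (1 - \<beta>)) \<longlongrightarrow> 0) (at x within {0..x})" by simp
    qed
    then show ?thesis by (simp add: F_def)
  qed
  ultimately have cF: "continuous_on {0..x} F"
    unfolding continuous_on_def isCont_def by (metis atLeastAtMost_iff less_eq_real_def tendsto_within_subset subset_UNIV)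
  have "((\<lambda>u. \<beta> * q u - f' u * (x - u) powr (-\<beta>)) has_integral (F x - F 0)) {0..x}"
  proof (rule fundamental_theorem_of_calculus_interior_strong[of "{}"])
    show "(F has_vector_derivative \<beta> * q u - f' u * (x - u) powr (-\<beta>)) (at u)" if "u \<in> {0<..<x} - {}" for u
    proof -
      have u: "x - u > 0" using that by auto
      have "(F has_real_derivative
          (- f' u) * (x - u) powr (-\<beta>) + ((-1) * (-\<beta> * (x - u) powr (-\<beta> - 1))) * (f x - f u)) (at u)"
        unfolding F_def
        by (rule derivative_eq_intros DERIV_fun_powr f' refl u | simp add: u)+
      moreover have "(x - u) powr (-\<beta> - 1) = 1 / (x - u) powr (\<beta> + 1)"
        using u by (simp add: powr_diff powr_add powr_minus divide_inverse)
      ultimately show ?thesis unfolding q_def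
        by (simp add: has_real_derivative_iff_has_vector_derivative algebra_simps)
    qed
  qed (use cF x in auto)
  moreover have "((\<lambda>u. \<beta> * q u - f' u * (x - u) powr (-\<beta>)) has_integral
      (\<beta> * (LBINT u:{0..x}. q u) - (LBINT u:{0..x}. f' u * (x - u) powr (-\<beta>)))) {0..x}"
    using set_borel_integral_eq_integral[OF i1] set_borel_integral_eq_integral[OF i2]
    by (intro has_integral_diff has_integral_mult_right) (auto simp: has_integral_integral)
  ultimately have "F x - F 0 = \<beta> * (LBINT u:{0..x}. q u) - (LBINT u:{0..x}. f' u * (x - u) powr (-\<beta>))"
    by (rule has_integral_unique)
  then show ?thesis unfolding frac_op_def q_def[symmetric]
    using x by (simp add: F_def powr_minus divide_inverse algebra_simps)
qed

text \<open>The exponents add up to -1, so the scaling factors of the affine map onto [0,1] cancel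
  and the Beta integral comes out independent of p and q.\<close>

lemma beta_kernel:
  fixes p q \<beta> :: real
  assumes b: "0 < \<beta>" "\<beta> < 1" and pq: "p < q"
  shows "has_bochner_integral lborel
    (\<lambda>x. indicator {p..q} x * ((x - p) powr (-\<beta>) * (q - x) powr (\<beta> - 1))) (Gamma \<beta> * Gamma (1 - \<beta>))"
proof -
  let ?f = "\<lambda>t. indicator {0..1} t * (t powr (1 - \<beta> - 1) * (1 - t) powr (\<beta> - 1)) :: real"
  have "has_bochner_integral lborel ?f (Beta (1 - \<beta>) \<beta>)"
    by (rule has_bochner_integral_lborel_nonneg) (use has_integral_Beta_real[of "1 - \<beta>" \<beta>] b in auto)
  then have "has_bochner_integral lborel (\<lambda>x. ?f (- p / (q - p) + (1 / (q - p)) * x)) (Beta (1 - \<beta>) \<beta> /\<^sub>R \<bar>1 / (q - p)\<bar>)"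
    using pq by (subst lborel_has_bochner_integral_real_affine_iff[of "1 / (q - p)" _ _ "- p / (q - p)", symmetric]) auto
  then have "has_bochner_integral lborel (\<lambda>x. (1 / (q - p)) * ?f (- p / (q - p) + (1 / (q - p)) * x))
      ((1 / (q - p)) * (Beta (1 - \<beta>) \<beta> /\<^sub>R \<bar>1 / (q - p)\<bar>))"
    by (rule has_bochner_integral_mult_right)
  moreover have "(1 / (q - p)) * (Beta (1 - \<beta>) \<beta> /\<^sub>R \<bar>1 / (q - p)\<bar>) = Gamma \<beta> * Gamma (1 - \<beta>)"
    using pq by (simp add: Beta_def)
  moreover have "(1 / (q - p)) * ?f (- p / (q - p) + (1 / (q - p)) * x) =
      indicator {p..q} x * ((x - p) powr (-\<beta>) * (q - x) powr (\<beta> - 1))" for x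
  proof -
    have t: "- p / (q - p) + (1 / (q - p)) * x = (x - p) / (q - p)" by (simp add: diff_divide_distrib)
    have t1: "1 - (x - p) / (q - p) = (q - x) / (q - p)" using pq by (simp add: field_simps)
    have "(q - p) powr (-\<beta>) * (q - p) powr (\<beta> - 1) = 1 / (q - p)"
      using pq unfolding powr_add[symmetric] by (simp add: powr_neg_one)
    moreover have "x \<in> {p..q} \<longleftrightarrow> (x - p) / (q - p) \<in> {0..1}" using pq by (auto simp: divide_simps)
    ultimately show ?thesis unfolding t t1 using pq 
      by (auto simp: indicator_def powr_divide)
  qed
  ultimately show ?thesis by simp
qed

text \<open>Integrability on the product is checked by Tonelli for the nonnegative kernel alone; the
  signed factor \<gamma> costs only the constant K.\<close>

lemma Fubini_bounded_kernel:
  fixes k \<gamma> :: "real \<Rightarrow> real \<Rightarrow> real"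
  assumes k[measurable]: "(\<lambda>(x, w). k x w) \<in> borel_measurable (lborel \<Otimes>\<^sub>M lborel)"
    and \<gamma>[measurable]: "(\<lambda>(x, w). \<gamma> x w) \<in> borel_measurable (lborel \<Otimes>\<^sub>M lborel)"
    and k0: "\<And>x w. 0 \<le> k x w" and K: "\<And>x w. \<bar>\<gamma> x w\<bar> \<le> K"
    and c: "\<And>x. (\<integral>\<^sup>+w. k x w \<partial>lborel) \<le> ennreal (c x)" "\<And>x. 0 \<le> c x" "integrable lborel c"
  shows "(\<integral>x. (\<integral>w. k x w * \<gamma> x w \<partial>lborel) \<partial>lborel) = (\<integral>w. (\<integral>x. k x w * \<gamma> x w \<partial>lborel) \<partial>lborel)"
    and "integrable lborel (\<lambda>x. \<integral>w. k x w * \<gamma> x w \<partial>lborel)"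
proof -
  have i: "integrable (lborel \<Otimes>\<^sub>M lborel) (\<lambda>(x, w). k x w * \<gamma> x w)"
  proof (rule integrableI_bounded)
    have "(\<integral>\<^sup>+z. ennreal (norm (case z of (x, w) \<Rightarrow> k x w * \<gamma> x w)) \<partial>(lborel \<Otimes>\<^sub>M lborel))
       \<le> (\<integral>\<^sup>+z. ennreal K * ennreal (case z of (x, w) \<Rightarrow> k x w) \<partial>(lborel \<Otimes>\<^sub>M lborel))"
    proof (rule nn_integral_mono)
      fix z :: "real \<times> real"
      obtain x w where z: "z = (x, w)" by (cases z)
      have "\<bar>k x w * \<gamma> x w\<bar> = k x w * \<bar>\<gamma> x w\<bar>" using k0[of x w] by (simp add: abs_mult)
      also have "\<dots> \<le> k x w * K" by (rule mult_left_mono[OF K k0])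
      finally show "ennreal (norm (case z of (x, w) \<Rightarrow> k x w * \<gamma> x w)) \<le> ennreal K * ennreal (case z of (x, w) \<Rightarrow> k x w)"
        using k0[of x w] order_trans[OF abs_ge_zero K[of x w]] by (simp add: z ennreal_mult'[symmetric] ennreal_leI mult.commute)
    qed
    also have "\<dots> = ennreal K * (\<integral>\<^sup>+x. (\<integral>\<^sup>+w. k x w \<partial>lborel) \<partial>lborel)"
      by (subst nn_integral_cmult) (auto simp: lborel.nn_integral_fst[symmetric])
    also have "\<dots> \<le> ennreal K * (\<integral>\<^sup>+x. c x \<partial>lborel)"
      by (intro mult_left_mono nn_integral_mono c) auto
    also have "\<dots> < \<infinity>"
      using nn_integral_eq_integral[OF c(3)] c(2) by (simp add: ennreal_mult_less_top)
    finally show "(\<integral>\<^sup>+z. ennreal (norm (case z of (x, w) \<Rightarrow> k x w * \<gamma> x w)) \<partial>(lborel \<Otimes>\<^sub>M lborel)) < \<infinity>" .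
  qed measurable
  show "(\<integral>x. (\<integral>w. k x w * \<gamma> x w \<partial>lborel) \<partial>lborel) = (\<integral>w. (\<integral>x. k x w * \<gamma> x w \<partial>lborel) \<partial>lborel)"
    by (rule lborel_pair.Fubini_integral[symmetric]) (use i in simp)
  show "integrable lborel (\<lambda>x. \<integral>w. k x w * \<gamma> x w \<partial>lborel)"
    using lborel_pair.integrable_fst[OF i] by simp
qed

text \<open>Fractional integrals of orders 1 - \<beta> and \<beta> compose to ordinary integration:
  after Fubini the inner integral over x is the Beta kernel between u and 1 - w.\<close>

lemma iterated_kernel:
  fixes \<gamma> :: "real \<Rightarrow> real"
  assumes \<gamma>[measurable]: "\<gamma> \<in> borel_measurable borel" and K: "\<And>u. \<bar>\<gamma> u\<bar> \<le> K"
    and b: "0 < \<beta>" "\<beta> < 1" and u: "0 \<le> u" "u \<le> 1"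
  shows "(LBINT x:{u..1}. (x - u) powr (-\<beta>) * (LBINT w:{0..1 - x}. \<gamma> w * (1 - x - w) powr (\<beta> - 1)))
    = Gamma \<beta> * Gamma (1 - \<beta>) * (LBINT w:{0..1 - u}. \<gamma> w)" (is "?l = ?r")
proof -
  \<comment> \<open>The triangle of integration is part of the kernel, so exchanging the integrals
    leaves their limits alone.\<close>
  define k where "k x w = (if u \<le> x \<and> 0 \<le> w \<and> w \<le> 1 - x then (x - u) powr (-\<beta>) * (1 - x - w) powr (\<beta> - 1) else 0)" for x w
  have "?l = (\<integral>x. (\<integral>w. k x w * \<gamma> w \<partial>lborel) \<partial>lborel)"
    unfolding set_lebesgue_integral_def
  proof (rule Bochner_Integration.integral_cong[OF refl])
    fix x
    show "indicator {u..1} x *\<^sub>R ((x - u) powr (-\<beta>) * (\<integral>w. indicator {0..1 - x} w *\<^sub>R (\<gamma> w * (1 - x - w) powr (\<beta> - 1)) \<partial>lborel))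
      = (\<integral>w. k x w * \<gamma> w \<partial>lborel)"
    proof (cases "x \<in> {u..1}")
      case True
      then show ?thesis unfolding integral_mult_right_zero[symmetric] integral_scaleR_right[symmetric]
        by (intro Bochner_Integration.integral_cong) (auto simp: k_def indicator_def)
    next
      case False
      then have "k x w = 0" for w unfolding k_def by auto
      then show ?thesis using False by simp
    qed
  qed
  also have "\<dots> = (\<integral>w. (\<integral>x. k x w * \<gamma> w \<partial>lborel) \<partial>lborel)"
  proof (rule Fubini_bounded_kernel(1)[OF _ _ _ K])
    show "(\<lambda>(x, w). k x w) \<in> borel_measurable (lborel \<Otimes>\<^sub>M lborel)"
      unfolding k_def by measurable
    show "0 \<le> k x w" for x w by (simp add: k_def)
    show "(\<integral>\<^sup>+w. k x w \<partial>lborel) \<le> ennreal (1 / \<beta> * (indicator {u..1} x * (x - u) powr (-\<beta>)))" for x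
    proof (cases "u \<le> x \<and> x \<le> 1")
      case True
      have "(\<integral>\<^sup>+w. k x w \<partial>lborel) = (\<integral>\<^sup>+w. ennreal ((x - u) powr (-\<beta>) * (indicator {0..1 - x} w * (1 - x - w) powr (\<beta> - 1))) \<partial>lborel)"
        using True by (intro nn_integral_cong) (auto simp: k_def indicator_def)
      also have "\<dots> = ennreal ((x - u) powr (-\<beta>) * ((1 - x - 0) powr (\<beta> - 1 + 1) / (\<beta> - 1 + 1)))"
        using has_bochner_integral_mult_right[OF powr_kernel_left[of "\<beta> - 1" 0 "1 - x"], of "(x - u) powr (-\<beta>)"] b True
        by (subst nn_integral_eq_integral) (auto simp: has_bochner_integral_iff)
      also have "\<dots> \<le> ennreal (1 / \<beta> * (indicator {u..1} x * (x - u) powr (-\<beta>)))"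
      proof (rule ennreal_leI)
        have "(1 - x) powr \<beta> \<le> 1 powr \<beta>" using True u b by (intro powr_mono2) auto
        then have "(1 - x) powr \<beta> / \<beta> \<le> 1 / \<beta>" using b by (intro divide_right_mono) auto
        from mult_left_mono[OF this, of "(x - u) powr (-\<beta>)"] 
        show "(x - u) powr (-\<beta>) * ((1 - x - 0) powr (\<beta> - 1 + 1) / (\<beta> - 1 + 1)) \<le> 1 / \<beta> * (indicator {u..1} x * (x - u) powr (-\<beta>))"
          using True by simp
      qed
      finally show ?thesis .
    next
      case False
      then have "k x w = 0" for w unfolding k_def by auto
      then show ?thesis by simp
    qed
    show "integrable lborel (\<lambda>x. 1 / \<beta> * (indicator {u..1} x * (x - u) powr (-\<beta>)))"
      using powr_kernel_right[of "-\<beta>" u 1] b u by (intro integrable_mult_right) (auto simp: has_bochner_integral_iff)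
  qed (use b in auto)
  also have "\<dots> = (\<integral>w. Gamma \<beta> * Gamma (1 - \<beta>) * (indicator {0..1 - u} w *\<^sub>R \<gamma> w) \<partial>lborel)"
  proof (rule integral_cong_AE)
    show "AE w in lborel. (\<integral>x. k x w * \<gamma> w \<partial>lborel) = Gamma \<beta> * Gamma (1 - \<beta>) * (indicator {0..1 - u} w *\<^sub>R \<gamma> w)"
      \<comment> \<open>The Beta kernel needs u < 1 - w; the exceptional point w = 1 - u is a null
        set.\<close>
      using AE_lborel_singleton[of "1 - u"]
    proof eventually_elim
      case (elim w)
      show ?case
      proof (cases "0 \<le> w \<and> w < 1 - u")
        case True
        have "(\<integral>x. k x w \<partial>lborel) = (\<integral>x. indicator {u..1 - w} x * ((x - u) powr (-\<beta>) * ((1 - w) - x) powr (\<beta> - 1)) \<partial>lborel)"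
          using True by (intro Bochner_Integration.integral_cong) (auto simp: k_def indicator_def algebra_simps)
        also have "\<dots> = Gamma \<beta> * Gamma (1 - \<beta>)"
          using beta_kernel[OF b, of u "1 - w"] True by (auto simp: has_bochner_integral_iff)
        finally show ?thesis using True by simp
      next
        case False
        then have "k x w = 0" for x using elim by (auto simp: k_def)
        then show ?thesis using False elim by (auto simp: indicator_def)
      qed
    qed
    have [measurable]: "(\<lambda>(x, w). k x w) \<in> borel_measurable (lborel \<Otimes>\<^sub>M lborel)"
      unfolding k_def by measurable
    show "(\<lambda>w. \<integral>x. k x w * \<gamma> w \<partial>lborel) \<in> borel_measurable lborel" by measurable
  qed measurable
  also have "\<dots> = ?r" by (simp add: set_lebesgue_integral_def)
  finally show ?thesis .
qed

definition c1_bounded :: "real \<Rightarrow> (real \<Rightarrow> real) \<Rightarrow> (real \<Rightarrow> real) \<Rightarrow> bool" where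
  "c1_bounded K f f' \<longleftrightarrow> holder 1 K f \<and> (\<forall>u. (f has_real_derivative f' u) (at u)) \<and>
     continuous_on UNIV f' \<and> (\<forall>u. \<bar>f' u\<bar> \<le> K)"

lemma c1_bounded_reflect:
  assumes "c1_bounded K g g'"
  shows "c1_bounded K (\<lambda>y. g (1 - y) - g 1) (\<lambda>y. - g' (1 - y))"
  unfolding c1_bounded_def
proof (intro conjI allI)
  show "holder 1 K (\<lambda>y. g (1 - y) - g 1)" using assms by (auto simp: c1_bounded_def intro: holder_reflect)
  show "((\<lambda>y. g (1 - y) - g 1) has_real_derivative - g' (1 - u)) (at u)" for u
  proof -
    have "((\<lambda>y. g (1 - y)) has_real_derivative g' (1 - u) * (- 1)) (at u)"
      using assms by (intro DERIV_chain2[of g]) (auto simp: c1_bounded_def intro!: derivative_eq_intros)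
    from DERIV_diff[OF this DERIV_const[of "g 1"]] show ?thesis by simp
  qed
  have "continuous_on UNIV g'" using assms by (simp add: c1_bounded_def)
  then show "continuous_on UNIV (\<lambda>y. - g' (1 - y))"
    by (intro continuous_on_minus continuous_on_compose2[of UNIV g' UNIV "\<lambda>y. 1 - y"]) (auto intro!: continuous_intros)
  show "\<bar>- g' (1 - u)\<bar> \<le> K" for u using assms by (simp add: c1_bounded_def)
qed

lemma c1_bounded_FTC:
  assumes "c1_bounded K f f'" "a \<le> b"
  shows "(LBINT u:{a..b}. f' u) = f b - f a"
proof -
  have "(\<integral>u. indicator {a..b} u *\<^sub>R f' u \<partial>lborel) = f b - f a"
    using assms by (intro integral_FTC_atLeastAtMost)
      (auto simp: c1_bounded_def has_real_derivative_iff_has_vector_derivative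
        intro: has_vector_derivative_at_within continuous_on_subset)
  then show ?thesis by (simp add: set_lebesgue_integral_def)
qed

text \<open>The Caputo form splits \<open>frac_op \<beta> f\<close> into a part from f(0) and the
  fractional integral of f'. Paired with the fractional derivative of g, their kernels produce
  increments g(u) - g(1), and a classical integration by parts moves the derivative back to
  g.\<close>

lemma gls_val_c1:
  assumes f: "c1_bounded K f f'" and g: "c1_bounded K2 g g'" and b: "0 < \<beta>" "\<beta> < 1"
  shows "gls_val \<beta> f g = (LBINT x:{0..1}. f x * g' x)"
proof -
  let ?\<Gamma> = "Gamma \<beta> * Gamma (1 - \<beta>)"
  define gt where "gt = (\<lambda>y. g (1 - y) - g 1)"
  define \<gamma> where "\<gamma> = (\<lambda>y. - g' (1 - y))"
  have gt: "c1_bounded K2 gt \<gamma>" unfolding gt_def \<gamma>_def by (rule c1_bounded_reflect[OF g])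
  have gt0: "gt 0 = 0" by (simp add: gt_def)
  have cont: "continuous_on UNIV f'" "continuous_on UNIV \<gamma>" "continuous_on UNIV g'" "continuous_on UNIV f" "continuous_on UNIV g"
    using f gt g by (auto simp: c1_bounded_def intro: DERIV_continuous_on holder_continuous)
  note [measurable] = cont[THEN borel_measurable_continuous_onI]
  have [measurable]: "gt \<in> borel_measurable borel" unfolding gt_def by measurable
  define a where "a = frac_op (1 - \<beta>) gt"
  have [measurable]: "a \<in> borel_measurable borel" unfolding a_def by measurable
  have a_eq: "a y = (LBINT w:{0..y}. \<gamma> w * (y - w) powr (\<beta> - 1))" if "0 \<le> y" for y
    using frac_op_smooth[of K2 gt \<gamma> "1 - \<beta>" y] gt gt0 b that unfolding a_def by (simp add: c1_bounded_def)
  define p where "p x = (LBINT u:{0..x}. f' u * (x - u) powr (-\<beta>))" for x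
  have f_eq: "frac_op \<beta> f x = f 0 * x powr (-\<beta>) + p x" if "0 \<le> x" for x
    using frac_op_smooth[of K f f' \<beta> x] f b that unfolding p_def by (simp add: c1_bounded_def)
  define M where "M = K2 + K2 / \<beta>"
  have a_bd: "\<bar>a y\<bar> \<le> M" if "0 \<le> y" "y \<le> 1" for y
    using frac_op_bound_0[of 1 K2 gt "1 - \<beta>" y] gt gt0 b that unfolding a_def M_def by (simp add: c1_bounded_def)
  \<comment> \<open>The composition law undoes the fractional derivative of g. The case u = 0 serves
    the boundary term of f, general u the integral of f'.\<close>
  have kern: "(LBINT x:{u..1}. (x - u) powr (-\<beta>) * a (1 - x)) = ?\<Gamma> * (g u - g 1)" if u: "0 \<le> u" "u \<le> 1" for u
  proof -
    have "(LBINT x:{u..1}. (x - u) powr (-\<beta>) * a (1 - x)) =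
        (LBINT x:{u..1}. (x - u) powr (-\<beta>) * (LBINT w:{0..1 - x}. \<gamma> w * (1 - x - w) powr (\<beta> - 1)))"
      using u by (intro set_lebesgue_integral_cong) (auto simp: a_eq)
    also have "\<dots> = ?\<Gamma> * (LBINT w:{0..1 - u}. \<gamma> w)"
      using gt by (intro iterated_kernel[of \<gamma> K2] b u) (auto simp: c1_bounded_def)
    also have "\<dots> = ?\<Gamma> * (g u - g 1)" using c1_bounded_FTC[OF gt, of 0 "1 - u"] u by (simp add: gt_def)
    finally show ?thesis .
  qed
  define k where "k x u = (if 0 \<le> u \<and> u \<le> x \<and> x \<le> 1 then (x - u) powr (-\<beta>) else 0)" for x u
  define q where "q x u = f' u * (if 0 \<le> x \<and> x \<le> 1 then a (1 - x) else 0)" for x u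
  have M0: "0 \<le> M" using a_bd[of 0] by simp
  have "K \<ge> 0" using f by (auto simp: c1_bounded_def holder_def)
  have q_bd: "\<bar>q x u\<bar> \<le> K * M" for x u
    unfolding q_def abs_mult using f a_bd[of "1 - x"] M0 \<open>K \<ge> 0\<close> by (intro mult_mono) (auto simp: c1_bounded_def)
  have k_bd: "(\<integral>\<^sup>+u. k x u \<partial>lborel) \<le> ennreal (1 / (1 - \<beta>) * indicator {0..1} x)" for x
  proof (cases "0 \<le> x \<and> x \<le> 1")
    case True
    have "(\<integral>\<^sup>+u. k x u \<partial>lborel) = (\<integral>\<^sup>+u. ennreal (indicator {0..x} u * (x - u) powr (-\<beta>)) \<partial>lborel)"
      using True by (intro nn_integral_cong) (auto simp: k_def indicator_def)
    also have "\<dots> = ennreal ((x - 0) powr (- \<beta> + 1) / (- \<beta> + 1))"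
      using powr_kernel_left[of "-\<beta>" 0 x] b True
      by (subst nn_integral_eq_integral) (auto simp: has_bochner_integral_iff)
    also have "\<dots> \<le> ennreal (1 / (1 - \<beta>) * indicator {0..1} x)"
      using True b powr_mono2[of "1 - \<beta>" x 1] by (intro ennreal_leI) (auto simp: divide_right_mono)
    finally show ?thesis .
  next
    case False
    then have "k x w = 0" for w unfolding k_def by auto
    then show ?thesis by simp
  qed
  have [measurable]: "(\<lambda>(x, u). k x u) \<in> borel_measurable (lborel \<Otimes>\<^sub>M lborel)"
    unfolding k_def by measurable
  have [measurable]: "(\<lambda>(x, u). q x u) \<in> borel_measurable (lborel \<Otimes>\<^sub>M lborel)"
    unfolding q_def by measurable
  have kq: "k x u = 0 \<or> (0 \<le> u \<and> u \<le> x \<and> x \<le> 1)" for x u by (auto simp: k_def)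
  note Fub = Fubini_bounded_kernel[of k q "K * M" "\<lambda>x. 1 / (1 - \<beta>) * indicator {0..1} x"]
  have eq1: "(\<integral>u. k x u * q x u \<partial>lborel) = indicator {0..1} x *\<^sub>R (p x * a (1 - x))" for x
  proof (cases "0 \<le> x \<and> x \<le> 1")
    case True
    have "p x * a (1 - x) = (\<integral>u. (indicator {0..x} u *\<^sub>R (f' u * (x - u) powr (-\<beta>))) * a (1 - x) \<partial>lborel)"
      unfolding p_def set_lebesgue_integral_def by simp
    also have "\<dots> = (\<integral>u. k x u * q x u \<partial>lborel)"
      using True by (intro Bochner_Integration.integral_cong) (auto simp: k_def q_def indicator_def)
    finally show ?thesis using True by simp
  next
    case False
    then have "k x w = 0" for w unfolding k_def by auto
    then show ?thesis using False by simp
  qed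
  have eq2: "(\<integral>x. k x u * q x u \<partial>lborel) = indicator {0..1} u *\<^sub>R (?\<Gamma> * (f' u * (g u - g 1)))" for u
  proof (cases "0 \<le> u \<and> u \<le> 1")
    case True
    have "?\<Gamma> * (f' u * (g u - g 1)) = f' u * (LBINT x:{u..1}. (x - u) powr (-\<beta>) * a (1 - x))"
      using kern True by simp
    also have "\<dots> = (\<integral>x. f' u * (indicator {u..1} x *\<^sub>R ((x - u) powr (-\<beta>) * a (1 - x))) \<partial>lborel)"
      unfolding set_lebesgue_integral_def by simp
    also have "\<dots> = (\<integral>x. k x u * q x u \<partial>lborel)"
      using True by (intro Bochner_Integration.integral_cong) (auto simp: k_def q_def indicator_def)
    finally show ?thesis using True by simp
  next
    case False
    then have "k x u = 0" for x unfolding k_def by auto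
    then show ?thesis using False by simp
  qed
  have ci: "integrable lborel (\<lambda>x. 1 / (1 - \<beta>) * indicator {0..1::real} x)"
    by (intro integrable_mult_right) auto
  have T2: "(LBINT x:{0..1}. p x * a (1 - x)) = ?\<Gamma> * (LBINT u:{0..1}. f' u * (g u - g 1))"
    and i2: "set_integrable lborel {0..1} (\<lambda>x. p x * a (1 - x))"
  proof -
    have "(\<integral>x. indicator {0..1} x *\<^sub>R (p x * a (1 - x)) \<partial>lborel) = (\<integral>u. indicator {0..1} u *\<^sub>R (?\<Gamma> * (f' u * (g u - g 1))) \<partial>lborel)"
      unfolding eq1[symmetric] eq2[symmetric]
      by (rule Fub(1)[OF _ _ _ q_bd k_bd _ ci]) (use b in \<open>auto simp: k_def\<close>)
    also have "\<dots> = (LBINT u:{0..1}. ?\<Gamma> * (f' u * (g u - g 1)))" by (simp only: set_lebesgue_integral_def)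
    also have "\<dots> = ?\<Gamma> * (LBINT u:{0..1}. f' u * (g u - g 1))" by (rule set_integral_mult_right)
    finally show "(LBINT x:{0..1}. p x * a (1 - x)) = ?\<Gamma> * (LBINT u:{0..1}. f' u * (g u - g 1))"
      by (simp add: set_lebesgue_integral_def)
    show "set_integrable lborel {0..1} (\<lambda>x. p x * a (1 - x))"
      unfolding set_integrable_def eq1[symmetric]
      by (rule Fub(2)[OF _ _ _ q_bd k_bd _ ci]) (use b in \<open>auto simp: k_def\<close>)
  qed
  have i1: "set_integrable lborel {0..1} (\<lambda>x. x powr (-\<beta>) * a (1 - x))"
    unfolding set_integrable_def
  proof (rule Bochner_Integration.integrable_bound)
    show "integrable lborel (\<lambda>x. M * (indicator {0..1} x * x powr (-\<beta>)))"
      using powr_kernel_0[of "-\<beta>" 1] b by (intro integrable_mult_right) (auto simp: has_bochner_integral_iff)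
    have "\<bar>x powr (-\<beta>) * a (1 - x)\<bar> \<le> \<bar>M * x powr (-\<beta>)\<bar>" if "0 \<le> x" "x \<le> 1" for x
      using a_bd[of "1 - x"] that M0 by (simp add: abs_mult mult.commute[of "x powr _"] mult_right_mono)
    then show "AE x in lborel. norm (indicator {0..1} x *\<^sub>R (x powr (-\<beta>) * a (1 - x)))
       \<le> norm (M * (indicator {0..1} x * x powr (-\<beta>)))"
      by (intro AE_I2) (auto simp: indicator_def)
  qed measurable
  have "(LBINT x:{0..1}. frac_op \<beta> f x * a (1 - x)) =
      (LBINT x:{0..1}. f 0 * (x powr (-\<beta>) * a (1 - x)) + p x * a (1 - x))"
    by (intro set_lebesgue_integral_cong) (auto simp: f_eq algebra_simps)
  also have "\<dots> = f 0 * (LBINT x:{0..1}. x powr (-\<beta>) * a (1 - x)) + (LBINT x:{0..1}. p x * a (1 - x))"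
    using i1 i2 by (subst set_integral_add) auto
  also have "\<dots> = ?\<Gamma> * (f 0 * (g 0 - g 1) + (LBINT u:{0..1}. f' u * (g u - g 1)))"
  proof -
    have k0: "(LBINT x:{0..1}. x powr (-\<beta>) * a (1 - x)) = ?\<Gamma> * (g 0 - g 1)" using kern[of 0] by simp
    have "f 0 * (c * d) + c * i = c * (f 0 * d + i)" for c d i :: real by (simp add: algebra_simps)
    then show ?thesis unfolding k0 T2 .
  qed
  \<comment> \<open>The product f (g - g(1)) vanishes at 1, and its value at 0 absorbs the
    contribution of f(0).\<close>
  also have "f 0 * (g 0 - g 1) + (LBINT u:{0..1}. f' u * (g u - g 1)) = - (LBINT u:{0..1}. f u * g' u)"
  proof -
    have c: "set_integrable lborel {0..1} (\<lambda>u. f' u * (g u - g 1))" "set_integrable lborel {0..1} (\<lambda>u. f u * g' u)"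
      using cont[THEN continuous_on_subset[OF _ subset_UNIV]]
      by (auto intro!: borel_integrable_atLeastAtMost' continuous_intros)
    have "(\<integral>u. indicator {0..1} u *\<^sub>R (f' u * (g u - g 1) + f u * g' u) \<partial>lborel) = f 1 * (g 1 - g 1) - f 0 * (g 0 - g 1)"
    proof (rule integral_FTC_atLeastAtMost)
      have d: "(f has_real_derivative f' u) (at u)" "(g has_real_derivative g' u) (at u)" for u
        using f g by (auto simp: c1_bounded_def)
      have "((\<lambda>u. f u * (g u - g 1)) has_real_derivative f' u * (g u - g 1) + f u * g' u) (at u)" for u
        by (rule derivative_eq_intros d refl)+ simp
      then show "((\<lambda>u. f u * (g u - g 1)) has_vector_derivative f' u * (g u - g 1) + f u * g' u) (at u within {0..1})" for u
        unfolding has_real_derivative_iff_has_vector_derivative by (rule has_vector_derivative_at_within)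
      show "continuous_on {0..1} (\<lambda>u. f' u * (g u - g 1) + f u * g' u)"
        by (intro continuous_intros continuous_on_subset[OF cont(1)]
        continuous_on_subset[OF cont(3)] continuous_on_subset[OF cont(4)] continuous_on_subset[OF cont(5)] subset_UNIV)
    qed simp
    then have "(LBINT u:{0..1}. f' u * (g u - g 1) + f u * g' u) = - f 0 * (g 0 - g 1)"
      by (simp add: set_lebesgue_integral_def)
    then show ?thesis using c by simp
  qed
  finally have "(LBINT x:{0..1}. frac_op \<beta> f x * a (1 - x)) = ?\<Gamma> * - (LBINT u:{0..1}. f u * g' u)" .
  moreover have "Gamma \<beta> > 0" "Gamma (1 - \<beta>) > 0" using b by (auto intro: Gamma_real_pos)
  ultimately show ?thesis unfolding gls_val_def a_def gt_def by simp
qed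

section \<open>Mollification and the passage to Hoelder integrands\<close>

definition mollify :: "real \<Rightarrow> (real \<Rightarrow> real) \<Rightarrow> real \<Rightarrow> real" where
  "mollify h f u = integral {0..h} (\<lambda>r. f (u + r)) / h"

lemma holder_shift_integrable:
  assumes "holder \<alpha> L f" "\<alpha> > 0"
  shows "(\<lambda>r. f (u + r)) integrable_on {a..b}"
  by (intro integrable_continuous_real continuous_on_compose2[OF holder_continuous[OF assms]] continuous_intros) auto

text \<open>A running mean averages shifted copies of f, so the constant is the same for all h; this
  uniformity is what \<open>gls_val_tendsto\<close> asks for.\<close>

lemma mollify_holder:
  assumes f: "holder \<alpha> L f" "\<alpha> > 0" and h: "0 < h"
  shows "holder \<alpha> L (mollify h f)"
  unfolding holder_def
proof (intro conjI allI)
  show "0 \<le> L" using holder_nonneg[OF f(1)] .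
  fix u v
  have i: "(\<lambda>r. f (u + r) - f (v + r)) integrable_on {0..h}"
    by (intro integrable_diff holder_shift_integrable[OF f])
  have "norm (integral {0..h} (\<lambda>r. f (u + r) - f (v + r))) \<le> integral {0..h} (\<lambda>r. L * \<bar>u - v\<bar> powr \<alpha>)"
    using holderD[OF f(1), of "u + r" "v + r" for r] by (intro integral_norm_bound_integral i) auto
  then have "\<bar>integral {0..h} (\<lambda>r. f (u + r)) - integral {0..h} (\<lambda>r. f (v + r))\<bar> \<le> h * (L * \<bar>u - v\<bar> powr \<alpha>)"
    using h by (subst integral_diff[symmetric]) (auto simp: mult_ac intro: holder_shift_integrable[OF f])
  then have "\<bar>integral {0..h} (\<lambda>r. f (u + r)) - integral {0..h} (\<lambda>r. f (v + r))\<bar> / h \<le> L * \<bar>u - v\<bar> powr \<alpha>"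
    using h by (simp add: field_simps)
  moreover have "mollify h f u - mollify h f v = (integral {0..h} (\<lambda>r. f (u + r)) - integral {0..h} (\<lambda>r. f (v + r))) / h"
    by (simp add: mollify_def diff_divide_distrib)
  ultimately show "\<bar>mollify h f u - mollify h f v\<bar> \<le> L * \<bar>u - v\<bar> powr \<alpha>" using h by simp
qed

lemma mollify_close:
  assumes f: "holder \<alpha> L f" "\<alpha> > 0" and h: "0 < h"
  shows "\<bar>mollify h f u - f u\<bar> \<le> L * h powr \<alpha>"
proof -
  have i: "(\<lambda>r. f (u + r) - f u) integrable_on {0..h}"
    by (intro integrable_diff holder_shift_integrable[OF f]) auto
  have "norm (integral {0..h} (\<lambda>r. f (u + r) - f u)) \<le> integral {0..h} (\<lambda>r. L * h powr \<alpha>)"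
  proof (intro integral_norm_bound_integral i)
    fix r assume r: "r \<in> {0..h}"
    have "\<bar>f (u + r) - f u\<bar> \<le> L * \<bar>r\<bar> powr \<alpha>" using holderD[OF f(1), of "u + r" u] by simp
    also have "\<dots> \<le> L * h powr \<alpha>" using r f holder_nonneg[OF f(1)] by (intro mult_left_mono powr_mono2) auto
    finally show "norm (f (u + r) - f u) \<le> L * h powr \<alpha>" by simp
  qed auto
  then have "\<bar>integral {0..h} (\<lambda>r. f (u + r)) - h * f u\<bar> \<le> h * (L * h powr \<alpha>)"
    using h by (subst (asm) integral_diff) (auto simp: mult_ac intro: holder_shift_integrable[OF f])
  then have "\<bar>integral {0..h} (\<lambda>r. f (u + r)) - h * f u\<bar> / h \<le> L * h powr \<alpha>"
    using h by (simp add: field_simps)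
  moreover have "mollify h f u - f u = (integral {0..h} (\<lambda>r. f (u + r)) - h * f u) / h"
    using h by (simp add: mollify_def field_simps)
  ultimately show ?thesis using h by simp
qed

lemma mollify_tendsto:
  assumes f: "holder \<alpha> L f" "\<alpha> > 0"
  shows "(\<lambda>k. mollify (1 / real (Suc k)) f u) \<longlonglongrightarrow> f u"
proof -
  have "(\<lambda>k. L * (1 / real (Suc k)) powr \<alpha>) \<longlonglongrightarrow> L * 0 powr \<alpha>"
    using f by (intro tendsto_intros tendsto_powr' LIMSEQ_Suc[OF lim_1_over_n]) auto
  then have "(\<lambda>k. L * (1 / real (Suc k)) powr \<alpha>) \<longlonglongrightarrow> 0" using f by simp
  then have "(\<lambda>k. mollify (1 / real (Suc k)) f u - f u) \<longlonglongrightarrow> 0"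
  proof (rule Lim_null_comparison[rotated])
    show "\<forall>\<^sub>F k in sequentially. norm (mollify (1 / real (Suc k)) f u - f u) \<le> L * (1 / real (Suc k)) powr \<alpha>"
      using mollify_close[OF f] by (intro always_eventually) simp
  qed
  then show ?thesis by (simp add: LIM_zero_iff)
qed

text \<open>The derivative of a running mean is a difference quotient. Its bound may blow up as h
  tends to 0, which is harmless: only the Hoelder constant has to be uniform.\<close>

lemma mollify_c1:
  assumes f: "holder \<alpha> L f" "\<alpha> > 0" and h: "0 < h"
  shows "c1_bounded (L * h powr \<alpha> / h) (mollify h f) (\<lambda>u. (f (u + h) - f u) / h)"
proof -
  have cf: "continuous_on UNIV f" using holder_continuous[OF f] .
  have bd: "\<bar>(f (u + h) - f u) / h\<bar> \<le> L * h powr \<alpha> / h" for u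
    using holderD[OF f(1), of "u + h" u] h by (simp add: divide_right_mono)
  have d: "(mollify h f has_real_derivative (f (u + h) - f u) / h) (at u)" for u
  proof -
    \<comment> \<open>The primitive starts at u - 1, strictly to the left of u, and is thus
      differentiable on both sides of u; near u the running mean is its difference quotient.\<close>
    define P where "P v = integral {u - 1..v} f" for v
    have dP: "(P has_real_derivative f v) (at v)" if "v > u - 1" for v
    proof -
      have "(P has_vector_derivative f v) (at v within {u - 1..v + 1})"
        unfolding P_def by (rule integral_has_vector_derivative) (use that cf in \<open>auto intro: continuous_on_subset\<close>)
      then show ?thesis using that
        by (simp add: has_real_derivative_iff_has_vector_derivative at_within_Icc_at)
    qed
    have "((\<lambda>v. P (v + h)) has_real_derivative f (u + h) * 1) (at u)"
      by (rule DERIV_chain2[of P]) (use dP[of "u + h"] h in \<open>auto intro!: derivative_eq_intros\<close>)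
    then have "((\<lambda>v. (P (v + h) - P v) / h) has_real_derivative (f (u + h) - f u) / h) (at u)"
      using dP[of u] h by (auto intro!: derivative_eq_intros)
    moreover have "\<forall>\<^sub>F v in nhds u. v > u - 1" using eventually_nhds_in_open[of "{u - 1<..}" u] by simp
    then have "\<forall>\<^sub>F v in nhds u. (P (v + h) - P v) / h = mollify h f v"
    proof eventually_elim
      case (elim v)
      have "integral {0..h} (\<lambda>r. f (v + r)) = integral {v..v + h} f"
        using integral_shift[of 0 v h f] continuous_on_subset[OF cf]
        by (simp add: o_def add.commute)
      moreover have "integral {u - 1..v} f + integral {v..v + h} f = integral {u - 1..v + h} f"
        using elim h cf by (intro Henstock_Kurzweil_Integration.integral_combine integrable_continuous_real) (auto intro: continuous_on_subset)
      ultimately show ?case by (simp add: P_def mollify_def)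
    qed
    ultimately show ?thesis by (subst DERIV_cong_ev[OF refl _ refl, symmetric])
  qed
  have "\<bar>mollify h f u - mollify h f v\<bar> \<le> (L * h powr \<alpha> / h) * \<bar>u - v\<bar>" for u v
    using field_differentiable_bound[of UNIV "mollify h f" "\<lambda>u. (f (u + h) - f u) / h" "L * h powr \<alpha> / h" u v] d bd by auto
  moreover have "0 \<le> L * h powr \<alpha> / h" using holder_nonneg[OF f(1)] h by simp
  moreover have "continuous_on UNIV (\<lambda>u. (f (u + h) - f u) / h)"
    using h by (intro continuous_intros continuous_on_compose2[OF cf]) auto
  ultimately show ?thesis unfolding c1_bounded_def holder_def using d bd by auto
qed

lemma mollify_bounded_01:
  assumes f: "holder \<alpha> L f" "\<alpha> > 0" and x: "0 \<le> x" "x \<le> 1"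
  shows "\<bar>mollify (1 / real (Suc k)) f x\<bar> \<le> \<bar>f 0\<bar> + L + L"
proof -
  have "L * (1 / real (Suc k)) powr \<alpha> \<le> L * 1 powr \<alpha>"
    using f(2) holder_nonneg[OF f(1)] by (intro mult_left_mono powr_mono2) auto
  then have "\<bar>mollify (1 / real (Suc k)) f 0\<bar> \<le> \<bar>f 0\<bar> + L"
    using mollify_close[OF f, of "1 / real (Suc k)" 0] by simp
  with mollify_holder[OF f] show ?thesis by (rule holder_bounded_01) (use f x in auto)
qed

text \<open>The stopped integrand of a smooth path has kinks, so a case between smooth and rough is
  needed: f alone is mollified while g stays smooth.\<close>

lemma gls_val_holder_c1:
  assumes f: "holder \<alpha> L f" and g: "c1_bounded K g g'" and b: "0 < \<beta>" "\<beta> < \<alpha>" "\<beta> < 1"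
  shows "gls_val \<beta> f g = (LBINT x:{0..1}. f x * g' x)"
proof -
  let ?F = "\<lambda>k. mollify (1 / real (Suc k)) f"
  have \<alpha>: "\<alpha> > 0" using b by simp
  have F: "holder \<alpha> L (?F k)" for k by (rule mollify_holder[OF f \<alpha>]) simp
  have gh: "holder 1 K g" using g by (simp add: c1_bounded_def)
  have [measurable]: "g' \<in> borel_measurable borel" "f \<in> borel_measurable borel" "?F k \<in> borel_measurable borel" for k
    using g holder_borel[OF F \<alpha>] holder_borel[OF f \<alpha>] by (auto simp: c1_bounded_def intro: borel_measurable_continuous_onI)
  have "(\<lambda>k. gls_val \<beta> (?F k) g) \<longlonglongrightarrow> gls_val \<beta> f g"
    using b by (intro gls_val_tendsto[where G="\<lambda>_. g", OF F f mollify_tendsto[OF f \<alpha>] gh gh]) auto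
  moreover have "gls_val \<beta> (?F k) g = (LBINT x:{0..1}. ?F k x * g' x)" for k
    by (rule gls_val_c1[OF mollify_c1[OF f \<alpha>] g b(1,3)]) simp
  moreover have "(\<lambda>k. LBINT x:{0..1}. ?F k x * g' x) \<longlonglongrightarrow> (LBINT x:{0..1}. f x * g' x)"
    unfolding set_lebesgue_integral_def
  proof (rule integral_dominated_convergence)
    show "integrable lborel (\<lambda>x. indicator {0..1::real} x * ((\<bar>f 0\<bar> + L + L) * K) :: real)" by (intro integrable_mult_left) auto
    show "AE x in lborel. (\<lambda>k. indicator {0..1} x *\<^sub>R (?F k x * g' x)) \<longlonglongrightarrow> indicator {0..1} x *\<^sub>R (f x * g' x)"
      by (intro AE_I2 tendsto_intros mollify_tendsto[OF f \<alpha>])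
    fix k
    have "\<bar>?F k x * g' x\<bar> \<le> (\<bar>f 0\<bar> + L + L) * K" if "0 \<le> x" "x \<le> 1" for x
      unfolding abs_mult using mollify_bounded_01[OF f \<alpha>, of x k] that \<alpha> g holder_nonneg[OF f]
      by (intro mult_mono) (auto simp: c1_bounded_def)
    then show "AE x in lborel. norm (indicator {0..1} x *\<^sub>R (?F k x * g' x)) \<le> indicator {0..1} x * ((\<bar>f 0\<bar> + L + L) * K)"
      by (intro AE_I2) (auto simp: indicator_def)
  qed measurable
  ultimately show ?thesis using LIMSEQ_unique by auto
qed

section \<open>The elementary integrand on one block\<close>

text \<open>\<open>bump\<close> is odd, vanishes at $\pm 1$, and its even primitive \<open>bump_int\<close> takes the value 1 there.\<close>

definition bump :: "real \<Rightarrow> real" where "bump y = 4 * y - 4 * y ^ 3"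
definition bump_int :: "real \<Rightarrow> real" where "bump_int y = 2 * y ^ 2 - y ^ 4"

lemma bump_int_deriv: "(bump_int has_real_derivative bump y) (at y)"
  unfolding bump_int_def[abs_def] bump_def by (auto intro!: derivative_eq_intros)

lemma bump_lipschitz:
  assumes "\<bar>y\<bar> \<le> D" "\<bar>z\<bar> \<le> D"
  shows "\<bar>bump y - bump z\<bar> \<le> (4 + 12 * D ^ 2) * \<bar>y - z\<bar>"
proof -
  have sq: "\<bar>y * y\<bar> \<le> D * D" "\<bar>y * z\<bar> \<le> D * D" "\<bar>z * z\<bar> \<le> D * D"
    unfolding abs_mult using assms by (intro mult_mono; auto)+
  have "bump y - bump z = (4 - 4 * (y * y + y * z + z * z)) * (y - z)"
    by (simp add: bump_def algebra_simps power3_eq_cube)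
  moreover have "\<bar>4 - 4 * (y * y + y * z + z * z)\<bar> \<le> 4 + 12 * (D * D)"
  proof -
    have "\<bar>4 - 4 * (a + b + c)\<bar> \<le> 4 + 12 * d" if "\<bar>a\<bar> \<le> d" "\<bar>b\<bar> \<le> d" "\<bar>c\<bar> \<le> d" for a b c d :: real
      using that by (auto simp: abs_le_iff)
    from this[OF sq] show ?thesis .
  qed
  ultimately show ?thesis unfolding power2_eq_square by (simp add: abs_mult mult_right_mono)
qed

lemma bump_bound:
  assumes "\<bar>y\<bar> \<le> D"
  shows "\<bar>bump y\<bar> \<le> (4 + 12 * D ^ 2) * D"
proof -
  have "\<bar>bump y - bump 0\<bar> \<le> (4 + 12 * D ^ 2) * \<bar>y - 0\<bar>" by (rule bump_lipschitz) (use assms in auto)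
  also have "\<dots> \<le> (4 + 12 * D ^ 2) * D" using assms by (intro mult_left_mono) auto
  finally show ?thesis by (simp add: bump_def)
qed

definition cutoff :: "real \<Rightarrow> real \<Rightarrow> real \<Rightarrow> real" where
  "cutoff m t u = min 1 (max 0 ((t - u) / (t - m)))"

text \<open>\<open>\<tau>\<close> is the stopping time; the cutoff only matters if the bump has not returned to 0 by time \<open>m\<close>.\<close>

definition stopped :: "(real \<Rightarrow> real) \<Rightarrow> real \<Rightarrow> real \<Rightarrow> real \<Rightarrow> real \<Rightarrow> real \<Rightarrow> real \<Rightarrow> real" where
  "stopped x s \<tau> m t \<epsilon> u = bump ((x (max s (min \<tau> u)) - x s) / \<epsilon>) / \<epsilon> * cutoff m t u"

text \<open>The chain rule on [s,\<tau>] gives the first term. Afterwards the bump is frozen, and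
  integrating the cutoff over [\<tau>,t] against x gives, by parts, the mean of x over [m,t] minus
  x(\<tau>). No integral against x remains, so pointwise limits and measurability are
  accessible.\<close>

definition stopped_val :: "(real \<Rightarrow> real) \<Rightarrow> real \<Rightarrow> real \<Rightarrow> real \<Rightarrow> real \<Rightarrow> real \<Rightarrow> real" where
  "stopped_val x s \<tau> m t \<epsilon> = bump_int ((x \<tau> - x s) / \<epsilon>) +
     bump ((x \<tau> - x s) / \<epsilon>) / \<epsilon> * ((LBINT u:{m..t}. x u) / (t - m) - x \<tau>)"

lemma cutoff_range: "0 \<le> cutoff m t u" "cutoff m t u \<le> 1"
  by (auto simp: cutoff_def)

text \<open>Interpolation: an increment is at most min(1, r) with r = |u - v|/(t - m), and min(1, r)
  is at most r^\<alpha> since \<alpha> is at most 1.\<close>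

lemma cutoff_holder:
  assumes "m < t" "0 < \<alpha>" "\<alpha> \<le> 1"
  shows "\<bar>cutoff m t u - cutoff m t v\<bar> \<le> (t - m) powr (-\<alpha>) * \<bar>u - v\<bar> powr \<alpha>"
proof -
  let ?r = "\<bar>u - v\<bar> / (t - m)"
  have "\<bar>cutoff m t u - cutoff m t v\<bar> \<le> \<bar>(t - u) / (t - m) - (t - v) / (t - m)\<bar>"
  proof -
    have "\<bar>min 1 (max 0 a) - min 1 (max 0 b)\<bar> \<le> \<bar>a - b\<bar>" for a b :: real by (auto simp: min_def max_def)
    then show ?thesis unfolding cutoff_def .
  qed
  also have "(t - u) / (t - m) - (t - v) / (t - m) = (v - u) / (t - m)" by (simp add: diff_divide_distrib[symmetric])
  finally have 1: "\<bar>cutoff m t u - cutoff m t v\<bar> \<le> ?r" using assms by (simp add: abs_minus_commute)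
  have 2: "\<bar>cutoff m t u - cutoff m t v\<bar> \<le> 1" using cutoff_range[of m t u] cutoff_range[of m t v] by (simp add: abs_le_iff)
  have "\<bar>cutoff m t u - cutoff m t v\<bar> \<le> ?r powr \<alpha>"
  proof (cases "?r \<le> 1")
    case True
    then have "?r powr 1 \<le> ?r powr \<alpha>" using assms by (intro powr_mono') auto
    then show ?thesis using 1 assms by simp
  next
    case False
    then have "1 powr \<alpha> \<le> ?r powr \<alpha>" using assms by (intro powr_mono2) auto
    then show ?thesis using 2 by simp
  qed
  also have "?r powr \<alpha> = (t - m) powr (-\<alpha>) * \<bar>u - v\<bar> powr \<alpha>"
    using assms by (simp add: powr_divide powr_minus_divide)
  finally show ?thesis .
qed

text \<open>Clamping time to [s,\<tau>] is 1-Lipschitz, so freezing costs nothing; the rest is a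
  product estimate. D measures the excursion in units of the level: D = 1 when \<tau> is the hitting
  time, but mollified paths may overshoot and need a larger D.\<close>

lemma stopped_holder:
  assumes x: "holder \<alpha> L x" and \<alpha>: "0 < \<alpha>" "\<alpha> \<le> 1" and mt: "m < t" "s \<le> \<tau>" "0 < \<epsilon>" "0 \<le> D"
    and D: "\<And>u. u \<in> {s..\<tau>} \<Longrightarrow> \<bar>x u - x s\<bar> \<le> D * \<epsilon>"
  shows "holder \<alpha> ((4 + 12 * D ^ 2) * (L / \<epsilon> + D * (t - m) powr (-\<alpha>)) / \<epsilon>) (stopped x s \<tau> m t \<epsilon>)"
  unfolding holder_def
proof (intro conjI allI)
  let ?c = "4 + 12 * D ^ 2"
  show "0 \<le> ?c * (L / \<epsilon> + D * (t - m) powr (-\<alpha>)) / \<epsilon>"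
    using mt holder_nonneg[OF x] by (intro divide_nonneg_pos mult_nonneg_nonneg add_nonneg_nonneg) auto
  fix u v
  define cl where "cl u = max s (min \<tau> u)" for u
  define y where "y u = (x (cl u) - x s) / \<epsilon>" for u
  have cl: "cl u \<in> {s..\<tau>}" for u using mt by (auto simp: cl_def)
  have y: "\<bar>y u\<bar> \<le> D" for u using D[OF cl[of u]] mt by (simp add: y_def field_simps)
  have "\<bar>y u - y v\<bar> = \<bar>x (cl u) - x (cl v)\<bar> / \<epsilon>"
    using mt by (simp add: y_def diff_divide_distrib[symmetric])
  also have "\<dots> \<le> (L * \<bar>cl u - cl v\<bar> powr \<alpha>) / \<epsilon>"
    using mt by (intro divide_right_mono holderD[OF x]) auto
  also have "\<dots> \<le> (L * \<bar>u - v\<bar> powr \<alpha>) / \<epsilon>"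
    using mt \<alpha> holder_nonneg[OF x] by (intro divide_right_mono mult_left_mono powr_mono2) (auto simp: cl_def)
  finally have yy: "\<bar>y u - y v\<bar> \<le> L / \<epsilon> * \<bar>u - v\<bar> powr \<alpha>" by simp
  have b1: "\<bar>bump (y u) - bump (y v)\<bar> \<le> ?c * (L / \<epsilon> * \<bar>u - v\<bar> powr \<alpha>)"
    by (rule order_trans[OF bump_lipschitz[OF y y]]) (intro mult_left_mono yy, simp)
  have b2: "\<bar>bump (y v)\<bar> \<le> ?c * D" by (rule bump_bound[OF y])
  have eq: "stopped x s \<tau> m t \<epsilon> u - stopped x s \<tau> m t \<epsilon> v =
      ((bump (y u) - bump (y v)) * cutoff m t u + bump (y v) * (cutoff m t u - cutoff m t v)) / \<epsilon>"
    by (simp add: stopped_def y_def cl_def algebra_simps add_divide_distrib diff_divide_distrib)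
  have "\<bar>(bump (y u) - bump (y v)) * cutoff m t u\<bar> \<le> ?c * (L / \<epsilon> * \<bar>u - v\<bar> powr \<alpha>) * 1"
    unfolding abs_mult[of _ "cutoff m t u"] using b1 cutoff_range[of m t u] by (intro mult_mono) auto
  moreover have "\<bar>bump (y v) * (cutoff m t u - cutoff m t v)\<bar> \<le> (?c * D) * ((t - m) powr (-\<alpha>) * \<bar>u - v\<bar> powr \<alpha>)"
    unfolding abs_mult[of "bump _"] using mt by (intro mult_mono b2 cutoff_holder \<alpha>) auto
  ultimately have "\<bar>(bump (y u) - bump (y v)) * cutoff m t u + bump (y v) * (cutoff m t u - cutoff m t v)\<bar>
     \<le> ?c * (L / \<epsilon> * \<bar>u - v\<bar> powr \<alpha>) * 1 + (?c * D) * ((t - m) powr (-\<alpha>) * \<bar>u - v\<bar> powr \<alpha>)"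
    by (rule order_trans[OF abs_triangle_ineq add_mono])
  also have "\<dots> = ?c * (L / \<epsilon> + D * (t - m) powr (-\<alpha>)) * \<bar>u - v\<bar> powr \<alpha>"
    by (simp add: algebra_simps)
  finally have "\<bar>(bump (y u) - bump (y v)) * cutoff m t u + bump (y v) * (cutoff m t u - cutoff m t v)\<bar>
     \<le> ?c * (L / \<epsilon> + D * (t - m) powr (-\<alpha>)) * \<bar>u - v\<bar> powr \<alpha>" .
  then show "\<bar>stopped x s \<tau> m t \<epsilon> u - stopped x s \<tau> m t \<epsilon> v\<bar> \<le> ?c * (L / \<epsilon> + D * (t - m) powr (-\<alpha>)) / \<epsilon> * \<bar>u - v\<bar> powr \<alpha>"
    unfolding eq using mt by (simp add: divide_right_mono)
qed

lemma stopped_outside: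
  assumes "s \<le> \<tau>" "m < t" "u \<le> s \<or> t \<le> u"
  shows "stopped x s \<tau> m t \<epsilon> u = 0"
  using assms(3)
proof
  assume "u \<le> s"
  then have "max s (min \<tau> u) = s" by simp
  then show ?thesis by (simp add: stopped_def bump_def)
next
  assume "t \<le> u"
  then have "(t - u) / (t - m) \<le> 0" using assms(2) by (intro divide_nonpos_pos) auto
  then show ?thesis by (simp add: stopped_def cutoff_def)
qed

text \<open>Fundamental theorem on [0,s], [s,\<tau>], [\<tau>,m], [m,t] and [t,1]; the integrand is
  0 on the first and the last.\<close>

lemma stopped_integral_c1:
  assumes g: "c1_bounded K g g'" and st: "0 \<le> s" "s \<le> \<tau>" "\<tau> \<le> m" "m < t" "t \<le> 1" "0 < \<epsilon>"
  shows "(LBINT u:{0..1}. stopped g s \<tau> m t \<epsilon> u * g' u) = stopped_val g s \<tau> m t \<epsilon>"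
proof -
  let ?F = "\<lambda>u. stopped g s \<tau> m t \<epsilon> u * g' u"
  define y where "y u = (g u - g s) / \<epsilon>" for u
  define c where "c = bump (y \<tau>) / \<epsilon>"
  have cg: "continuous_on S g" and cg': "continuous_on S g'" for S
    using g by (auto simp: c1_bounded_def intro: continuous_on_subset DERIV_continuous_on has_field_derivative_at_within)
  have d: "(g has_real_derivative g' u) (at u within S)" for u S
    using g by (auto simp: c1_bounded_def intro: has_field_derivative_at_within)
  have i1: "(?F has_integral 0) {0..s}"
    by (rule has_integral_is_0) (use st in \<open>auto simp: stopped_outside\<close>)
  have i2: "(?F has_integral (bump_int (y \<tau>) - bump_int (y s))) {s..\<tau>}"
  proof (rule has_integral_eq)
    show "((\<lambda>u. bump (y u) * (g' u / \<epsilon>)) has_integral (bump_int (y \<tau>) - bump_int (y s))) {s..\<tau>}"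
    proof (rule fundamental_theorem_of_calculus[OF st(2)])
      fix u
      have "(y has_real_derivative g' u / \<epsilon>) (at u within {s..\<tau>})"
        unfolding y_def using st by (auto intro!: derivative_eq_intros d)
      from DERIV_chain2[OF bump_int_deriv this]
      show "((\<lambda>u. bump_int (y u)) has_vector_derivative bump (y u) * (g' u / \<epsilon>)) (at u within {s..\<tau>})"
        by (simp add: has_real_derivative_iff_has_vector_derivative)
    qed
    show "bump (y u) * (g' u / \<epsilon>) = ?F u" if "u \<in> {s..\<tau>}" for u
      using that st by (auto simp: stopped_def cutoff_def y_def max_def min_def divide_simps)
  qed
  have i3: "(?F has_integral (c * g m - c * g \<tau>)) {\<tau>..m}"
  proof (rule has_integral_eq)
    show "((\<lambda>u. c * g' u) has_integral (c * g m - c * g \<tau>)) {\<tau>..m}"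
      by (rule fundamental_theorem_of_calculus[OF st(3)])
        (auto simp: has_real_derivative_iff_has_vector_derivative[symmetric] intro!: derivative_eq_intros d)
    show "c * g' u = ?F u" if "u \<in> {\<tau>..m}" for u
      using that st by (auto simp: c_def stopped_def cutoff_def y_def max_def min_def divide_simps)
  qed
  \<comment> \<open>Integration by parts on the descent: the derivative of the linear factor cancels
    against that of the running integral of g.\<close>
  define P where "P u = c * ((t - u) / (t - m)) * g u + c / (t - m) * integral {m..u} g" for u
  have i4: "(?F has_integral (P t - P m)) {m..t}"
  proof (rule has_integral_eq)
    show "((\<lambda>u. c * ((t - u) / (t - m)) * g' u) has_integral (P t - P m)) {m..t}"
    proof (rule fundamental_theorem_of_calculus)
      fix u assume u: "u \<in> {m..t}"
      have "((\<lambda>v. integral {m..v} g) has_real_derivative g u) (at u within {m..t})"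
        using integral_has_vector_derivative[OF cg u] by (simp add: has_real_derivative_iff_has_vector_derivative)
      then have "(P has_real_derivative c * ((0 - 1) / (t - m)) * g u + g' u * (c * ((t - u) / (t - m))) + c / (t - m) * g u)
          (at u within {m..t})"
        unfolding P_def by (intro DERIV_add DERIV_mult DERIV_cmult DERIV_cdivide DERIV_diff DERIV_const DERIV_ident d)
      then have "(P has_real_derivative c * ((t - u) / (t - m)) * g' u) (at u within {m..t})"
        by (simp add: mult.commute)
      then show "(P has_vector_derivative c * ((t - u) / (t - m)) * g' u) (at u within {m..t})"
        by (simp add: has_real_derivative_iff_has_vector_derivative)
    qed (use st in simp)
    show "c * ((t - u) / (t - m)) * g' u = ?F u" if "u \<in> {m..t}" for u
      using that st by (auto simp: c_def stopped_def cutoff_def y_def max_def min_def divide_simps)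
  qed
  have i5: "(?F has_integral 0) {t..1}"
    by (rule has_integral_is_0) (use st in \<open>auto simp: stopped_outside\<close>)
  note comb = has_integral_combine[rotated 2]
  have "(?F has_integral 0 + (bump_int (y \<tau>) - bump_int (y s)) + (c * g m - c * g \<tau>) + (P t - P m) + 0) {0..1}"
    using st by (intro comb[OF _ i5] comb[OF _ i4] comb[OF _ i3] comb[OF i1 i2]) auto
  then have 1: "integral {0..1} ?F = bump_int (y \<tau>) - bump_int (y s) + (c * g m - c * g \<tau>) + (P t - P m)"
    by (simp add: integral_unique)
  have "continuous_on {0..1} ?F"
    unfolding stopped_def cutoff_def bump_def using st
    by (intro continuous_intros cg' continuous_on_compose2[OF cg[of UNIV]]) auto
  then have "(LBINT u:{0..1}. ?F u) = integral {0..1} ?F"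
    by (intro set_borel_integral_eq_integral borel_integrable_atLeastAtMost')
  moreover have "(LBINT u:{m..t}. g u) = integral {m..t} g"
    by (intro set_borel_integral_eq_integral borel_integrable_atLeastAtMost' cg)
  moreover have "P t - P m = c * (integral {m..t} g / (t - m)) - c * g m"
    using st by (simp add: P_def)
  moreover have "bump_int (y s) = 0" by (simp add: y_def bump_int_def)
  moreover have "stopped_val g s \<tau> m t \<epsilon> = bump_int (y \<tau>) + c * ((LBINT u:{m..t}. g u) / (t - m) - g \<tau>)"
    by (simp add: stopped_val_def y_def c_def)
  ultimately show ?thesis unfolding 1 by (simp add: right_diff_distrib)
qed

text \<open>The path is mollified with \<tau> held fixed, which is why \<open>stopped\<close> and
  \<open>stopped_val\<close> take an arbitrary \<tau> instead of a hitting time: for smooth paths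
  both sides agree, and both are continuous under the limit.\<close>

lemma gls_val_stopped:
  assumes x: "holder \<alpha> L x" and \<alpha>: "0 < \<alpha>" "\<alpha> \<le> 1"
    and st: "0 \<le> s" "s \<le> \<tau>" "\<tau> \<le> m" "m < t" "t \<le> 1" "0 < \<epsilon>"
    and b: "0 < \<beta>" "\<beta> < \<alpha>" "\<beta> < 1" "1 - \<beta> < \<alpha>"
  shows "gls_val \<beta> (stopped x s \<tau> m t \<epsilon>) x = stopped_val x s \<tau> m t \<epsilon>"
proof -
  let ?x = "\<lambda>k. mollify (1 / real (Suc k)) x"
  have xk: "holder \<alpha> L (?x k)" for k by (rule mollify_holder[OF x \<alpha>(1)]) simp
  have lim: "(\<lambda>k. ?x k u) \<longlonglongrightarrow> x u" for u by (rule mollify_tendsto[OF x \<alpha>(1)])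
  \<comment> \<open>A crude constant that serves x and all its mollifications at once; the level
    itself need not bound the mollified paths up to \<tau>.\<close>
  define D where "D = L / \<epsilon>"
  have D: "\<bar>f u - f s\<bar> \<le> D * \<epsilon>" if f: "holder \<alpha> L f" and u: "u \<in> {s..\<tau>}" for f u
  proof -
    have "L * \<bar>u - s\<bar> powr \<alpha> \<le> L * 1 powr \<alpha>"
      using u st \<alpha> holder_nonneg[OF x] by (intro mult_left_mono powr_mono2) auto
    then show ?thesis using holderD[OF f, of u s] st by (simp add: D_def)
  qed
  have D0: "0 \<le> D" using holder_nonneg[OF x] st by (simp add: D_def)
  define M where "M = (4 + 12 * D ^ 2) * (L / \<epsilon> + D * (t - m) powr (-\<alpha>)) / \<epsilon>"
  have sh: "holder \<alpha> M (stopped f s \<tau> m t \<epsilon>)" if "holder \<alpha> L f" for f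
    unfolding M_def using that st \<alpha> D0 D[OF that] by (intro stopped_holder) auto
  have "(\<lambda>k. stopped (?x k) s \<tau> m t \<epsilon> u) \<longlonglongrightarrow> stopped x s \<tau> m t \<epsilon> u" for u
    unfolding stopped_def bump_def using st by (intro tendsto_intros lim) auto
  then have 1: "(\<lambda>k. gls_val \<beta> (stopped (?x k) s \<tau> m t \<epsilon>) (?x k)) \<longlonglongrightarrow> gls_val \<beta> (stopped x s \<tau> m t \<epsilon>) x"
    using b by (intro gls_val_tendsto[where \<alpha>=\<alpha> and \<alpha>'=\<alpha> and L=M and L'=L] sh xk x lim) auto
  have "gls_val \<beta> (stopped (?x k) s \<tau> m t \<epsilon>) (?x k) = stopped_val (?x k) s \<tau> m t \<epsilon>" for k
  proof -
    have c1: "c1_bounded (L * (1 / real (Suc k)) powr \<alpha> / (1 / real (Suc k))) (?x k)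
        (\<lambda>u. (x (u + 1 / real (Suc k)) - x u) / (1 / real (Suc k)))"
      by (rule mollify_c1[OF x \<alpha>(1)]) simp
    show ?thesis by (rule trans[OF gls_val_holder_c1[OF sh[OF xk] c1 b(1-3)] stopped_integral_c1[OF c1 st]])
  qed
  moreover have "(\<lambda>k. stopped_val (?x k) s \<tau> m t \<epsilon>) \<longlonglongrightarrow> stopped_val x s \<tau> m t \<epsilon>"
  proof -
    have [measurable]: "x \<in> borel_measurable borel" "?x k \<in> borel_measurable borel" for k
      using holder_borel[OF xk \<alpha>(1)] holder_borel[OF x \<alpha>(1)] by auto
    have "(\<lambda>k. LBINT u:{m..t}. ?x k u) \<longlonglongrightarrow> (LBINT u:{m..t}. x u)"
      unfolding set_lebesgue_integral_def
    proof (rule integral_dominated_convergence)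
      show "integrable lborel (\<lambda>u. indicator {m..t} u * (\<bar>x 0\<bar> + L + L) :: real)"
        using st by (intro integrable_mult_left integrable_real_indicator) auto
      show "AE u in lborel. (\<lambda>k. indicator {m..t} u *\<^sub>R ?x k u) \<longlonglongrightarrow> indicator {m..t} u *\<^sub>R x u"
        by (intro AE_I2 tendsto_intros lim)
      show "AE u in lborel. norm (indicator {m..t} u *\<^sub>R ?x k u) \<le> indicator {m..t} u * (\<bar>x 0\<bar> + L + L)" for k
        using mollify_bounded_01[OF x \<alpha>(1), of _ k] st by (intro AE_I2) (auto simp: indicator_def)
    qed measurable
    then show ?thesis unfolding stopped_val_def bump_def bump_int_def using st
      by (intro tendsto_intros lim) auto
  qed
  ultimately show ?thesis using 1 LIMSEQ_unique by auto
qed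

text \<open>Stated without a stopping time: the condition inspects the path only from s up to the
  current time (capped at m), so adaptedness can be read off. \<open>block_stopped\<close> recovers
  the form with \<tau>.\<close>

definition block :: "(real \<Rightarrow> real) \<Rightarrow> real \<Rightarrow> real \<Rightarrow> real \<Rightarrow> real \<Rightarrow> real \<Rightarrow> real" where
  "block x s m t \<epsilon> u = (if \<forall>v\<in>{s..max s (min m u)}. \<bar>x v - x s\<bar> < \<epsilon>
     then bump ((x (max s (min m u)) - x s) / \<epsilon>) / \<epsilon> * cutoff m t u else 0)"

text \<open>If the level is reached, the bump is 0 and its primitive is 1 there, so
  \<open>stopped_val\<close> reduces to 1; otherwise \<tau> = m.\<close>

definition block_val :: "(real \<Rightarrow> real) \<Rightarrow> real \<Rightarrow> real \<Rightarrow> real \<Rightarrow> real \<Rightarrow> real" where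
  "block_val x s m t \<epsilon> = (if \<forall>v\<in>{s..m}. \<bar>x v - x s\<bar> < \<epsilon> then stopped_val x s m m t \<epsilon> else 1)"

text \<open>\<tau> is the first time in [s,m] at which the level is reached, or m if there is
  none.\<close>

lemma block_stopped:
  assumes c: "continuous_on UNIV x" and st: "s \<le> m" "0 < \<epsilon>"
  obtains \<tau> where "s \<le> \<tau>" "\<tau> \<le> m" "block x s m t \<epsilon> = stopped x s \<tau> m t \<epsilon>"
    "block_val x s m t \<epsilon> = stopped_val x s \<tau> m t \<epsilon>" "\<And>u. u \<in> {s..\<tau>} \<Longrightarrow> \<bar>x u - x s\<bar> \<le> \<epsilon>"
proof (cases "\<forall>v\<in>{s..m}. \<bar>x v - x s\<bar> < \<epsilon>")
  case True
  then have "block x s m t \<epsilon> = stopped x s m m t \<epsilon>"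
    using st by (auto simp: fun_eq_iff block_def stopped_def)
  then show ?thesis using True st by (intro that[of m]) (auto simp: block_val_def intro: less_imp_le)
next
  case False
  \<comment> \<open>By continuity the set of times at or above the level is closed, so its infimum
    belongs to it.\<close>
  define S where "S = {s..m} \<inter> (\<lambda>v. \<bar>x v - x s\<bar>) -` {\<epsilon>..}"
  have cl: "closed S" unfolding S_def
    by (intro continuous_closed_preimage continuous_intros continuous_on_subset[OF c]) auto
  have ne: "S \<noteq> {}" using False by (force simp: S_def)
  have bb: "bdd_below S" unfolding S_def by auto
  define \<tau> where "\<tau> = Inf S"
  have \<tau>: "\<tau> \<in> S" unfolding \<tau>_def by (rule closed_contains_Inf[OF ne bb cl])
  have before: "\<bar>x v - x s\<bar> < \<epsilon>" if "s \<le> v" "v < \<tau>" for v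
  proof (rule ccontr)
    assume "\<not> ?thesis"
    then have "v \<in> S" using that \<tau> by (auto simp: S_def)
    then have "\<tau> \<le> v" unfolding \<tau>_def by (rule cInf_lower[OF _ bb])
    with that show False by simp
  qed
  have s\<tau>: "s < \<tau>" using \<tau> st by (cases "s = \<tau>") (auto simp: S_def)
  have le: "\<bar>x \<tau> - x s\<bar> \<le> \<epsilon>"
  proof (rule tendsto_upperbound)
    show "((\<lambda>v. \<bar>x v - x s\<bar>) \<longlongrightarrow> \<bar>x \<tau> - x s\<bar>) (at_left \<tau>)"
      using c by (intro tendsto_intros) (auto simp: continuous_on_def intro: tendsto_within_subset)
    show "\<forall>\<^sub>F v in at_left \<tau>. \<bar>x v - x s\<bar> \<le> \<epsilon>"
      using s\<tau> before unfolding eventually_at_left[OF s\<tau>] by (force intro: less_imp_le)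
  qed simp
  then have eq: "\<bar>x \<tau> - x s\<bar> = \<epsilon>" using \<tau> by (auto simp: S_def)
  then have y: "(x \<tau> - x s) / \<epsilon> = 1 \<or> (x \<tau> - x s) / \<epsilon> = -1" using st by (auto simp: field_simps abs_if split: if_splits)
  have b0: "bump ((x \<tau> - x s) / \<epsilon>) = 0" "bump_int ((x \<tau> - x s) / \<epsilon>) = 1"
  proof -
    have "bump a = 0 \<and> bump_int a = 1" if "a = 1 \<or> a = -1" for a
      using that by (auto simp: bump_def bump_int_def)
    from this[OF y] show "bump ((x \<tau> - x s) / \<epsilon>) = 0" "bump_int ((x \<tau> - x s) / \<epsilon>) = 1" by auto
  qed
  have "block x s m t \<epsilon> u = stopped x s \<tau> m t \<epsilon> u" for u
  proof (cases "max s (min m u) < \<tau>")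
    case True
    then have "\<forall>v\<in>{s..max s (min m u)}. \<bar>x v - x s\<bar> < \<epsilon>" using before by auto
    moreover have "max s (min m u) = max s (min \<tau> u)" using True s\<tau> \<tau> by (auto simp: S_def)
    ultimately show ?thesis by (simp add: block_def stopped_def)
  next
    case False
    \<comment> \<open>From \<tau> on, \<open>block\<close> is 0 by definition and
      \<open>stopped\<close> because \<open>bump\<close> vanishes at 1 and -1.\<close>
    have "max s (min \<tau> u) = \<tau>" using False s\<tau> \<tau> by (auto simp: S_def)
    moreover have "\<not> (\<forall>v\<in>{s..max s (min m u)}. \<bar>x v - x s\<bar> < \<epsilon>)"
      using False s\<tau> eq by (auto intro!: bexI[of _ \<tau>])
    then have "block x s m t \<epsilon> u = 0" unfolding block_def by (rule if_not_P)
    ultimately show ?thesis using b0 by (simp add: stopped_def)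
  qed
  then show ?thesis using b0 s\<tau> \<tau> False before le eq
    by (intro that[of \<tau>]) (auto simp: S_def block_val_def stopped_val_def fun_eq_iff less_le)
qed

section \<open>Series of integrands and the fractional norm\<close>

text \<open>The integrand of \<open>gls_norm\<close> on [0,1]. With values in \<open>ennreal\<close>
  it can be summed and compared before any integrability is known, and its finiteness at a point is
  exactly what convergence of the fractional derivative there requires.\<close>

definition norm_density :: "real \<Rightarrow> (real \<Rightarrow> real) \<Rightarrow> real \<Rightarrow> ennreal" where
  "norm_density \<beta> f t = ennreal (\<bar>f t\<bar> / t powr \<beta>) +
     (\<integral>\<^sup>+s. ennreal (indicator {0..t} s * (\<bar>f t - f s\<bar> / (t - s) powr (\<beta> + 1))) \<partial>lborel)"

lemma norm_density_borel [measurable]: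
  assumes [measurable]: "f \<in> borel_measurable borel"
  shows "norm_density \<beta> f \<in> borel_measurable borel"
proof -
  have eq: "norm_density \<beta> f = (\<lambda>t. ennreal (\<bar>f t\<bar> / t powr \<beta>) +
     (\<integral>\<^sup>+s. ennreal ((if 0 \<le> s \<and> s \<le> t then 1 else 0) * (\<bar>f t - f s\<bar> / (t - s) powr (\<beta> + 1))) \<partial>lborel))"
    by (auto simp: norm_density_def fun_eq_iff indicator_def intro!: nn_integral_cong)
  show ?thesis unfolding eq by measurable
qed

lemma gls_norm_eq: "gls_norm \<beta> 0 1 f = (\<integral>\<^sup>+t. norm_density \<beta> f t * indicator {0..1} t \<partial>lborel)"
proof -
  have "(\<integral>\<^sup>+s\<in>{0..t}. ennreal (\<bar>f t - f s\<bar> / (t - s) powr (\<beta> + 1)) \<partial>lborel)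
     = (\<integral>\<^sup>+s. ennreal (indicator {0..t} s * (\<bar>f t - f s\<bar> / (t - s) powr (\<beta> + 1))) \<partial>lborel)" for t
    by (intro nn_integral_cong) (auto simp: indicator_def)
  then show ?thesis by (simp add: gls_norm_def norm_density_def)
qed

lemma norm_density_integrable:
  assumes [measurable]: "f \<in> borel_measurable borel" and fin: "norm_density \<beta> f x < \<infinity>"
  shows "set_integrable lborel {0..x} (\<lambda>u. (f x - f u) / (x - u) powr (\<beta> + 1))"
  unfolding set_integrable_def
proof (rule integrableI_bounded)
  have "(\<integral>\<^sup>+u. ennreal (norm (indicator {0..x} u *\<^sub>R ((f x - f u) / (x - u) powr (\<beta> + 1)))) \<partial>lborel)
    = (\<integral>\<^sup>+s. ennreal (indicator {0..x} s * (\<bar>f x - f s\<bar> / (x - s) powr (\<beta> + 1))) \<partial>lborel)"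
    by (intro nn_integral_cong) (auto simp: indicator_def)
  also have "\<dots> \<le> norm_density \<beta> f x" by (simp add: norm_density_def)
  finally show "(\<integral>\<^sup>+u. ennreal (norm (indicator {0..x} u *\<^sub>R ((f x - f u) / (x - u) powr (\<beta> + 1)))) \<partial>lborel) < \<infinity>"
    using fin by (rule order_le_less_trans)
qed measurable

lemma frac_op_le_norm_density:
  assumes [measurable]: "f \<in> borel_measurable borel" and b: "0 < \<beta>" "\<beta> < 1"
  shows "ennreal \<bar>frac_op \<beta> f x\<bar> \<le> norm_density \<beta> f x"
proof (cases "norm_density \<beta> f x < \<infinity>")
  case True
  let ?I = "LBINT u:{0..x}. (f x - f u) / (x - u) powr (\<beta> + 1)"
  have "ennreal \<bar>?I\<bar> \<le> (\<integral>\<^sup>+u. ennreal (norm (indicator {0..x} u *\<^sub>R ((f x - f u) / (x - u) powr (\<beta> + 1)))) \<partial>lborel)"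
    using integral_norm_bound_ennreal[OF norm_density_integrable[OF _ True, unfolded set_integrable_def]]
    by (simp add: set_lebesgue_integral_def)
  also have "\<dots> = (\<integral>\<^sup>+s. ennreal (indicator {0..x} s * (\<bar>f x - f s\<bar> / (x - s) powr (\<beta> + 1))) \<partial>lborel)"
    by (intro nn_integral_cong) (auto simp: indicator_def)
  finally have I: "ennreal \<bar>?I\<bar> \<le> (\<integral>\<^sup>+s. ennreal (indicator {0..x} s * (\<bar>f x - f s\<bar> / (x - s) powr (\<beta> + 1))) \<partial>lborel)" .
  have "\<bar>frac_op \<beta> f x\<bar> \<le> \<bar>f x\<bar> / x powr \<beta> + \<bar>\<beta>\<bar> * \<bar>?I\<bar>"
    unfolding frac_op_def abs_mult[symmetric] by (rule order_trans[OF abs_triangle_ineq]) simp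
  also have "\<dots> \<le> \<bar>f x\<bar> / x powr \<beta> + 1 * \<bar>?I\<bar>" using b by (intro add_left_mono mult_right_mono) auto
  finally have "ennreal \<bar>frac_op \<beta> f x\<bar> \<le> ennreal (\<bar>f x\<bar> / x powr \<beta> + \<bar>?I\<bar>)" by (intro ennreal_leI) simp
  also have "\<dots> = ennreal (\<bar>f x\<bar> / x powr \<beta>) + ennreal \<bar>?I\<bar>" by (rule ennreal_plus) auto
  also have "\<dots> \<le> norm_density \<beta> f x" unfolding norm_density_def by (intro add_left_mono I)
  finally show ?thesis .
next
  case False then show ?thesis by (simp add: not_less top_unique)
qed

lemma frac_op_integrable:
  assumes [measurable]: "f \<in> borel_measurable borel" and b: "0 < \<beta>" "\<beta> < 1" and fin: "gls_norm \<beta> 0 1 f < \<infinity>"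
  shows "set_integrable lborel {0..1} (frac_op \<beta> f)"
    and "AE x in lborel. x \<in> {0..1} \<longrightarrow> norm_density \<beta> f x < \<infinity>"
    and "ennreal (LBINT x:{0..1}. \<bar>frac_op \<beta> f x\<bar>) \<le> gls_norm \<beta> 0 1 f"
proof -
  have le: "(\<integral>\<^sup>+x. ennreal (norm (indicator {0..1} x *\<^sub>R frac_op \<beta> f x)) \<partial>lborel) \<le> gls_norm \<beta> 0 1 f"
    unfolding gls_norm_eq
    by (intro nn_integral_mono) (auto simp: indicator_def frac_op_le_norm_density[OF _ b])
  show i: "set_integrable lborel {0..1} (frac_op \<beta> f)"
    unfolding set_integrable_def
    by (rule integrableI_bounded) (use le fin in \<open>auto intro: order_le_less_trans\<close>)
  have "AE x in lborel. norm_density \<beta> f x * indicator {0..1} x \<noteq> \<infinity>"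
    by (rule nn_integral_noteq_infinite) (use fin in \<open>auto simp: gls_norm_eq\<close>)
  then show "AE x in lborel. x \<in> {0..1} \<longrightarrow> norm_density \<beta> f x < \<infinity>"
    by eventually_elim (auto simp: less_top)
  have "(LBINT x:{0..1}. \<bar>frac_op \<beta> f x\<bar>) = (\<integral>x. norm (indicator {0..1} x *\<^sub>R frac_op \<beta> f x) \<partial>lborel)"
    unfolding set_lebesgue_integral_def by (intro Bochner_Integration.integral_cong) (auto simp: indicator_def)
  then show "ennreal (LBINT x:{0..1}. \<bar>frac_op \<beta> f x\<bar>) \<le> gls_norm \<beta> 0 1 f"
    using le nn_integral_eq_integral[OF integrable_norm[OF i[unfolded set_integrable_def]]] by simp
qed

text \<open>The substitution u -> 1 - u turns the right-sided integral into a left-sided one; the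
  subtracted g(1) cancels in the difference quotient.\<close>

lemma right_frac_deriv_eq:
  "right_frac_deriv 1 \<beta> (\<lambda>x. g x - g 1) x =
     exp (\<i> * complex_of_real (pi * (1 - \<beta>))) / complex_of_real (Gamma \<beta>) *
       complex_of_real (frac_op (1 - \<beta>) (\<lambda>y. g (1 - y) - g 1) (1 - x))"
proof -
  have "(LBINT u:{0..1 - x}. (g x - g (1 - u)) / (1 - x - u) powr (2 - \<beta>)) =
     (\<integral>u. indicator {0..1 - x} (1 + (-1) * u) *\<^sub>R ((g x - g (1 - (1 + (-1) * u))) / (1 - x - (1 + (-1) * u)) powr (2 - \<beta>)) \<partial>lborel)"
    unfolding set_lebesgue_integral_def by (subst lborel_integral_real_affine[of "-1" _ 1]) auto
  also have "\<dots> = (LBINT u:{x..1}. (g x - g u) / (u - x) powr (2 - \<beta>))"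
    unfolding set_lebesgue_integral_def
    by (intro Bochner_Integration.integral_cong) (auto simp: indicator_def)
  finally show ?thesis by (simp add: right_frac_deriv_def frac_op_def)
qed

lemma right_frac_deriv_exists_holder:
  assumes g: "holder \<alpha> L g" and b: "0 < \<beta>" "\<beta> < 1" "1 - \<beta> < \<alpha>" and x: "0 \<le> x" "x \<le> 1"
  shows "right_frac_deriv_exists 1 \<beta> (\<lambda>x. g x - g 1) x"
proof -
  have "integrable lborel (\<lambda>u. indicator {0..1 - x} u *\<^sub>R ((g x - g (1 - u)) / (1 - x - u) powr (2 - \<beta>)))"
    using holder_quotient_integrable(1)[OF holder_reflect[OF g], of "1 - \<beta>" "1 - x"] b x
    by (simp add: set_integrable_def)
  from lborel_integrable_real_affine[OF this, of "-1" 1]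
  have "integrable lborel (\<lambda>u. indicator {0..1 - x} (1 + (-1) * u) *\<^sub>R ((g x - g (1 - (1 + (-1) * u))) / (1 - x - (1 + (-1) * u)) powr (2 - \<beta>)))"
    by simp
  also have "?this \<longleftrightarrow> integrable lborel (\<lambda>u. indicator {x..1} u *\<^sub>R ((g x - g 1 - (g u - g 1)) / (u - x) powr (2 - \<beta>)))"
    by (intro Bochner_Integration.integrable_cong) (auto simp: indicator_def)
  finally show ?thesis by (simp add: right_frac_deriv_exists_def set_integrable_def)
qed

text \<open>Return to the official notion: the finite norm gives the integrable left derivative, the
  Hoelder integrator gives the bounded right derivative.\<close>

lemma has_gls_integral_gls_val:
  assumes f: "f \<in> borel_measurable borel" and fin: "gls_norm \<beta> 0 1 f < \<infinity>"
    and g: "holder \<alpha> L g" and b: "0 < \<beta>" "\<beta> < 1" "1 - \<beta> < \<alpha>"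
  shows "has_gls_integral \<beta> 0 1 f g (gls_val \<beta> f g)"
proof -
  define h where "h x = frac_op (1 - \<beta>) (\<lambda>y. g (1 - y) - g 1) (1 - x)" for x
  define c where "c = exp (\<i> * complex_of_real (pi * (1 - \<beta>))) / complex_of_real (Gamma \<beta>)"
  have [measurable]: "f \<in> borel_measurable borel" "g \<in> borel_measurable borel"
    using f holder_borel[OF g] b by auto
  have [measurable]: "h \<in> borel_measurable borel" unfolding h_def by measurable
  have D: "right_frac_deriv 1 \<beta> (\<lambda>x. g x - g 1) = (\<lambda>x. c * complex_of_real (h x))"
    by (simp add: fun_eq_iff right_frac_deriv_eq c_def h_def)
  have A: "left_frac_deriv 0 \<beta> f = (\<lambda>x. 1 / Gamma (1 - \<beta>) * frac_op \<beta> f x)"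
    by (simp add: fun_eq_iff left_frac_deriv_def frac_op_def)
  have h_bd: "\<bar>h x\<bar> \<le> L + L / (\<alpha> - (1 - \<beta>))" if "0 \<le> x" "x \<le> 1" for x
    unfolding h_def using that b by (intro frac_op_bound_0[OF holder_reflect[OF g]]) auto
  have e: "exp (\<i> * complex_of_real (pi * \<beta>)) * exp (\<i> * complex_of_real (pi * (1 - \<beta>))) = -1"
  proof -
    have "\<i> * complex_of_real (pi * \<beta>) + \<i> * complex_of_real (pi * (1 - \<beta>)) = complex_of_real pi * \<i>"
      by (simp add: algebra_simps)
    then show ?thesis unfolding exp_add[symmetric] by (simp only: exp_pi_i)
  qed
  have "(LBINT x:{0..1}. complex_of_real (1 / Gamma (1 - \<beta>) * frac_op \<beta> f x) * (c * complex_of_real (h x)))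
     = (LBINT x:{0..1}. (c / complex_of_real (Gamma (1 - \<beta>))) * complex_of_real (frac_op \<beta> f x * h x))"
    by (intro set_lebesgue_integral_cong) (auto simp: field_simps)
  also have "\<dots> = (c / complex_of_real (Gamma (1 - \<beta>))) * complex_of_real (LBINT x:{0..1}. frac_op \<beta> f x * h x)"
    by (simp only: set_integral_mult_right set_integral_complex_of_real)
  finally have int: "exp (\<i> * complex_of_real (pi * \<beta>)) * (LBINT x:{0..1}. complex_of_real (1 / Gamma (1 - \<beta>) * frac_op \<beta> f x) * (c * complex_of_real (h x)))
     = complex_of_real (gls_val \<beta> f g)"
    using e by (simp add: c_def gls_val_def h_def flip: mult.assoc)
  show ?thesis unfolding has_gls_integral_def Let_def D A
  proof (intro conjI)
    show "AE x in lborel. x \<in> {0..1} \<longrightarrow> left_frac_deriv_exists 0 \<beta> f x"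
      using frac_op_integrable(2)[OF f b(1,2) fin]
      by eventually_elim (auto simp: left_frac_deriv_exists_def intro: norm_density_integrable[OF f])
    show "set_integrable lborel {0..1} (\<lambda>x. 1 / Gamma (1 - \<beta>) * frac_op \<beta> f x)"
      using frac_op_integrable(1)[OF f b(1,2) fin] by simp
    show "AE x in lborel. x \<in> {0..1} \<longrightarrow> right_frac_deriv_exists 1 \<beta> (\<lambda>x. g x - g 1) x"
      using right_frac_deriv_exists_holder[OF g b] by (intro AE_I2) auto
    show "set_borel_measurable lborel {0..1} (\<lambda>x. c * complex_of_real (h x))"
      unfolding set_borel_measurable_def by measurable
    show "\<exists>B. AE x in lborel. x \<in> {0..1} \<longrightarrow> norm (c * complex_of_real (h x)) \<le> B"
      using h_bd by (intro exI[of _ "norm c * (L + L / (\<alpha> - (1 - \<beta>)))"] AE_I2) (auto simp: norm_mult intro!: mult_left_mono)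
    show "complex_of_real (gls_val \<beta> f g) = exp (\<i> * complex_of_real (pi * \<beta>)) *
        (LBINT x:{0..1}. complex_of_real (1 / Gamma (1 - \<beta>) * frac_op \<beta> f x) * (c * complex_of_real (h x)))"
      using int by simp
  qed (use b in auto)
qed

text \<open>Serves to exchange the globally extended path, on which the analysis is done, for the
  given process.\<close>

lemma has_gls_integral_cong:
  assumes "has_gls_integral \<beta> 0 1 f g I" and eq: "\<And>x. 0 \<le> x \<Longrightarrow> x \<le> 1 \<Longrightarrow> g x = g' x"
  shows "has_gls_integral \<beta> 0 1 f g' I"
proof -
  have D: "right_frac_deriv 1 \<beta> (\<lambda>x. g x - g 1) x = right_frac_deriv 1 \<beta> (\<lambda>x. g' x - g' 1) x" if "x \<in> {0..1}" for x
  proof -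
    have "(LBINT u:{x..1}. (g x - g 1 - (g u - g 1)) / (u - x) powr (2 - \<beta>)) =
        (LBINT u:{x..1}. (g' x - g' 1 - (g' u - g' 1)) / (u - x) powr (2 - \<beta>))"
      using that by (intro set_lebesgue_integral_cong) (auto simp: eq)
    then show ?thesis using that by (simp add: right_frac_deriv_def eq)
  qed
  have E: "right_frac_deriv_exists 1 \<beta> (\<lambda>x. g x - g 1) x = right_frac_deriv_exists 1 \<beta> (\<lambda>x. g' x - g' 1) x" if "x \<in> {0..1}" for x
    unfolding right_frac_deriv_exists_def using that by (intro set_integrable_cong) (auto simp: eq)
  have "(LBINT x:{0..1}. complex_of_real (left_frac_deriv 0 \<beta> f x) * right_frac_deriv 1 \<beta> (\<lambda>x. g x - g 1) x) =
     (LBINT x:{0..1}. complex_of_real (left_frac_deriv 0 \<beta> f x) * right_frac_deriv 1 \<beta> (\<lambda>x. g' x - g' 1) x)"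
    by (intro set_lebesgue_integral_cong) (auto simp: D)
  moreover have "(\<lambda>x. indicator {0..1} x *\<^sub>R right_frac_deriv 1 \<beta> (\<lambda>x. g x - g 1) x) =
      (\<lambda>x. indicator {0..1} x *\<^sub>R right_frac_deriv 1 \<beta> (\<lambda>x. g' x - g' 1) x)"
    by (auto simp: fun_eq_iff indicator_def D)
  ultimately show ?thesis using assms(1) D E
    unfolding has_gls_integral_def Let_def set_borel_measurable_def by (simp cong: conj_cong imp_cong)
qed

text \<open>On a short interval a smaller Hoelder exponent is paid for by a power of the length.\<close>

lemma holder_weaken_support:
  assumes f: "holder \<alpha> L f" and sup: "\<And>u. u \<le> p \<or> q \<le> u \<Longrightarrow> f u = 0" and pq: "p < q"
    and a: "0 < \<alpha>'" "\<alpha>' \<le> \<alpha>"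
  shows "holder \<alpha>' (L * (q - p) powr (\<alpha> - \<alpha>')) f"
  unfolding holder_def
proof (intro conjI allI)
  show "0 \<le> L * (q - p) powr (\<alpha> - \<alpha>')" using holder_nonneg[OF f] by simp
  have max: "\<bar>f u\<bar> \<le> L * (q - p) powr \<alpha>" for u
  proof (cases "p < u \<and> u < q")
    case True
    have "\<bar>f u\<bar> \<le> L * \<bar>u - p\<bar> powr \<alpha>" using holderD[OF f, of u p] sup[of p] by simp
    also have "\<dots> \<le> L * (q - p) powr \<alpha>" using True a holder_nonneg[OF f] by (intro mult_left_mono powr_mono2) auto
    finally show ?thesis .
  next
    case False then show ?thesis using sup[of u] holder_nonneg[OF f] by (auto simp: not_less)
  qed
  fix u v
  show "\<bar>f u - f v\<bar> \<le> L * (q - p) powr (\<alpha> - \<alpha>') * \<bar>u - v\<bar> powr \<alpha>'"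
  proof (cases "\<bar>u - v\<bar> \<le> q - p")
    case True
    have "\<bar>f u - f v\<bar> \<le> L * (\<bar>u - v\<bar> powr (\<alpha> - \<alpha>') * \<bar>u - v\<bar> powr \<alpha>')"
      using holderD[OF f, of u v] by (simp flip: powr_add)
    also have "\<dots> \<le> L * ((q - p) powr (\<alpha> - \<alpha>') * \<bar>u - v\<bar> powr \<alpha>')"
      using True a holder_nonneg[OF f] by (intro mult_left_mono mult_right_mono powr_mono2) auto
    finally show ?thesis by simp
  next
    case False
    \<comment> \<open>Points further apart than the support cannot both lie inside it, so the bound
      on a single value suffices.\<close>
    then have "f u = 0 \<or> f v = 0" using sup[of u] sup[of v] by force
    then have "\<bar>f u - f v\<bar> \<le> L * (q - p) powr \<alpha>" using max[of u] max[of v] by auto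
    also have "\<dots> = L * (q - p) powr (\<alpha> - \<alpha>') * (q - p) powr \<alpha>'" by (simp flip: powr_add mult.assoc)
    also have "\<dots> \<le> L * (q - p) powr (\<alpha> - \<alpha>') * \<bar>u - v\<bar> powr \<alpha>'"
      using False a pq holder_nonneg[OF f] by (intro mult_left_mono powr_mono2) auto
    finally show ?thesis .
  qed
qed

text \<open>The double integral lives where t or s lies in [p,q]. In either case that variable
  contributes the length q - p, and the kernel integrated in the other one contributes at most
  1/(\<alpha> - \<beta>). For the single integral, |f| is at most L (q - p)^\<alpha> and
  t^(-\<beta>) is at most (t - p)^(-\<beta>).\<close>

lemma gls_norm_support:
  assumes f: "holder \<alpha> L f" and sup: "\<And>u. u \<le> p \<or> q \<le> u \<Longrightarrow> f u = 0" and pq: "0 \<le> p" "p < q" "q \<le> 1"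
    and b: "0 < \<beta>" "\<beta> < \<alpha>" "\<beta> < 1"
  shows "gls_norm \<beta> 0 1 f \<le> ennreal (L * (q - p) * (1 / (1 - \<beta>) + 2 / (\<alpha> - \<beta>)))"
proof -
  have L: "0 \<le> L" using holder_nonneg[OF f] .
  have [measurable]: "f \<in> borel_measurable borel" using holder_borel[OF f] b by auto
  have T1: "(\<integral>\<^sup>+t. ennreal (\<bar>f t\<bar> / t powr \<beta>) * indicator {0..1} t \<partial>lborel) \<le> ennreal (L * (q - p) / (1 - \<beta>))"
  proof -
    have "(\<integral>\<^sup>+t. ennreal (\<bar>f t\<bar> / t powr \<beta>) * indicator {0..1} t \<partial>lborel)
        \<le> (\<integral>\<^sup>+t. ennreal (L * (q - p) powr \<alpha> * (indicator {p..q} t * (t - p) powr (-\<beta>))) \<partial>lborel)"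
    proof (rule nn_integral_mono)
      fix t
      show "ennreal (\<bar>f t\<bar> / t powr \<beta>) * indicator {0..1} t \<le> ennreal (L * (q - p) powr \<alpha> * (indicator {p..q} t * (t - p) powr (-\<beta>)))"
      proof (cases "p < t \<and> t < q")
        case True
        have "\<bar>f t\<bar> \<le> L * \<bar>t - p\<bar> powr \<alpha>" using holderD[OF f, of t p] sup[of p] by simp
        also have "\<dots> \<le> L * (q - p) powr \<alpha>" using True b L by (intro mult_left_mono powr_mono2) auto
        finally have 1: "\<bar>f t\<bar> \<le> L * (q - p) powr \<alpha>" .
        have "t powr (-\<beta>) \<le> (t - p) powr (-\<beta>)" using True pq b by (intro powr_mono2') auto
        with 1 have "\<bar>f t\<bar> * t powr (-\<beta>) \<le> (L * (q - p) powr \<alpha>) * (t - p) powr (-\<beta>)"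
          using L by (intro mult_mono) auto
        then show ?thesis using True pq by (auto simp: powr_minus_divide intro!: ennreal_leI)
      next
        case False then show ?thesis using sup[of t] by (auto simp: not_less)
      qed
    qed
    also have "\<dots> = ennreal (L * (q - p) powr \<alpha> * ((q - p) powr (-\<beta> + 1) / (-\<beta> + 1)))"
      using has_bochner_integral_mult_right[OF powr_kernel_right[of "-\<beta>" p q]] b pq L
      by (subst nn_integral_eq_integral) (auto simp: has_bochner_integral_iff)
    also have "\<dots> \<le> ennreal (L * (q - p) / (1 - \<beta>))"
    proof (rule ennreal_leI)
      have "(q - p) powr \<alpha> * (q - p) powr (-\<beta> + 1) = (q - p) powr (\<alpha> - \<beta>) * (q - p)"
        using pq by (simp flip: powr_add) (simp add: powr_add powr_diff)
      also have "\<dots> \<le> 1 powr (\<alpha> - \<beta>) * (q - p)" using pq b by (intro mult_right_mono powr_mono2) auto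
      finally have "L * ((q - p) powr \<alpha> * (q - p) powr (-\<beta> + 1)) / (1 - \<beta>) \<le> L * (q - p) / (1 - \<beta>)"
        using L b by (intro divide_right_mono mult_left_mono) auto
      then show "L * (q - p) powr \<alpha> * ((q - p) powr (-\<beta> + 1) / (-\<beta> + 1)) \<le> L * (q - p) / (1 - \<beta>)" by simp
    qed
    finally show ?thesis .
  qed
  define k where "k t s = (if 0 \<le> s \<and> s \<le> t \<and> t \<le> 1 then (t - s) powr (\<alpha> - \<beta> - 1) else 0)" for t s
  have k0: "0 \<le> k t s" for t s by (simp add: k_def)
  have [measurable]: "(\<lambda>(t, s). k t s) \<in> borel_measurable (lborel \<Otimes>\<^sub>M lborel)" unfolding k_def by measurable
  have one: "r powr (\<alpha> - \<beta>) / (\<alpha> - \<beta>) \<le> 1 / (\<alpha> - \<beta>)" if "0 \<le> r" "r \<le> 1" for r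
    using powr_mono2[of "\<alpha> - \<beta>" r 1] that b by (intro divide_right_mono) auto
  have ks: "(\<integral>\<^sup>+s. ennreal (k t s) \<partial>lborel) \<le> ennreal (1 / (\<alpha> - \<beta>))" for t
  proof (cases "0 \<le> t \<and> t \<le> 1")
    case True
    have "(\<integral>\<^sup>+s. ennreal (k t s) \<partial>lborel) = (\<integral>\<^sup>+s. ennreal (indicator {0..t} s * (t - s) powr (\<alpha> - \<beta> - 1)) \<partial>lborel)"
      using True by (intro nn_integral_cong) (auto simp: k_def indicator_def)
    also have "\<dots> = ennreal ((t - 0) powr (\<alpha> - \<beta> - 1 + 1) / (\<alpha> - \<beta> - 1 + 1))"
      using powr_kernel_left[of "\<alpha> - \<beta> - 1" 0 t] b True
      by (subst nn_integral_eq_integral) (auto simp: has_bochner_integral_iff)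
    also have "\<dots> \<le> ennreal (1 / (\<alpha> - \<beta>))" using one[of t] True by (intro ennreal_leI) auto
    finally show ?thesis .
  next
    case False
    then have "k t s = 0" for s by (auto simp: k_def)
    then show ?thesis by simp
  qed
  have kt: "(\<integral>\<^sup>+t. ennreal (k t s) \<partial>lborel) \<le> ennreal (1 / (\<alpha> - \<beta>))" for s
  proof (cases "0 \<le> s \<and> s \<le> 1")
    case True
    have "(\<integral>\<^sup>+t. ennreal (k t s) \<partial>lborel) = (\<integral>\<^sup>+t. ennreal (indicator {s..1} t * (t - s) powr (\<alpha> - \<beta> - 1)) \<partial>lborel)"
      using True by (intro nn_integral_cong) (auto simp: k_def indicator_def)
    also have "\<dots> = ennreal ((1 - s) powr (\<alpha> - \<beta> - 1 + 1) / (\<alpha> - \<beta> - 1 + 1))"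
      using powr_kernel_right[of "\<alpha> - \<beta> - 1" s 1] b True
      by (subst nn_integral_eq_integral) (auto simp: has_bochner_integral_iff)
    also have "\<dots> \<le> ennreal (1 / (\<alpha> - \<beta>))" using one[of "1 - s"] True by (intro ennreal_leI) auto
    finally show ?thesis .
  next
    case False
    then have "k t s = 0" for t by (auto simp: k_def)
    then show ?thesis by simp
  qed
  have ind: "(\<integral>\<^sup>+t. ennreal (L * indicator {p..q} t) * ennreal (1 / (\<alpha> - \<beta>)) \<partial>lborel) = ennreal (L * (q - p) / (\<alpha> - \<beta>))"
  proof -
    have "(\<integral>\<^sup>+t. ennreal (L * indicator {p..q} t) * ennreal (1 / (\<alpha> - \<beta>)) \<partial>lborel) =
       (\<integral>\<^sup>+t. ennreal (L / (\<alpha> - \<beta>)) * indicator {p..q} t \<partial>lborel)"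
      using L b by (intro nn_integral_cong) (auto simp: indicator_def simp flip: ennreal_mult)
    also have "\<dots> = ennreal (L * (q - p) / (\<alpha> - \<beta>))"
      using pq L b by (subst nn_integral_cmult_indicator) (auto simp flip: ennreal_mult)
    finally show ?thesis .
  qed
  have "(\<integral>\<^sup>+t. (\<integral>\<^sup>+s. ennreal (indicator {0..t} s * (\<bar>f t - f s\<bar> / (t - s) powr (\<beta> + 1))) \<partial>lborel) * indicator {0..1} t \<partial>lborel)
    \<le> (\<integral>\<^sup>+t. \<integral>\<^sup>+s. (ennreal (L * indicator {p..q} t) * ennreal (k t s) + ennreal (L * indicator {p..q} s) * ennreal (k t s)) \<partial>lborel \<partial>lborel)"
  proof (rule nn_integral_mono)
    fix t
    have "ennreal (indicator {0..t} s * (\<bar>f t - f s\<bar> / (t - s) powr (\<beta> + 1)))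
        \<le> ennreal (L * indicator {p..q} t) * ennreal (k t s) + ennreal (L * indicator {p..q} s) * ennreal (k t s)" if t: "0 \<le> t" "t \<le> 1" for s
    proof (cases "0 \<le> s \<and> s \<le> t \<and> (t \<in> {p..q} \<or> s \<in> {p..q})")
      case True
      have "indicator {0..t} s * (\<bar>f t - f s\<bar> / (t - s) powr (\<beta> + 1)) \<le> L * k t s"
        using holder_quotient_le[OF f, of s t \<beta>] True t by (simp add: k_def)
      also have "\<dots> \<le> L * indicator {p..q} t * k t s + L * indicator {p..q} s * k t s"
        using True L k0[of t s] by (auto simp: indicator_def)
      finally have "ennreal (indicator {0..t} s * (\<bar>f t - f s\<bar> / (t - s) powr (\<beta> + 1)))
          \<le> ennreal (L * indicator {p..q} t * k t s + L * indicator {p..q} s * k t s)" by (rule ennreal_leI)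
      also have "\<dots> = ennreal (L * indicator {p..q} t) * ennreal (k t s) + ennreal (L * indicator {p..q} s) * ennreal (k t s)"
        using L k0[of t s] by (subst ennreal_plus) (auto simp: ennreal_mult)
      finally show ?thesis .
    next
      case False
      then have "indicator {0..t} s * (\<bar>f t - f s\<bar> / (t - s) powr (\<beta> + 1)) = 0"
        using sup[of t] sup[of s] by (auto simp: indicator_def)
      then show ?thesis by (simp only: ennreal_0 zero_le)
    qed
    then show "(\<integral>\<^sup>+s. ennreal (indicator {0..t} s * (\<bar>f t - f s\<bar> / (t - s) powr (\<beta> + 1))) \<partial>lborel) * indicator {0..1} t
      \<le> (\<integral>\<^sup>+s. (ennreal (L * indicator {p..q} t) * ennreal (k t s) + ennreal (L * indicator {p..q} s) * ennreal (k t s)) \<partial>lborel)"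
      by (cases "t \<in> {0..1}") (auto intro!: nn_integral_mono)
  qed
  also have "\<dots> = (\<integral>\<^sup>+t. \<integral>\<^sup>+s. ennreal (L * indicator {p..q} t) * ennreal (k t s) \<partial>lborel \<partial>lborel)
     + (\<integral>\<^sup>+t. \<integral>\<^sup>+s. ennreal (L * indicator {p..q} s) * ennreal (k t s) \<partial>lborel \<partial>lborel)"
    by (subst nn_integral_add[symmetric]) (auto intro!: nn_integral_cong nn_integral_add)
  also have "(\<integral>\<^sup>+t. \<integral>\<^sup>+s. ennreal (L * indicator {p..q} s) * ennreal (k t s) \<partial>lborel \<partial>lborel) =
     (\<integral>\<^sup>+s. \<integral>\<^sup>+t. ennreal (L * indicator {p..q} s) * ennreal (k t s) \<partial>lborel \<partial>lborel)"
    by (rule lborel_pair.Fubini'[symmetric]) measurable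
  also have "\<dots> = (\<integral>\<^sup>+s. ennreal (L * indicator {p..q} s) * (\<integral>\<^sup>+t. ennreal (k t s) \<partial>lborel) \<partial>lborel)"
    by (intro nn_integral_cong nn_integral_cmult) measurable
  also have "(\<integral>\<^sup>+t. \<integral>\<^sup>+s. ennreal (L * indicator {p..q} t) * ennreal (k t s) \<partial>lborel \<partial>lborel)
     = (\<integral>\<^sup>+t. ennreal (L * indicator {p..q} t) * (\<integral>\<^sup>+s. ennreal (k t s) \<partial>lborel) \<partial>lborel)"
    by (intro nn_integral_cong nn_integral_cmult) measurable
  also have "(\<integral>\<^sup>+t. ennreal (L * indicator {p..q} t) * (\<integral>\<^sup>+s. ennreal (k t s) \<partial>lborel) \<partial>lborel) +
      (\<integral>\<^sup>+s. ennreal (L * indicator {p..q} s) * (\<integral>\<^sup>+t. ennreal (k t s) \<partial>lborel) \<partial>lborel)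
     \<le> (\<integral>\<^sup>+t. ennreal (L * indicator {p..q} t) * ennreal (1 / (\<alpha> - \<beta>)) \<partial>lborel) +
      (\<integral>\<^sup>+s. ennreal (L * indicator {p..q} s) * ennreal (1 / (\<alpha> - \<beta>)) \<partial>lborel)"
    by (intro add_mono nn_integral_mono mult_left_mono ks kt) auto
  also have "\<dots> = ennreal (L * (q - p) / (\<alpha> - \<beta>) + L * (q - p) / (\<alpha> - \<beta>))"
    unfolding ind using L pq b by (intro ennreal_plus[symmetric]) auto
  also have "L * (q - p) / (\<alpha> - \<beta>) + L * (q - p) / (\<alpha> - \<beta>) = L * (q - p) * (2 / (\<alpha> - \<beta>))" by simp
  finally have T2: "(\<integral>\<^sup>+t. (\<integral>\<^sup>+s. ennreal (indicator {0..t} s * (\<bar>f t - f s\<bar> / (t - s) powr (\<beta> + 1))) \<partial>lborel) * indicator {0..1} t \<partial>lborel)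
     \<le> ennreal (L * (q - p) * (2 / (\<alpha> - \<beta>)))" .
  have "(\<lambda>t. \<integral>\<^sup>+s. ennreal ((if 0 \<le> s \<and> s \<le> t then 1 else 0) * (\<bar>f t - f s\<bar> / (t - s) powr (\<beta> + 1))) \<partial>lborel) \<in> borel_measurable borel"
    by measurable
  also have "(\<lambda>t. \<integral>\<^sup>+s. ennreal ((if 0 \<le> s \<and> s \<le> t then 1 else 0) * (\<bar>f t - f s\<bar> / (t - s) powr (\<beta> + 1))) \<partial>lborel) =
     (\<lambda>t. \<integral>\<^sup>+s. ennreal (indicator {0..t} s * (\<bar>f t - f s\<bar> / (t - s) powr (\<beta> + 1))) \<partial>lborel)"
    by (auto simp: fun_eq_iff indicator_def intro!: nn_integral_cong)
  finally have [measurable]: "(\<lambda>t. \<integral>\<^sup>+s. ennreal (indicator {0..t} s * (\<bar>f t - f s\<bar> / (t - s) powr (\<beta> + 1))) \<partial>lborel) \<in> borel_measurable borel" .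
  have "gls_norm \<beta> 0 1 f \<le> ennreal (L * (q - p) / (1 - \<beta>)) + ennreal (L * (q - p) * (2 / (\<alpha> - \<beta>)))"
    unfolding gls_norm_eq norm_density_def distrib_right
    by (rule order_trans[OF eq_refl[OF nn_integral_add] add_mono[OF T1 T2]]; measurable)
  also have "\<dots> = ennreal (L * (q - p) / (1 - \<beta>) + L * (q - p) * (2 / (\<alpha> - \<beta>)))"
    using L pq b by (intro ennreal_plus[symmetric]) auto
  also have "L * (q - p) / (1 - \<beta>) + L * (q - p) * (2 / (\<alpha> - \<beta>)) = L * (q - p) * (1 / (1 - \<beta>) + 2 / (\<alpha> - \<beta>))"
    by (simp add: distrib_left)
  finally show ?thesis .
qed

lemma ennreal_abs_suminf_le:
  fixes a :: "nat \<Rightarrow> real"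
  assumes "finite {n. a n \<noteq> 0}"
  shows "ennreal \<bar>\<Sum>n. a n\<bar> \<le> (\<Sum>n. ennreal \<bar>a n\<bar>)"
proof -
  have s: "summable (\<lambda>n. \<bar>a n\<bar>)" by (rule summable_finite[OF assms]) auto
  have "ennreal \<bar>\<Sum>n. a n\<bar> \<le> ennreal (\<Sum>n. \<bar>a n\<bar>)" by (intro ennreal_leI summable_rabs s)
  also have "\<dots> = (\<Sum>n. ennreal \<bar>a n\<bar>)" by (rule suminf_ennreal2[symmetric]) (use s in auto)
  finally show ?thesis .
qed

lemma frac_op_cmult: "frac_op \<beta> (\<lambda>u. c * f u) x = c * frac_op \<beta> f x"
proof -
  have "(LBINT u:{0..x}. (c * f x - c * f u) / (x - u) powr (\<beta> + 1)) =
      (LBINT u:{0..x}. c * ((f x - f u) / (x - u) powr (\<beta> + 1)))"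
    by (intro set_lebesgue_integral_cong) (auto simp: right_diff_distrib)
  also have "\<dots> = c * (LBINT u:{0..x}. (f x - f u) / (x - u) powr (\<beta> + 1))" by (rule set_integral_mult_right)
  finally show ?thesis by (simp add: frac_op_def algebra_simps)
qed

lemma gls_val_cmult: "gls_val \<beta> (\<lambda>u. c * f u) g = c * gls_val \<beta> f g"
proof -
  let ?h = "\<lambda>x. frac_op (1 - \<beta>) (\<lambda>y. g (1 - y) - g 1) (1 - x)"
  have "(LBINT x:{0..1}. frac_op \<beta> (\<lambda>u. c * f u) x * ?h x) = (LBINT x:{0..1}. c * (frac_op \<beta> f x * ?h x))"
    by (simp add: frac_op_cmult mult.assoc)
  also have "\<dots> = c * (LBINT x:{0..1}. frac_op \<beta> f x * ?h x)" by (rule set_integral_mult_right)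
  finally show ?thesis by (simp add: gls_val_def)
qed

lemma holder_cmult: "holder \<alpha> L f \<Longrightarrow> holder \<alpha> (\<bar>c\<bar> * L) (\<lambda>u. c * f u)"
  by (auto simp: holder_def abs_mult mult.assoc intro!: mult_left_mono simp flip: right_diff_distrib)

section \<open>Countable sums of integrands with finitely many nonzero terms at each point\<close>

context
  fixes f :: "nat \<Rightarrow> real \<Rightarrow> real" and \<beta> :: real
  assumes f_borel [measurable]: "\<And>n. f n \<in> borel_measurable borel"
    and finite_support: "\<And>x. finite {n. f n x \<noteq> 0}"
    and \<beta>: "0 < \<beta>" "\<beta> < 1"
begin

lemma norm_density_suminf: "norm_density \<beta> (\<lambda>x. \<Sum>n. f n x) t \<le> (\<Sum>n. norm_density \<beta> (f n) t)"
proof -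
  have sf: "summable (\<lambda>n. f n x)" for x by (rule summable_finite[OF finite_support]) auto
  have "ennreal (\<bar>\<Sum>n. f n t\<bar> / t powr \<beta>) = ennreal \<bar>\<Sum>n. f n t / t powr \<beta>\<bar>"
    by (simp add: suminf_divide[OF sf])
  also have "\<dots> \<le> (\<Sum>n. ennreal \<bar>f n t / t powr \<beta>\<bar>)"
    by (rule ennreal_abs_suminf_le) (rule finite_subset[OF _ finite_support[of t]], auto)
  finally have 1: "ennreal (\<bar>\<Sum>n. f n t\<bar> / t powr \<beta>) \<le> (\<Sum>n. ennreal (\<bar>f n t\<bar> / t powr \<beta>))" by simp
  have "(\<integral>\<^sup>+s. ennreal (indicator {0..t} s * (\<bar>(\<Sum>n. f n t) - (\<Sum>n. f n s)\<bar> / (t - s) powr (\<beta> + 1))) \<partial>lborel)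
    \<le> (\<integral>\<^sup>+s. (\<Sum>n. ennreal (indicator {0..t} s * (\<bar>f n t - f n s\<bar> / (t - s) powr (\<beta> + 1)))) \<partial>lborel)"
  proof (rule nn_integral_mono)
    fix s
    let ?a = "\<lambda>n. indicator {0..t} s * ((f n t - f n s) / (t - s) powr (\<beta> + 1)) :: real"
    have "(\<Sum>n. ?a n) = indicator {0..t} s * (((\<Sum>n. f n t) - (\<Sum>n. f n s)) / (t - s) powr (\<beta> + 1))"
      using sf by (simp add: suminf_mult suminf_divide suminf_diff summable_diff summable_divide del: times_divide_eq_right)
    then have "ennreal (indicator {0..t} s * (\<bar>(\<Sum>n. f n t) - (\<Sum>n. f n s)\<bar> / (t - s) powr (\<beta> + 1))) = ennreal \<bar>\<Sum>n. ?a n\<bar>"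
      by (simp add: abs_mult)
    also have "\<dots> \<le> (\<Sum>n. ennreal \<bar>?a n\<bar>)"
      by (rule ennreal_abs_suminf_le) (rule finite_subset[OF _ finite_UnI[OF finite_support[of t] finite_support[of s]]], auto)
    finally show "ennreal (indicator {0..t} s * (\<bar>(\<Sum>n. f n t) - (\<Sum>n. f n s)\<bar> / (t - s) powr (\<beta> + 1)))
      \<le> (\<Sum>n. ennreal (indicator {0..t} s * (\<bar>f n t - f n s\<bar> / (t - s) powr (\<beta> + 1))))"
      by (simp add: abs_mult)
  qed
  also have "\<dots> = (\<Sum>n. \<integral>\<^sup>+s. ennreal (indicator {0..t} s * (\<bar>f n t - f n s\<bar> / (t - s) powr (\<beta> + 1))) \<partial>lborel)"
    by (rule nn_integral_suminf) measurable
  finally show ?thesis unfolding norm_density_def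
    using 1 by (subst suminf_add[symmetric]) (auto intro!: add_mono)
qed

lemma gls_norm_suminf: "gls_norm \<beta> 0 1 (\<lambda>x. \<Sum>n. f n x) \<le> (\<Sum>n. gls_norm \<beta> 0 1 (f n))"
proof -
  have "gls_norm \<beta> 0 1 (\<lambda>x. \<Sum>n. f n x) \<le> (\<integral>\<^sup>+t. (\<Sum>n. norm_density \<beta> (f n) t * indicator {0..1} t) \<partial>lborel)"
    unfolding gls_norm_eq by (intro nn_integral_mono) (auto simp: indicator_def norm_density_suminf)
  also have "\<dots> = (\<Sum>n. gls_norm \<beta> 0 1 (f n))"
    unfolding gls_norm_eq by (rule nn_integral_suminf) measurable
  finally show ?thesis .
qed

text \<open>Pointwise the sum of the f n is finite; only the inner integral needs an exchange with
  the series, and the finite total density at x makes the quotients absolutely summable in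
  L1.\<close>

lemma frac_op_sums:
  assumes fin: "(\<Sum>n. norm_density \<beta> (f n) x) < \<infinity>"
  shows "(\<lambda>n. frac_op \<beta> (f n) x) sums frac_op \<beta> (\<lambda>x. \<Sum>n. f n x) x"
    and "summable (\<lambda>n. \<bar>frac_op \<beta> (f n) x\<bar>)"
proof -
  have sf: "summable (\<lambda>n. f n x)" for x by (rule summable_finite[OF finite_support]) auto
  have finn: "norm_density \<beta> (f n) x < \<infinity>" for n
    using sum_le_suminf[of "\<lambda>n. norm_density \<beta> (f n) x" "{n}"] fin by (auto intro: order_le_less_trans)
  have sum_top: "summable a" if "\<And>n. 0 \<le> a n" "\<And>n. ennreal (a n) \<le> norm_density \<beta> (f n) x" for a
  proof (rule summable_suminf_not_top)
    have "(\<Sum>n. ennreal (a n)) \<le> (\<Sum>n. norm_density \<beta> (f n) x)" by (intro suminf_le that) auto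
    then show "(\<Sum>n. ennreal (a n)) \<noteq> top" using fin by (auto simp: top_unique)
  qed (use that in auto)
  show "summable (\<lambda>n. \<bar>frac_op \<beta> (f n) x\<bar>)"
    by (rule sum_top) (auto intro: frac_op_le_norm_density \<beta>)
  define q where "q n u = indicator {0..x} u *\<^sub>R ((f n x - f n u) / (x - u) powr (\<beta> + 1))" for n u
  have qi: "integrable lborel (q n)" for n
    using norm_density_integrable[OF f_borel finn] by (simp add: set_integrable_def q_def[abs_def])
  have "(\<lambda>n. integral\<^sup>L lborel (q n)) sums (\<integral>u. (\<Sum>n. q n u) \<partial>lborel)"
  proof (rule sums_integral[OF qi])
    have "finite {n. norm (q n u) \<noteq> 0}" for u
      by (rule finite_subset[OF _ finite_UnI[OF finite_support[of x] finite_support[of u]]]) (auto simp: q_def)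
    then have "summable (\<lambda>n. norm (q n u))" for u
      by (rule summable_finite) auto
    then show "AE u in lborel. summable (\<lambda>n. norm (q n u))" by simp
    show "summable (\<lambda>n. \<integral>u. norm (q n u) \<partial>lborel)"
    proof (rule sum_top)
      fix n
      have "ennreal (\<integral>u. norm (q n u) \<partial>lborel) = (\<integral>\<^sup>+u. ennreal (norm (q n u)) \<partial>lborel)"
        using qi by (intro nn_integral_eq_integral[symmetric]) auto
      also have "\<dots> = (\<integral>\<^sup>+s. ennreal (indicator {0..x} s * (\<bar>f n x - f n s\<bar> / (x - s) powr (\<beta> + 1))) \<partial>lborel)"
        by (intro nn_integral_cong) (auto simp: q_def indicator_def)
      also have "\<dots> \<le> norm_density \<beta> (f n) x" by (simp add: norm_density_def)
      finally show "ennreal (\<integral>u. norm (q n u) \<partial>lborel) \<le> norm_density \<beta> (f n) x" .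
    qed simp
  qed
  also have "(\<lambda>u. \<Sum>n. q n u) = (\<lambda>u. indicator {0..x} u *\<^sub>R (((\<Sum>n. f n x) - (\<Sum>n. f n u)) / (x - u) powr (\<beta> + 1)))"
    using sf by (auto simp: fun_eq_iff q_def indicator_def suminf_divide suminf_diff summable_diff)
  finally have 1: "(\<lambda>n. LBINT u:{0..x}. (f n x - f n u) / (x - u) powr (\<beta> + 1)) sums
     (LBINT u:{0..x}. ((\<Sum>n. f n x) - (\<Sum>n. f n u)) / (x - u) powr (\<beta> + 1))"
    by (simp add: set_lebesgue_integral_def q_def[abs_def])
  show "(\<lambda>n. frac_op \<beta> (f n) x) sums frac_op \<beta> (\<lambda>x. \<Sum>n. f n x) x"
    unfolding frac_op_def by (intro sums_add sums_divide sums_mult 1 summable_sums sf)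
qed

text \<open>The derivative of the integrator is bounded, so summable norms dominate the products and
  the series may be integrated term by term. Almost every point has finite total density.\<close>

lemma gls_val_sums:
  assumes fin: "(\<Sum>n. gls_norm \<beta> 0 1 (f n)) < \<infinity>"
    and g: "holder \<alpha> L g" "1 - \<beta> < \<alpha>"
  shows "(\<lambda>n. gls_val \<beta> (f n) g) sums gls_val \<beta> (\<lambda>x. \<Sum>n. f n x) g"
proof -
  define h where "h x = frac_op (1 - \<beta>) (\<lambda>y. g (1 - y) - g 1) (1 - x)" for x
  have [measurable]: "g \<in> borel_measurable borel" using holder_borel[OF g(1)] g \<beta> by auto
  have [measurable]: "h \<in> borel_measurable borel" unfolding h_def by measurable
  define M where "M = L + L / (\<alpha> - (1 - \<beta>))"
  have M: "0 \<le> M" using holder_nonneg[OF g(1)] g by (simp add: M_def)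
  have h_bd: "\<bar>h x\<bar> \<le> M" if "0 \<le> x" "x \<le> 1" for x
    unfolding h_def M_def using that g \<beta> by (intro frac_op_bound_0[OF holder_reflect[OF g(1)]]) auto
  have finn: "gls_norm \<beta> 0 1 (f n) < \<infinity>" for n
    using sum_le_suminf[of "\<lambda>n. gls_norm \<beta> 0 1 (f n)" "{n}"] fin by (auto intro: order_le_less_trans)
  note fi = frac_op_integrable[OF f_borel \<beta> finn]
  define q where "q n x = indicator {0..1} x *\<^sub>R (frac_op \<beta> (f n) x * h x)" for n x
  have q_bd: "norm (q n x) \<le> M * (indicator {0..1} x *\<^sub>R \<bar>frac_op \<beta> (f n) x\<bar>)" for n x
    using mult_left_mono[OF h_bd[of x], of "\<bar>frac_op \<beta> (f n) x\<bar>"]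
    by (auto simp: q_def indicator_def abs_mult mult.commute)
  have ai: "integrable lborel (\<lambda>x. M * (indicator {0..1} x *\<^sub>R \<bar>frac_op \<beta> (f n) x\<bar>))" for n
    using set_integrable_abs[OF fi(1)] unfolding set_integrable_def by (rule integrable_mult_right)
  have qi: "integrable lborel (q n)" for n
  proof (rule Bochner_Integration.integrable_bound[OF ai])
    show "AE x in lborel. norm (q n x) \<le> norm (M * (indicator {0..1} x *\<^sub>R \<bar>frac_op \<beta> (f n) x\<bar>))"
      by (intro AE_I2 order_trans[OF q_bd]) (simp only: real_norm_def abs_ge_self)
    show "q n \<in> borel_measurable lborel" unfolding q_def[abs_def] by measurable
  qed
  have AEfin: "AE x in lborel. x \<in> {0..1} \<longrightarrow> (\<Sum>n. norm_density \<beta> (f n) x) < \<infinity>"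
  proof -
    have "(\<integral>\<^sup>+x. (\<Sum>n. norm_density \<beta> (f n) x * indicator {0..1} x) \<partial>lborel) = (\<Sum>n. gls_norm \<beta> 0 1 (f n))"
      unfolding gls_norm_eq by (rule nn_integral_suminf) measurable
    then have "AE x in lborel. (\<Sum>n. norm_density \<beta> (f n) x * indicator {0..1} x) \<noteq> \<infinity>"
      using fin by (intro nn_integral_noteq_infinite) auto
    then show ?thesis by eventually_elim (auto simp: less_top)
  qed
  have "(\<lambda>n. integral\<^sup>L lborel (q n)) sums (\<integral>x. (\<Sum>n. q n x) \<partial>lborel)"
  proof (rule sums_integral[OF qi])
    show "AE x in lborel. summable (\<lambda>n. norm (q n x))"
      using AEfin
    proof eventually_elim
      case (elim x)
      show ?case
      proof (cases "x \<in> {0..1}")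
        case True
        then have "summable (\<lambda>n. \<bar>frac_op \<beta> (f n) x\<bar> * \<bar>h x\<bar>)"
          using elim by (intro summable_mult2 frac_op_sums(2)) auto
        then show ?thesis using True by (simp add: q_def abs_mult)
      qed (simp add: q_def)
    qed
    show "summable (\<lambda>n. \<integral>x. norm (q n x) \<partial>lborel)"
    proof (rule summable_comparison_test')
      have "(\<Sum>n. ennreal (LBINT x:{0..1}. \<bar>frac_op \<beta> (f n) x\<bar>)) \<le> (\<Sum>n. gls_norm \<beta> 0 1 (f n))"
        by (intro suminf_le fi(3)) auto
      then have "summable (\<lambda>n. LBINT x:{0..1}. \<bar>frac_op \<beta> (f n) x\<bar>)"
        using fin by (intro summable_suminf_not_top) (auto simp: top_unique set_lebesgue_integral_def)
      then show "summable (\<lambda>n. M * (LBINT x:{0..1}. \<bar>frac_op \<beta> (f n) x\<bar>))" by (rule summable_mult)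
      fix n
      have "(\<integral>x. norm (q n x) \<partial>lborel) \<le> (\<integral>x. M * (indicator {0..1} x *\<^sub>R \<bar>frac_op \<beta> (f n) x\<bar>) \<partial>lborel)"
        by (intro integral_mono ai q_bd) (use qi in auto)
      then show "norm (\<integral>x. norm (q n x) \<partial>lborel) \<le> M * (LBINT x:{0..1}. \<bar>frac_op \<beta> (f n) x\<bar>)"
        by (simp add: set_lebesgue_integral_def)
    qed
  qed
  also have "(\<integral>x. (\<Sum>n. q n x) \<partial>lborel) = (LBINT x:{0..1}. frac_op \<beta> (\<lambda>x. \<Sum>n. f n x) x * h x)"
    unfolding set_lebesgue_integral_def
  proof (rule integral_cong_AE)
    show "AE x in lborel. (\<Sum>n. q n x) = indicator {0..1} x *\<^sub>R (frac_op \<beta> (\<lambda>x. \<Sum>n. f n x) x * h x)"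
      using AEfin
    proof eventually_elim
      case (elim x)
      show ?case
      proof (cases "x \<in> {0..1}")
        case True
        then have "(\<lambda>n. frac_op \<beta> (f n) x * h x) sums (frac_op \<beta> (\<lambda>x. \<Sum>n. f n x) x * h x)"
          using elim by (intro sums_mult2 frac_op_sums(1)) auto
        then show ?thesis using True by (simp add: q_def sums_iff)
      qed (simp add: q_def)
    qed
    show "(\<lambda>x. \<Sum>n. q n x) \<in> borel_measurable lborel" unfolding q_def by measurable
  qed measurable
  finally show ?thesis
    unfolding gls_val_def h_def[symmetric] by (intro sums_mult) (simp add: set_lebesgue_integral_def q_def[abs_def])
qed

end

section \<open>The integrand along a path\<close>

definition grid :: "nat \<Rightarrow> real" where "grid n = 1 - (1/2) ^ n"
text \<open>Block n has length 2^(-n)/2; this is half of it.\<close>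

definition half_len :: "nat \<Rightarrow> real" where "half_len n = (1/2) ^ n / 4"
definition grid_mid :: "nat \<Rightarrow> real" where "grid_mid n = grid n + half_len n"

text \<open>In use \<gamma> slightly exceeds \<alpha>: the level must be small enough to be reached
  with high probability, yet large enough to keep the norm under control.\<close>

definition unit_block :: "real \<Rightarrow> (real \<Rightarrow> real) \<Rightarrow> nat \<Rightarrow> real \<Rightarrow> real" where
  "unit_block \<gamma> x n = block x (grid n) (grid_mid n) (grid (Suc n)) (half_len n powr \<gamma>)"

definition unit_val :: "real \<Rightarrow> (real \<Rightarrow> real) \<Rightarrow> nat \<Rightarrow> real" where
  "unit_val \<gamma> x n = block_val x (grid n) (grid_mid n) (grid (Suc n)) (half_len n powr \<gamma>)"

text \<open>The integral up to \<open>grid n\<close> of the integrand below; block \<open>n\<close> aims at making it equal to \<open>z (grid n)\<close>.\<close>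

fun realized :: "real \<Rightarrow> (real \<Rightarrow> real) \<Rightarrow> (real \<Rightarrow> real) \<Rightarrow> nat \<Rightarrow> real" where
  "realized \<gamma> x z 0 = 0"
| "realized \<gamma> x z (Suc n) = realized \<gamma> x z n + (z (grid n) - realized \<gamma> x z n) * unit_val \<gamma> x n"

text \<open>The blocks vanish outside disjoint open intervals, so at most one term is nonzero at any
  point and the value from time 1 on is 0.\<close>

definition integrand :: "real \<Rightarrow> (real \<Rightarrow> real) \<Rightarrow> (real \<Rightarrow> real) \<Rightarrow> real \<Rightarrow> real" where
  "integrand \<gamma> x z u = (\<Sum>n. (z (grid n) - realized \<gamma> x z n) * unit_block \<gamma> x n u)"

lemma grid_facts: "0 \<le> grid n" "grid n < grid_mid n" "grid_mid n < grid (Suc n)" "grid n < 1" "grid (Suc n) - grid_mid n = half_len n"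
  "grid (Suc n) - grid n = 2 * half_len n" "0 < half_len n" "half_len n < 1" "half_len (Suc n) = half_len n / 2"
proof -
  have "(1/2::real) ^ n \<le> 1" by (rule power_le_one) auto
  moreover have "(0::real) < (1/2) ^ n" by simp
  moreover have "(1/2::real) ^ Suc n = (1/2) ^ n / 2" by simp
  ultimately show "0 \<le> grid n" "grid n < grid_mid n" "grid_mid n < grid (Suc n)" "grid n < 1" "grid (Suc n) - grid_mid n = half_len n"
    "grid (Suc n) - grid n = 2 * half_len n" "0 < half_len n" "half_len n < 1" "half_len (Suc n) = half_len n / 2"
    unfolding grid_mid_def grid_def half_len_def by linarith+
qed

lemma half_len_powr: "half_len n powr p = (1/4) powr p * ((1/2) powr p) ^ n"
proof (induction n)
  case (Suc n)
  have "half_len (Suc n) powr p = (half_len n * (1/2)) powr p" by (simp add: grid_facts(9))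
  also have "\<dots> = half_len n powr p * (1/2) powr p" by (rule powr_mult)
  finally show ?case unfolding Suc.IH by simp
qed (simp add: half_len_def)

lemma grid_mono: "m \<le> n \<Longrightarrow> grid m \<le> grid n"
  unfolding grid_def by (simp add: power_decreasing)

lemma grid_tendsto: "grid \<longlonglongrightarrow> 1"
proof -
  have "(\<lambda>n. 1 - (1/2::real) ^ n) \<longlonglongrightarrow> 1 - 0" by (intro tendsto_diff tendsto_const LIMSEQ_realpow_zero) auto
  then show ?thesis by (simp add: grid_def[abs_def])
qed

lemma grid_exceeds:
  assumes "u < 1"
  obtains n where "u < grid n"
  using order_tendstoD(1)[OF grid_tendsto assms] by (auto simp: eventually_sequentially)

lemma unit_block_support:
  assumes "u \<le> grid n \<or> grid (Suc n) \<le> u"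
  shows "unit_block \<gamma> x n u = 0"
  using assms
proof
  assume "u \<le> grid n"
  then have "max (grid n) (min (grid_mid n) u) = grid n" by simp
  then show ?thesis by (simp add: unit_block_def block_def bump_def)
next
  assume "grid (Suc n) \<le> u"
  then have "(grid (Suc n) - u) / (grid (Suc n) - grid_mid n) \<le> 0" using grid_facts(3)[of n] by (intro divide_nonpos_pos) auto
  then show ?thesis by (simp add: unit_block_def block_def cutoff_def)
qed

lemma finite_unit_blocks: "finite {n. c n * unit_block \<gamma> x n u \<noteq> 0}"
proof (cases "u < 1")
  case True
  then obtain N where "u < grid N" by (rule grid_exceeds)
  then have "{n. c n * unit_block \<gamma> x n u \<noteq> 0} \<subseteq> {..<N}"
    using unit_block_support[of u _ \<gamma> x] grid_mono[of N] by (force simp: not_less)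
  then show ?thesis by (rule finite_subset) simp
next
  case False
  then have "unit_block \<gamma> x n u = 0" for n using grid_facts(4)[of "Suc n"] by (intro unit_block_support) auto
  then show ?thesis by simp
qed

lemma integrand_eq_sum:
  assumes "u < grid N"
  shows "integrand \<gamma> x z u = (\<Sum>n<N. (z (grid n) - realized \<gamma> x z n) * unit_block \<gamma> x n u)"
  unfolding integrand_def
proof (rule suminf_finite)
  fix n assume "n \<notin> {..<N}"
  then have "unit_block \<gamma> x n u = 0" using assms grid_mono[of N n] by (intro unit_block_support) auto
  then show "(z (grid n) - realized \<gamma> x z n) * unit_block \<gamma> x n u = 0" by simp
qed simp

text \<open>Lets the path be replaced by its constant extension beyond [0,1]: every grid point and
  clamped time stays in [0,1].\<close>

lemma integrand_cong:
  assumes x: "\<And>u. u \<in> {0..1} \<Longrightarrow> x u = x' u" and z: "\<And>u. u \<in> {0..1} \<Longrightarrow> z u = z' u"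
  shows "integrand \<gamma> x z = integrand \<gamma> x' z'"
proof -
  have t: "grid n \<in> {0..1}" "grid_mid n \<in> {0..1}" "grid (Suc n) \<in> {0..1}" for n
    using grid_facts[of n] grid_facts(4)[of "Suc n"] by auto
  have b: "unit_block \<gamma> x n u = unit_block \<gamma> x' n u" for n u
  proof -
    have "v \<in> {0..1}" if "v \<in> {grid n..max (grid n) (min (grid_mid n) u)}" for v
      using that t[of n] by auto
    then have "(\<forall>v\<in>{grid n..max (grid n) (min (grid_mid n) u)}. \<bar>x v - x (grid n)\<bar> < half_len n powr \<gamma>) \<longleftrightarrow>
      (\<forall>v\<in>{grid n..max (grid n) (min (grid_mid n) u)}. \<bar>x' v - x' (grid n)\<bar> < half_len n powr \<gamma>)"
      using x t by auto
    moreover have "max (grid n) (min (grid_mid n) u) \<in> {0..1}" using t[of n] by auto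
    ultimately show ?thesis using x t by (simp add: unit_block_def block_def)
  qed
  have v: "unit_val \<gamma> x n = unit_val \<gamma> x' n" for n
  proof -
    have "v \<in> {0..1}" if "v \<in> {grid n..grid_mid n} \<or> v \<in> {grid_mid n..grid (Suc n)}" for v
      using that t[of n] by auto
    then have "(\<forall>v\<in>{grid n..grid_mid n}. \<bar>x v - x (grid n)\<bar> < half_len n powr \<gamma>) \<longleftrightarrow>
      (\<forall>v\<in>{grid n..grid_mid n}. \<bar>x' v - x' (grid n)\<bar> < half_len n powr \<gamma>)"
      and "(LBINT u:{grid_mid n..grid (Suc n)}. x u) = (LBINT u:{grid_mid n..grid (Suc n)}. x' u)"
      using x t by (auto intro!: set_lebesgue_integral_cong)
    then show ?thesis using x t by (simp add: unit_val_def block_val_def stopped_val_def)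
  qed
  have "realized \<gamma> x z n = realized \<gamma> x' z' n" for n
    by (induction n) (use z t v in auto)
  then show ?thesis using b z t by (auto simp: integrand_def fun_eq_iff)
qed

lemma holder_mono: "holder \<alpha> L f \<Longrightarrow> L \<le> L' \<Longrightarrow> holder \<alpha> L' f"
  unfolding holder_def by (meson mult_right_mono order_trans powr_ge_zero)

text \<open>The factor 16 is 4 + 12 D^2 with D = 1; both powers of 2 stem from the block length 2 l;
  the last factor is that of \<open>gls_norm_support\<close> for the order \<beta> +
  \<kappa>.\<close>

definition norm_const :: "real \<Rightarrow> real \<Rightarrow> real \<Rightarrow> real \<Rightarrow> real" where
  "norm_const \<alpha> \<beta> \<kappa> L = 16 * (L + 1) * 2 powr (\<alpha> - (\<beta> + \<kappa>)) * 2 * (1 / (1 - \<beta>) + 2 / \<kappa>)"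

context
  fixes \<alpha> a L K \<kappa> \<beta> \<gamma> :: real and x z :: "real \<Rightarrow> real"
  assumes \<alpha>: "1 / 2 < \<alpha>" "\<alpha> \<le> 1" and a: "0 < a" "a \<le> 2 * \<alpha> - 1"
    and \<kappa>_def: "\<kappa> = a / 5" and \<beta>_def: "\<beta> = 1 - \<alpha> + \<kappa>" and \<gamma>_def: "\<gamma> = \<alpha> + \<kappa>"
    and x: "holder \<alpha> L x"
begin

text \<open>The condition that shapes the choice is \<open>\<beta> + \<kappa> < \<alpha>\<close>,
  that is 2\<kappa> < 2\<alpha> - 1; it follows from a being at most 2\<alpha> - 1.\<close>

lemma param: "0 < \<kappa>" "0 < \<beta>" "\<beta> < 1" "1 - \<alpha> < \<beta>" "\<beta> < \<alpha>" "1 - \<beta> < \<alpha>" "\<beta> + \<kappa> < \<alpha>" "0 < \<alpha>"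
  using \<alpha> a by (auto simp: \<kappa>_def \<beta>_def)

lemma unit_block_cases:
  obtains \<tau> where "grid n \<le> \<tau>" "\<tau> \<le> grid_mid n"
    "unit_block \<gamma> x n = stopped x (grid n) \<tau> (grid_mid n) (grid (Suc n)) (half_len n powr \<gamma>)"
    "unit_val \<gamma> x n = stopped_val x (grid n) \<tau> (grid_mid n) (grid (Suc n)) (half_len n powr \<gamma>)"
    "\<And>u. u \<in> {grid n..\<tau>} \<Longrightarrow> \<bar>x u - x (grid n)\<bar> \<le> half_len n powr \<gamma>"
proof -
  have "continuous_on UNIV x" by (rule holder_continuous[OF x param(8)])
  show ?thesis
  proof (rule block_stopped[OF \<open>continuous_on UNIV x\<close>, of "grid n" "grid_mid n" "half_len n powr \<gamma>" "grid (Suc n)"])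
    show "grid n \<le> grid_mid n" "0 < half_len n powr \<gamma>" using grid_facts[of n] by auto
  qed (rule that[unfolded unit_block_def unit_val_def])
qed

lemma gls_val_unit_block: "gls_val \<beta> (unit_block \<gamma> x n) x = unit_val \<gamma> x n"
proof -
  obtain \<tau> where \<tau>: "grid n \<le> \<tau>" "\<tau> \<le> grid_mid n"
    "unit_block \<gamma> x n = stopped x (grid n) \<tau> (grid_mid n) (grid (Suc n)) (half_len n powr \<gamma>)"
    "unit_val \<gamma> x n = stopped_val x (grid n) \<tau> (grid_mid n) (grid (Suc n)) (half_len n powr \<gamma>)"
    by (rule unit_block_cases[of n]) (rule that; assumption)
  show ?thesis unfolding \<tau>(3,4)
    using grid_facts[of n] grid_facts(4)[of "Suc n"] \<tau>(1,2) param \<alpha>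
    by (intro gls_val_stopped[OF x]) auto
qed

text \<open>One factor l^(-\<gamma>) comes from the prefactor of the block, the other from the
  rescaling inside the bump; the slope of the cutoff costs only l^(-\<alpha>), which is smaller as l
  < 1.\<close>

lemma unit_block_holder: "holder \<alpha> (16 * (L + 1) * half_len n powr (- 2 * \<gamma>)) (unit_block \<gamma> x n)"
proof -
  obtain \<tau> where \<tau>: "grid n \<le> \<tau>" "\<tau> \<le> grid_mid n"
    "unit_block \<gamma> x n = stopped x (grid n) \<tau> (grid_mid n) (grid (Suc n)) (half_len n powr \<gamma>)"
    "\<And>u. u \<in> {grid n..\<tau>} \<Longrightarrow> \<bar>x u - x (grid n)\<bar> \<le> half_len n powr \<gamma>"
    by (rule unit_block_cases[of n]) (rule that; assumption)
  note t = grid_facts[of n]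
  have "holder \<alpha> ((4 + 12 * 1 ^ 2) * (L / (half_len n powr \<gamma>) + 1 * (grid (Suc n) - grid_mid n) powr (-\<alpha>)) / (half_len n powr \<gamma>)) (unit_block \<gamma> x n)"
    unfolding \<tau>(3) using \<tau> t param \<alpha> by (intro stopped_holder x) auto
  moreover have "(4 + 12 * 1 ^ 2) * (L / (half_len n powr \<gamma>) + 1 * (grid (Suc n) - grid_mid n) powr (-\<alpha>)) / (half_len n powr \<gamma>)
      \<le> 16 * (L + 1) * half_len n powr (- 2 * \<gamma>)"
  proof -
    have "half_len n powr (-\<alpha>) \<le> half_len n powr (-\<gamma>)" using t param by (intro powr_mono') (auto simp: \<gamma>_def)
    then have "L * half_len n powr (-\<gamma>) + half_len n powr (-\<alpha>) \<le> (L + 1) * half_len n powr (-\<gamma>)" by (simp add: algebra_simps)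
    then have "(16 * (L * half_len n powr (-\<gamma>) + half_len n powr (-\<alpha>))) * half_len n powr (-\<gamma>) \<le> (16 * ((L + 1) * half_len n powr (-\<gamma>))) * half_len n powr (-\<gamma>)"
      by (intro mult_right_mono mult_left_mono) auto
    also have "\<dots> = 16 * (L + 1) * half_len n powr (- 2 * \<gamma>)" by (simp add: mult.assoc flip: powr_add)
    finally show ?thesis unfolding t(5) by (simp add: powr_minus divide_inverse)
  qed
  ultimately show ?thesis by (rule holder_mono)
qed

abbreviation "cst \<equiv> norm_const \<alpha> \<beta> \<kappa> L"

lemma cst_nonneg: "0 \<le> cst"
  unfolding norm_const_def using holder_nonneg[OF x] param by (intro mult_nonneg_nonneg add_nonneg_nonneg) auto

text \<open>The order is lowered from \<alpha> to \<beta> + \<kappa>, just above \<beta>, and the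
  short support pays. The exponent of l is -2\<gamma> + (\<alpha> - \<beta> - \<kappa>) + 1 =
  -4\<kappa> = \<kappa> - a.\<close>

lemma gls_norm_unit_block:
  "gls_norm \<beta> 0 1 (\<lambda>u. c * unit_block \<gamma> x n u) \<le> ennreal (\<bar>c\<bar> * (cst * half_len n powr (\<kappa> - a)))"
proof -
  let ?M = "\<bar>c\<bar> * (16 * (L + 1) * half_len n powr (- 2 * \<gamma>))"
  let ?q = "grid (Suc n) - grid n"
  note t = grid_facts[of n]
  have sup: "c * unit_block \<gamma> x n u = 0" if "u \<le> grid n \<or> grid (Suc n) \<le> u" for u
    using unit_block_support[OF that] by simp
  have "holder (\<beta> + \<kappa>) (?M * ?q powr (\<alpha> - (\<beta> + \<kappa>))) (\<lambda>u. c * unit_block \<gamma> x n u)"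
    using t param by (intro holder_weaken_support[OF holder_cmult[OF unit_block_holder] sup]) auto
  then have "gls_norm \<beta> 0 1 (\<lambda>u. c * unit_block \<gamma> x n u)
      \<le> ennreal (?M * ?q powr (\<alpha> - (\<beta> + \<kappa>)) * ?q * (1 / (1 - \<beta>) + 2 / ((\<beta> + \<kappa>) - \<beta>)))"
    using t param grid_facts(4)[of "Suc n"] by (intro gls_norm_support[OF _ sup]) auto
  also have "?M * ?q powr (\<alpha> - (\<beta> + \<kappa>)) * ?q * (1 / (1 - \<beta>) + 2 / ((\<beta> + \<kappa>) - \<beta>))
     = \<bar>c\<bar> * (cst * (half_len n powr (- 2 * \<gamma>) * half_len n powr (\<alpha> - (\<beta> + \<kappa>)) * half_len n powr 1))"
    using t unfolding t(6) norm_const_def by (simp add: powr_mult)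
  also have "half_len n powr (- 2 * \<gamma>) * half_len n powr (\<alpha> - (\<beta> + \<kappa>)) * half_len n powr 1 = half_len n powr (\<kappa> - a)"
    unfolding powr_add[symmetric] by (rule arg_cong[where f="\<lambda>e. half_len n powr e"]) (simp add: \<gamma>_def \<beta>_def \<kappa>_def)
  finally show ?thesis .
qed

lemma integrand_borel: "integrand \<gamma> x z \<in> borel_measurable borel"
proof -
  have [measurable]: "unit_block \<gamma> x n \<in> borel_measurable borel" for n
    by (rule holder_borel[OF unit_block_holder param(8)])
  show ?thesis unfolding integrand_def[abs_def] by measurable
qed

text \<open>Below each \<open>grid N\<close> the series is a finite sum of continuous blocks, and
  these open sets exhaust everything below 1.\<close>

lemma integrand_continuous: "continuous_on {0..<1} (integrand \<gamma> x z)"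
proof -
  have "continuous_on {..<grid N} (integrand \<gamma> x z)" for N
  proof -
    have "continuous_on {..<grid N} (\<lambda>u. \<Sum>n<N. (z (grid n) - realized \<gamma> x z n) * unit_block \<gamma> x n u)"
      using holder_continuous[OF unit_block_holder param(8)]
      by (intro continuous_intros) (auto intro: continuous_on_subset)
    also have "?this \<longleftrightarrow> ?thesis"
      by (intro continuous_on_cong) (auto simp: integrand_eq_sum)
    finally show ?thesis .
  qed
  then have "continuous_on (\<Union>N. {..<grid N}) (integrand \<gamma> x z)"
    by (intro continuous_on_open_UN) auto
  moreover have "{0..<1} \<subseteq> (\<Union>N. {..<grid N})"
  proof
    fix u :: real assume "u \<in> {0..<1}"
    then have "u < 1" by simp
    then obtain n where "u < grid n" by (rule grid_exceeds)
    then show "u \<in> (\<Union>N. {..<grid N})" by blast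
  qed
  ultimately show ?thesis by (rule continuous_on_subset)
qed

text \<open>The block integrals are the increments of \<open>realized\<close>, so their series
  telescopes to its limit, while the norms of the blocks are dominated by a geometric
  series.\<close>

lemma integrand_integral:
  assumes z: "\<And>u v. u \<in> {0..1} \<Longrightarrow> v \<in> {0..1} \<Longrightarrow> \<bar>z u - z v\<bar> \<le> K * \<bar>u - v\<bar> powr a"
    and hit: "\<forall>\<^sub>F n in sequentially. \<exists>v\<in>{grid n..grid_mid n}. \<bar>x v - x (grid n)\<bar> \<ge> half_len n powr \<gamma>"
  shows "gls_norm \<beta> 0 1 (integrand \<gamma> x z) < \<infinity>" "gls_val \<beta> (integrand \<gamma> x z) x = z 1"
proof -
  define V where "V n = z (grid n) - realized \<gamma> x z n" for n
  define f where "f n u = V n * unit_block \<gamma> x n u" for n u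
  have eq: "integrand \<gamma> x z = (\<lambda>u. \<Sum>n. f n u)" by (simp add: fun_eq_iff integrand_def f_def V_def)
  obtain N where N: "\<And>n. n \<ge> N \<Longrightarrow> \<exists>v\<in>{grid n..grid_mid n}. \<bar>x v - x (grid n)\<bar> \<ge> half_len n powr \<gamma>"
    using hit by (auto simp: eventually_sequentially)
  have val1: "unit_val \<gamma> x n = 1" if "n \<ge> N" for n
    using N[OF that] by (auto simp: unit_val_def block_val_def not_less)
  have grid01: "grid n \<in> {0..1}" for n using grid_facts[of n] by auto
  \<comment> \<open>With unit value 1 the update forgets the past: the accumulated error is
    cancelled in a single step.\<close>
  have realized_eq: "realized \<gamma> x z (Suc n) = z (grid n)" if "n \<ge> N" for n
    using val1[OF that] by simp
  have K: "0 \<le> K" using z[of 0 1] by (auto intro: order_trans[OF abs_ge_zero])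
  \<comment> \<open>One index later than N, since only then was the previous block successful: the
    coefficient is z(\<open>grid n\<close>) minus z(\<open>grid (n - 1)\<close>), over a distance of
    4 l.\<close>
  have V_bd: "\<bar>V n\<bar> \<le> K * 4 powr a * half_len n powr a" if "n \<ge> Suc N" for n
  proof -
    define k where "k = n - 1"
    have k: "n = Suc k" "k \<ge> N" using that by (auto simp: k_def)
    have "\<bar>V n\<bar> = \<bar>z (grid n) - z (grid k)\<bar>" using realized_eq[OF k(2)] by (simp add: V_def k(1) del: realized.simps)
    also have "\<dots> \<le> K * \<bar>grid n - grid k\<bar> powr a" by (rule z) (rule grid01)+
    also have "\<bar>grid n - grid k\<bar> = 4 * half_len n" using grid_facts[of k] by (simp add: k(1))
    also have "K * (4 * half_len n) powr a = K * 4 powr a * half_len n powr a" using grid_facts(7)[of n] by (simp add: powr_mult)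
    finally show ?thesis .
  qed
  \<comment> \<open>The coefficient gains l^a and the norm costs l^(\<kappa> - a); what remains is
    l^\<kappa>, geometric with ratio 2^(-\<kappa>).\<close>
  define B where "B n = \<bar>V n\<bar> * (cst * half_len n powr (\<kappa> - a))" for n
  have "summable B"
  proof (rule summable_comparison_test_ev)
    have "norm (B n) \<le> K * 4 powr a * cst * (1/4) powr \<kappa> * ((1/2) powr \<kappa>) ^ n" if "n \<ge> Suc N" for n
    proof -
      have "norm (B n) = B n" using cst_nonneg by (simp add: B_def)
      also have "\<dots> \<le> (K * 4 powr a * half_len n powr a) * (cst * half_len n powr (\<kappa> - a))"
        unfolding B_def using V_bd[OF that] cst_nonneg by (intro mult_right_mono) auto
      also have "\<dots> = K * 4 powr a * cst * (half_len n powr a * half_len n powr (\<kappa> - a))" by simp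
      also have "half_len n powr a * half_len n powr (\<kappa> - a) = half_len n powr \<kappa>" by (simp flip: powr_add)
      also have "half_len n powr \<kappa> = (1/4) powr \<kappa> * ((1/2) powr \<kappa>) ^ n" by (rule half_len_powr)
      finally show ?thesis by (simp add: mult.assoc)
    qed
    then show "\<forall>\<^sub>F n in sequentially. norm (B n) \<le> K * 4 powr a * cst * (1/4) powr \<kappa> * ((1/2) powr \<kappa>) ^ n"
      unfolding eventually_sequentially by blast
    have "(1/2::real) powr \<kappa> < 1 powr \<kappa>" using param by (intro powr_less_mono2) auto
    then show "summable (\<lambda>n. K * 4 powr a * cst * (1/4) powr \<kappa> * ((1/2) powr \<kappa>) ^ n)"
      by (intro summable_mult summable_geometric) simp
  qed
  have "(\<Sum>n. gls_norm \<beta> 0 1 (f n)) \<le> (\<Sum>n. ennreal (B n))"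
    unfolding f_def[abs_def] B_def by (intro suminf_le gls_norm_unit_block) auto
  also have "\<dots> = ennreal (\<Sum>n. B n)"
  proof (rule suminf_ennreal2[OF _ \<open>summable B\<close>])
    show "0 \<le> B n" for n using cst_nonneg by (simp add: B_def)
  qed
  also have "\<dots> < \<infinity>" by simp
  finally have fin: "(\<Sum>n. gls_norm \<beta> 0 1 (f n)) < \<infinity>" .
  have fb: "f n \<in> borel_measurable borel" for n
    unfolding f_def[abs_def] by (intro borel_measurable_times borel_measurable_const holder_borel[OF unit_block_holder param(8)])
  have ff: "finite {n. f n u \<noteq> 0}" for u unfolding f_def by (rule finite_unit_blocks)
  show "gls_norm \<beta> 0 1 (integrand \<gamma> x z) < \<infinity>"
    unfolding eq using gls_norm_suminf[of f \<beta>, OF fb ff] fin param by (auto intro: order_le_less_trans)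
  have "(\<lambda>n. gls_val \<beta> (f n) x) sums gls_val \<beta> (integrand \<gamma> x z) x"
    unfolding eq by (rule gls_val_sums[OF fb ff _ _ fin x]) (use param in auto)
  moreover have "gls_val \<beta> (f n) x = realized \<gamma> x z (Suc n) - realized \<gamma> x z n" for n
    unfolding f_def[abs_def] gls_val_cmult gls_val_unit_block by (simp add: V_def)
  moreover have "realized \<gamma> x z \<longlonglongrightarrow> z 1"
  proof -
    have "(\<lambda>n. K * \<bar>grid n - 1\<bar> powr a) \<longlonglongrightarrow> K * \<bar>1 - 1\<bar> powr a"
      using a by (intro tendsto_intros tendsto_powr' grid_tendsto) auto
    then have "(\<lambda>n. K * \<bar>grid n - 1\<bar> powr a) \<longlonglongrightarrow> 0" by simp
    then have "(\<lambda>n. z (grid n) - z 1) \<longlonglongrightarrow> 0"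
      using z[OF grid01, of 1] by (intro Lim_null_comparison[of "\<lambda>n. z (grid n) - z 1" "\<lambda>n. K * \<bar>grid n - 1\<bar> powr a"]) auto
    then have "(\<lambda>n. z (grid n)) \<longlonglongrightarrow> z 1" by (simp add: LIM_zero_iff)
    moreover have "\<forall>\<^sub>F n in sequentially. z (grid n) = realized \<gamma> x z (Suc n)"
      using realized_eq unfolding eventually_sequentially by force
    ultimately have "(\<lambda>n. realized \<gamma> x z (Suc n)) \<longlonglongrightarrow> z 1" by (rule Lim_transform_eventually)
    then show ?thesis by (simp only: filterlim_sequentially_Suc)
  qed
  then have "(\<lambda>n. realized \<gamma> x z (Suc n) - realized \<gamma> x z n) sums (z 1 - realized \<gamma> x z 0)"
    by (rule telescope_sums)
  ultimately show "gls_val \<beta> (integrand \<gamma> x z) x = z 1" by (simp add: sums_iff)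
qed

end

section \<open>Measurability\<close>

text \<open>The maximum is attained, so both strict and weak comparisons hold pointwise. Clamped
  rationals are used instead of rationals in [s,w] so that the end points, possibly irrational, are
  covered.\<close>

lemma continuous_on_SUP_facts:
  fixes D :: "real \<Rightarrow> real"
  assumes D: "continuous_on {s..w} D" and sw: "s \<le> w"
  shows "(SUP v\<in>{s..w}. D v) \<le> c \<longleftrightarrow> (\<forall>q\<in>\<rat>. D (max s (min w q)) \<le> c)"
    and "(SUP v\<in>{s..w}. D v) \<le> c \<longleftrightarrow> (\<forall>v\<in>{s..w}. D v \<le> c)"
    and "(SUP v\<in>{s..w}. D v) < c \<longleftrightarrow> (\<forall>v\<in>{s..w}. D v < c)"
proof -
  obtain v0 where v0: "v0 \<in> {s..w}" "\<And>v. v \<in> {s..w} \<Longrightarrow> D v \<le> D v0"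
    using continuous_attains_sup[OF _ _ D] sw by auto
  then have sup: "(SUP v\<in>{s..w}. D v) = D v0" by (intro cSup_eq_maximum) auto
  show "(SUP v\<in>{s..w}. D v) \<le> c \<longleftrightarrow> (\<forall>v\<in>{s..w}. D v \<le> c)"
    and "(SUP v\<in>{s..w}. D v) < c \<longleftrightarrow> (\<forall>v\<in>{s..w}. D v < c)"
    unfolding sup using v0 by (meson order_trans le_less_trans)+
  have c: "continuous_on UNIV (\<lambda>q. D (max s (min w q)))"
    using sw by (intro continuous_on_compose2[OF D] continuous_intros) auto
  have "D v0 \<le> c" if q: "\<And>q. q \<in> \<rat> \<Longrightarrow> D (max s (min w q)) \<le> c"
  proof -
    have "D (max s (min w v0)) \<le> c"
      by (rule continuous_le_on_closure[of \<rat> "\<lambda>q. D (max s (min w q))"])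
        (use c q in \<open>auto simp: Rats_closure_real\<close>)
    then show ?thesis using v0(1) by simp
  qed
  then show "(SUP v\<in>{s..w}. D v) \<le> c \<longleftrightarrow> (\<forall>q\<in>\<rat>. D (max s (min w q)) \<le> c)"
    unfolding sup using order_trans[OF v0(2)[of "max s (min w q)" for q]] sw by auto
qed

lemma path_sup_measurable:
  fixes Y :: "real \<Rightarrow> 'a \<Rightarrow> real"
  assumes Y: "\<And>v. v \<in> {s..w} \<Longrightarrow> Y v \<in> borel_measurable G" and sw: "s \<le> w"
    and c: "\<And>\<omega>. \<omega> \<in> space G \<Longrightarrow> continuous_on {s..w} (\<lambda>v. Y v \<omega>)"
  shows "(\<lambda>\<omega>. SUP v\<in>{s..w}. \<bar>Y v \<omega> - Y s \<omega>\<bar>) \<in> borel_measurable G"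
  unfolding borel_measurable_iff_le
proof
  fix r
  have [measurable]: "Y s \<in> borel_measurable G" "Y (max s (min w q)) \<in> borel_measurable G" for q
    using Y sw by auto
  have "{\<omega> \<in> space G. (SUP v\<in>{s..w}. \<bar>Y v \<omega> - Y s \<omega>\<bar>) \<le> r} =
      {\<omega> \<in> space G. \<forall>q\<in>\<rat>. \<bar>Y (max s (min w q)) \<omega> - Y s \<omega>\<bar> \<le> r}"
    using continuous_on_SUP_facts(1)[OF _ sw, of "\<lambda>v. \<bar>Y v _ - Y s _\<bar>"] c
    by (intro Collect_cong conj_cong refl continuous_on_SUP_facts(1)[OF _ sw]) (auto intro!: continuous_intros)
  also have "\<dots> \<in> sets G"
    by (intro sets.sets_Collect_countable_All' countable_rat) measurable
  finally show "{\<omega> \<in> space G. (SUP v\<in>{s..w}. \<bar>Y v \<omega> - Y s \<omega>\<bar>) \<le> r} \<in> sets G" .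
qed

text \<open>Joint measurability in time and outcome comes from rounding time to multiples of 1/(k+1)
  and path continuity; the integral over time is then measurable as a parameter integral.\<close>

lemma path_integral_measurable:
  fixes Y :: "real \<Rightarrow> 'a \<Rightarrow> real"
  assumes Y: "\<And>v. v \<in> {m..t} \<Longrightarrow> Y v \<in> borel_measurable G" and mt: "m \<le> t"
    and c: "\<And>\<omega>. \<omega> \<in> space G \<Longrightarrow> continuous_on {m..t} (\<lambda>v. Y v \<omega>)"
  shows "(\<lambda>\<omega>. LBINT u:{m..t}. Y u \<omega>) \<in> borel_measurable G"
proof -
  define cl where "cl u = max m (min t u)" for u :: real
  have cl: "cl u \<in> {m..t}" for u using mt by (auto simp: cl_def)
  have cc: "continuous_on UNIV (\<lambda>u. Y (cl u) \<omega>)" if "\<omega> \<in> space G" for \<omega>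
    unfolding cl_def using mt by (intro continuous_on_compose2[OF c[OF that]] continuous_intros) auto
  define r where "r k u = real_of_int \<lfloor>real (Suc k) * u\<rfloor> / real (Suc k)" for k u
  have "(\<lambda>p. Y (cl (r k (snd p))) (fst p)) \<in> borel_measurable (G \<Otimes>\<^sub>M lborel)" for k
    unfolding r_def
  proof (rule measurable_compose_countable[where f="\<lambda>i p. Y (cl (real_of_int i / real (Suc k))) (fst p)"])
    show "(\<lambda>p. Y (cl (real_of_int i / real (Suc k))) (fst p)) \<in> borel_measurable (G \<Otimes>\<^sub>M lborel)" for i
      by (rule measurable_compose[OF measurable_fst Y[OF cl]])
  qed measurable
  then have "(\<lambda>p. Y (cl (snd p)) (fst p)) \<in> borel_measurable (G \<Otimes>\<^sub>M lborel)"
  proof (rule borel_measurable_LIMSEQ_real[rotated])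
    fix p :: "'a \<times> real" assume p: "p \<in> space (G \<Otimes>\<^sub>M lborel)"
    have "(\<lambda>k. r k (snd p)) \<longlonglongrightarrow> snd p"
    proof -
      have "(\<lambda>k. r k (snd p) - snd p) \<longlonglongrightarrow> 0"
      proof (rule Lim_null_comparison)
        have "\<bar>r k u - u\<bar> \<le> 1 / real (Suc k)" for k u
        proof -
          have "\<bar>real_of_int \<lfloor>real (Suc k) * u\<rfloor> - real (Suc k) * u\<bar> \<le> 1" by linarith
          moreover have "r k u - u = (real_of_int \<lfloor>real (Suc k) * u\<rfloor> - real (Suc k) * u) / real (Suc k)"
            by (simp add: r_def diff_divide_distrib del: of_nat_Suc)
          ultimately show ?thesis by (simp add: abs_divide divide_right_mono)
        qed
        then show "\<forall>\<^sub>F k in sequentially. norm (r k (snd p) - snd p) \<le> 1 / real (Suc k)" by simp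
        show "(\<lambda>k. 1 / real (Suc k)) \<longlonglongrightarrow> 0" by (rule LIMSEQ_Suc[OF lim_1_over_n])
      qed
      then show ?thesis by (simp add: LIM_zero_iff)
    qed
    moreover have "isCont (\<lambda>u. Y (cl u) (fst p)) (snd p)"
      using cc[of "fst p"] p by (auto simp: space_pair_measure continuous_on_eq_continuous_at)
    ultimately show "(\<lambda>k. Y (cl (r k (snd p))) (fst p)) \<longlonglongrightarrow> Y (cl (snd p)) (fst p)"
      by (rule isCont_tendsto_compose[rotated])
  qed
  then have [measurable]: "(\<lambda>(\<omega>, u). Y (cl u) \<omega>) \<in> borel_measurable (G \<Otimes>\<^sub>M lborel)"
    by (simp add: case_prod_beta)
  have "(\<lambda>\<omega>. \<integral>u. indicator {m..t} u *\<^sub>R Y (cl u) \<omega> \<partial>lborel) \<in> borel_measurable G" by measurable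
  also have "(\<lambda>\<omega>. \<integral>u. indicator {m..t} u *\<^sub>R Y (cl u) \<omega> \<partial>lborel) = (\<lambda>\<omega>. LBINT u:{m..t}. Y u \<omega>)"
    unfolding set_lebesgue_integral_def
    by (intro ext Bochner_Integration.integral_cong) (auto simp: indicator_def cl_def)
  finally show ?thesis .
qed

lemma bump_borel [measurable]: "bump \<in> borel_measurable borel" "bump_int \<in> borel_measurable borel"
  unfolding bump_def[abs_def] bump_int_def[abs_def] by measurable

section \<open>Adaptedness of the integrand\<close>

locale holder_process =
  fixes M :: "'a measure" and F :: "real \<Rightarrow> 'a measure" and X z :: "real \<Rightarrow> 'a \<Rightarrow> real" and \<alpha> C :: real
  assumes basis: "stochastic_basis M F" and X_adapted: "adapted F X" and z_adapted: "adapted F z"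
    and \<alpha>_pos: "\<alpha> > 0" and C_pos: "C > 0"
    and X_holder: "\<And>\<omega> s t. \<lbrakk>\<omega> \<in> space M; s \<in> {0..1}; t \<in> {0..1}\<rbrakk> \<Longrightarrow>
        \<bar>X t \<omega> - X s \<omega>\<bar> \<le> C * \<bar>t - s\<bar> powr \<alpha>"
begin

text \<open>Constant extension beyond [0,1]: clamping is 1-Lipschitz, so the Hoelder bound becomes
  global with the same constant.\<close>

definition path :: "'a \<Rightarrow> real \<Rightarrow> real" where "path \<omega> u = X (max 0 (min 1 u)) \<omega>"

lemma path_holder: "\<omega> \<in> space M \<Longrightarrow> holder \<alpha> C (path \<omega>)"
  unfolding holder_def
proof (intro conjI allI)
  fix u v assume "\<omega> \<in> space M"
  then have "\<bar>path \<omega> u - path \<omega> v\<bar> \<le> C * \<bar>max 0 (min 1 u) - max 0 (min 1 v)\<bar> powr \<alpha>"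
    unfolding path_def by (intro X_holder) auto
  also have "\<dots> \<le> C * \<bar>u - v\<bar> powr \<alpha>"
    using \<alpha>_pos C_pos by (intro mult_left_mono powr_mono2) auto
  finally show "\<bar>path \<omega> u - path \<omega> v\<bar> \<le> C * \<bar>u - v\<bar> powr \<alpha>" .
qed (use C_pos in simp)

lemma path_eq: "u \<in> {0..1} \<Longrightarrow> path \<omega> u = X u \<omega>"
  by (simp add: path_def)

lemma X_continuous: "\<omega> \<in> space M \<Longrightarrow> 0 \<le> s \<Longrightarrow> w \<le> 1 \<Longrightarrow> continuous_on {s..w} (\<lambda>v. X v \<omega>)"
  using continuous_on_subset[OF holder_continuous[OF path_holder \<alpha>_pos], of \<omega> "{s..w}"]
  by (rule iffD1[OF continuous_on_cong, rotated 2]) (auto simp: path_eq)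

lemma space_F: "t \<in> {0..1} \<Longrightarrow> space (F t) = space M"
  using basis by (auto simp: stochastic_basis_def subalgebra_def)

lemma F_mono: "f \<in> borel_measurable (F s) \<Longrightarrow> s \<in> {0..1} \<Longrightarrow> t \<in> {0..1} \<Longrightarrow> s \<le> t \<Longrightarrow> f \<in> borel_measurable (F t)"
  using basis space_F[of s] space_F[of t]
  by (intro measurable_from_subalg[of "F t" "F s"]) (auto simp: stochastic_basis_def subalgebra_def)

lemma X_measurable: "0 \<le> s \<Longrightarrow> s \<le> t \<Longrightarrow> t \<le> 1 \<Longrightarrow> X s \<in> borel_measurable (F t)"
  and z_measurable: "0 \<le> s \<Longrightarrow> s \<le> t \<Longrightarrow> t \<le> 1 \<Longrightarrow> z s \<in> borel_measurable (F t)"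
  using X_adapted z_adapted by (auto simp: adapted_def intro!: F_mono[of _ s t])

lemma sup_measurable:
  assumes "0 \<le> s" "s \<le> w" "w \<le> t" "t \<le> 1"
  shows "(\<lambda>\<omega>. SUP v\<in>{s..w}. \<bar>X v \<omega> - X s \<omega>\<bar>) \<in> borel_measurable (F t)"
  using assms by (intro path_sup_measurable) (auto intro!: X_measurable X_continuous simp: space_F)

text \<open>The uncountable condition equals a strict bound on a measurable supremum, because the
  supremum is attained.\<close>

lemma hit_measurable:
  assumes "0 \<le> s" "s \<le> w" "w \<le> t" "t \<le> 1"
  shows "{\<omega> \<in> space (F t). \<forall>v\<in>{s..w}. \<bar>X v \<omega> - X s \<omega>\<bar> < \<epsilon>} \<in> sets (F t)"
proof -
  have [measurable]: "(\<lambda>\<omega>. SUP v\<in>{s..w}. \<bar>X v \<omega> - X s \<omega>\<bar>) \<in> borel_measurable (F t)" by (rule sup_measurable[OF assms])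
  have "{\<omega> \<in> space (F t). \<forall>v\<in>{s..w}. \<bar>X v \<omega> - X s \<omega>\<bar> < \<epsilon>} =
      {\<omega> \<in> space (F t). (SUP v\<in>{s..w}. \<bar>X v \<omega> - X s \<omega>\<bar>) < \<epsilon>}"
    using assms by (intro Collect_cong conj_cong refl continuous_on_SUP_facts(3)[symmetric])
      (auto intro!: continuous_intros X_continuous simp: space_F)
  then show ?thesis by simp
qed

lemma unit_block_measurable:
  assumes "t \<in> {0..1}"
  shows "(\<lambda>\<omega>. unit_block \<gamma> (\<lambda>u. X u \<omega>) n t) \<in> borel_measurable (F t)"
\<comment> \<open>Up to \<open>grid n\<close> the block is 0 and needs no later value of X; beyond
  it the clamped time is at most t.\<close>
proof (cases "t \<le> grid n")
  case True
  then show ?thesis by (simp add: unit_block_support)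
next
  case False
  let ?w = "max (grid n) (min (grid_mid n) t)"
  have w: "0 \<le> grid n" "grid n \<le> ?w" "?w \<le> t" "t \<le> 1" using False assms grid_facts[of n] by auto
  have [measurable]: "X ?w \<in> borel_measurable (F t)" "X (grid n) \<in> borel_measurable (F t)"
    using w by (auto intro: X_measurable)
  note [measurable] = hit_measurable[OF w, of "half_len n powr \<gamma>"]
  show ?thesis unfolding unit_block_def block_def by measurable
qed

text \<open>The value of an unsuccessful block contains the mean of X over its second half, hence is
  known only at the end of the block.\<close>

lemma unit_val_measurable:
  "(\<lambda>\<omega>. unit_val \<gamma> (\<lambda>u. X u \<omega>) n) \<in> borel_measurable (F (grid (Suc n)))"
proof -
  note t = grid_facts[of n] grid_facts(4)[of "Suc n"]
  have [measurable]: "X (grid n) \<in> borel_measurable (F (grid (Suc n)))" "X (grid_mid n) \<in> borel_measurable (F (grid (Suc n)))"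
    using t by (auto intro!: X_measurable)
  have [measurable]: "(\<lambda>\<omega>. LBINT u:{grid_mid n..grid (Suc n)}. X u \<omega>) \<in> borel_measurable (F (grid (Suc n)))"
    using t by (intro path_integral_measurable X_measurable X_continuous) (auto simp: space_F)
  have [measurable]: "{\<omega> \<in> space (F (grid (Suc n))). \<forall>v\<in>{grid n..grid_mid n}. \<bar>X v \<omega> - X (grid n) \<omega>\<bar> < half_len n powr \<gamma>} \<in> sets (F (grid (Suc n)))"
    using t by (intro hit_measurable) auto
  show ?thesis unfolding unit_val_def block_val_def stopped_val_def by measurable
qed

lemma realized_measurable:
  "(\<lambda>\<omega>. realized \<gamma> (\<lambda>u. X u \<omega>) (\<lambda>u. z u \<omega>) n) \<in> borel_measurable (F (grid n))"
proof (induction n)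
  case (Suc n)
  note t = grid_facts[of n] grid_facts(1,4)[of "Suc n"]
  have [measurable]: "z (grid n) \<in> borel_measurable (F (grid (Suc n)))" using t by (intro z_measurable) auto
  have [measurable]: "(\<lambda>\<omega>. realized \<gamma> (\<lambda>u. X u \<omega>) (\<lambda>u. z u \<omega>) n) \<in> borel_measurable (F (grid (Suc n)))"
    using t by (intro F_mono[OF Suc]) auto
  note [measurable] = unit_val_measurable
  show ?case by (simp only: realized.simps) measurable
qed simp

text \<open>The coefficient of block n is known from \<open>grid n\<close> on, and until then the
  block vanishes.\<close>

lemma integrand_adapted: "adapted F (\<lambda>t \<omega>. integrand \<gamma> (\<lambda>u. X u \<omega>) (\<lambda>u. z u \<omega>) t)"
  unfolding adapted_def
proof
  fix t :: real assume t: "t \<in> {0..1}"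
  have summand: "(\<lambda>\<omega>. (z (grid n) \<omega> - realized \<gamma> (\<lambda>u. X u \<omega>) (\<lambda>u. z u \<omega>) n) * unit_block \<gamma> (\<lambda>u. X u \<omega>) n t)
     \<in> borel_measurable (F t)" for n
  proof (cases "t \<le> grid n")
    case True then show ?thesis by (simp add: unit_block_support)
  next
    case False
    have [measurable]: "z (grid n) \<in> borel_measurable (F t)" using t False grid_facts[of n] by (intro z_measurable) auto
    have [measurable]: "(\<lambda>\<omega>. realized \<gamma> (\<lambda>u. X u \<omega>) (\<lambda>u. z u \<omega>) n) \<in> borel_measurable (F t)"
      using t False grid_facts[of n] by (intro F_mono[OF realized_measurable]) auto
    note [measurable] = unit_block_measurable[OF t]
    show ?thesis by measurable
  qed
  show "(\<lambda>\<omega>. integrand \<gamma> (\<lambda>u. X u \<omega>) (\<lambda>u. z u \<omega>) t) \<in> borel_measurable (F t)"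
    unfolding integrand_def by (rule borel_measurable_suminf[OF summand])
qed

end

text \<open>Difference quotients are at most L |h|^(\<alpha>-1), so the derivative is 0
  everywhere.\<close>

lemma holder_gt_1_const:
  assumes "holder \<alpha> L f" "1 < \<alpha>"
  shows "f u = f v"
proof -
  have "(f has_real_derivative 0) (at x)" for x
  proof -
  have "((\<lambda>h. (f (x + h) - f x) / h) \<longlongrightarrow> 0) (at 0)"
  proof (rule Lim_null_comparison)
    have "norm ((f (x + h) - f x) / h) \<le> L * \<bar>h\<bar> powr (\<alpha> - 1)" if "h \<noteq> 0" for h
    proof -
      have "\<bar>f (x + h) - f x\<bar> / \<bar>h\<bar> \<le> (L * \<bar>h\<bar> powr \<alpha>) / \<bar>h\<bar>"
        using holderD[OF assms(1), of "x + h" x] by (intro divide_right_mono) auto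
      then show ?thesis using that by (simp add: powr_diff)
    qed
    then show "\<forall>\<^sub>F h in at 0. norm ((f (x + h) - f x) / h) \<le> L * \<bar>h\<bar> powr (\<alpha> - 1)"
      by (auto simp: eventually_at_filter)
    have "((\<lambda>h. L * \<bar>h\<bar> powr (\<alpha> - 1)) \<longlongrightarrow> L * \<bar>0\<bar> powr (\<alpha> - 1)) (at 0)"
      using assms(2) by (intro tendsto_intros) auto
    then show "((\<lambda>h. L * \<bar>h\<bar> powr (\<alpha> - 1)) \<longlongrightarrow> 0) (at 0)" by simp
  qed
  then show ?thesis by (simp add: DERIV_def)
  qed
  then show ?thesis using DERIV_isconst_all by blast
qed

theorem theorem4p3:
  fixes M :: "'a measure" and F :: "real \<Rightarrow> 'a measure"
    and X z :: "real \<Rightarrow> 'a \<Rightarrow> real" and \<xi> :: "'a \<Rightarrow> real"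
    and \<alpha> \<delta> C1 C2 a :: real
  assumes basis: "stochastic_basis M F"
    and X_adapted: "adapted F X"
    and alpha: "\<alpha> > 1 / 2" and delta: "\<delta> > 0"
    and C1: "C1 > 0" and C2: "C2 > 0"
    and X_holder: "\<And>\<omega> s t. \<lbrakk>\<omega> \<in> space M; s \<in> {0..1}; t \<in> {0..1}\<rbrakk> \<Longrightarrow>
        \<bar>X t \<omega> - X s \<omega>\<bar> \<le> C1 * \<bar>t - s\<bar> powr \<alpha>"
    and X_small_dev: "\<And>s t \<Delta> \<epsilon>. \<lbrakk>s \<in> {0..1} \<inter> {1 - \<delta>..1}; t \<in> {0..1} \<inter> {1 - \<delta>..1};
          t = s + \<Delta>; \<Delta> > 0; \<epsilon> > 0; \<epsilon> \<le> \<Delta> powr \<alpha>\<rbrakk> \<Longrightarrow>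
        measure M {\<omega> \<in> space M. (SUP u\<in>{s..t}. \<bar>X u \<omega> - X s \<omega>\<bar>) \<le> \<epsilon>}
          \<le> exp (- C2 * \<Delta> * \<epsilon> powr (- 1 / \<alpha>))"
    and xi: "\<xi> \<in> borel_measurable M"
    and z_adapted: "adapted F z"
    and a: "a > 0"
    and z_holder: "AE \<omega> in M. holder_on {0..1} a (\<lambda>t. z t \<omega>)"
    and z_end: "AE \<omega> in M. z 1 \<omega> = \<xi> \<omega>"
  shows "\<exists>\<psi>. adapted F \<psi> \<and>
    (AE \<omega> in M. continuous_on {0..<1} (\<lambda>t. \<psi> t \<omega>)) \<and>
    (AE \<omega> in M. has_pathwise_integral \<alpha> 0 1 (\<lambda>t. \<psi> t \<omega>) (\<lambda>t. X t \<omega>) (\<xi> \<omega>))"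
proof -
  interpret P: holder_process M F X z \<alpha> C1
    using assms by unfold_locales auto
  interpret prob_space M using basis by (simp add: stochastic_basis_def)
  have alpha1: "\<alpha> \<le> 1" \<comment> \<open>otherwise the paths are constant, against the small deviation bound\<close>
  proof (rule ccontr)
    assume "\<not> \<alpha> \<le> 1"
    \<comment> \<open>The earliest time in [0,1] from which the small deviation bound is
      available.\<close>
    define s where "s = max 0 (1 - \<delta>)"
    have s: "0 \<le> s" "1 - \<delta> \<le> s" "s < 1" using delta by (auto simp: s_def)
    have "\<bar>X u \<omega> - X s \<omega>\<bar> \<le> (1 - s) powr \<alpha>" if "\<omega> \<in> space M" "u \<in> {s..1}" for u \<omega>
      using holder_gt_1_const[OF P.path_holder[OF that(1)], of u s] \<open>\<not> \<alpha> \<le> 1\<close> that s by (simp add: P.path_eq)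
    then have "(SUP u\<in>{s..1}. \<bar>X u \<omega> - X s \<omega>\<bar>) \<le> (1 - s) powr \<alpha>" if "\<omega> \<in> space M" for \<omega>
      using s that by (intro cSUP_least) auto
    then have "{\<omega> \<in> space M. (SUP u\<in>{s..1}. \<bar>X u \<omega> - X s \<omega>\<bar>) \<le> (1 - s) powr \<alpha>} = space M"
      by blast
    \<comment> \<open>With the level (1 - s)^\<alpha> the bound is exp(-C2) < 1, yet the event has
      probability 1.\<close>
    then have "1 \<le> exp (- C2 * (1 - s) * ((1 - s) powr \<alpha>) powr (- 1 / \<alpha>))"
      using X_small_dev[of s 1 "1 - s" "(1 - s) powr \<alpha>"] s delta by (simp add: prob_space)
    moreover have "- C2 * (1 - s) * ((1 - s) powr \<alpha>) powr (- 1 / \<alpha>) < 0"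
      using C2 s by (simp add: mult_neg_pos)
    ultimately show False by simp
  qed
  \<comment> \<open>A smaller Hoelder order of z is still valid on [0,1], and the exponents below
    require at most 2\<alpha> - 1.\<close>
  define a' where "a' = min a (2 * \<alpha> - 1)"
  have a': "0 < a'" "a' \<le> 2 * \<alpha> - 1" "a' \<le> a" using a alpha by (auto simp: a'_def)
  define \<kappa> where "\<kappa> = a' / 5"
  define \<beta> where "\<beta> = 1 - \<alpha> + \<kappa>"
  define \<gamma> where "\<gamma> = \<alpha> + \<kappa>"
  have \<kappa>: "0 < \<kappa>" "\<beta> \<in> {1 - \<alpha><..<1}" "0 < \<beta>" using a' alpha alpha1 by (auto simp: \<kappa>_def \<beta>_def)
  define \<psi> where "\<psi> t \<omega> = integrand \<gamma> (\<lambda>u. X u \<omega>) (\<lambda>u. z u \<omega>) t" for t \<omega>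
  \<comment> \<open>\<psi> is built from X itself for the sake of adaptedness; the analysis runs on
    the extended path.\<close>
  have \<psi>_path: "(\<lambda>t. \<psi> t \<omega>) = integrand \<gamma> (P.path \<omega>) (\<lambda>u. z u \<omega>)" for \<omega>
    unfolding \<psi>_def by (rule integrand_cong) (auto simp: P.path_eq)
  define bad where "bad n = {\<omega> \<in> space M. (SUP u\<in>{grid n..grid_mid n}. \<bar>X u \<omega> - X (grid n) \<omega>\<bar>) \<le> half_len n powr \<gamma>}" for n
  have t01: "0 \<le> grid n" "grid n \<le> grid_mid n" "grid_mid n \<le> 1" for n
    using grid_facts[of n] grid_facts(4)[of "Suc n"] by auto
  have bad_sets: "bad n \<in> sets M" for n
  proof -
    have "(\<lambda>\<omega>. SUP u\<in>{grid n..grid_mid n}. \<bar>X u \<omega> - X (grid n) \<omega>\<bar>) \<in> borel_measurable (F 1)"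
      by (rule P.sup_measurable) (use t01 in auto)
    then have [measurable]: "(\<lambda>\<omega>. SUP u\<in>{grid n..grid_mid n}. \<bar>X u \<omega> - X (grid n) \<omega>\<bar>) \<in> borel_measurable M"
      using basis by (intro measurable_from_subalg[of M "F 1"]) (auto simp: stochastic_basis_def)
    show ?thesis unfolding bad_def by measurable
  qed
  have bad_prob: "prob (bad n) \<le> (1 / C2) * ((1/4) powr (\<kappa> / \<alpha>) * ((1/2) powr (\<kappa> / \<alpha>)) ^ n)" if n: "1 - \<delta> \<le> grid n" for n
  proof -
    have l: "0 < half_len n" "half_len n < 1" by (rule grid_facts)+
    have "prob (bad n) \<le> exp (- C2 * half_len n * (half_len n powr \<gamma>) powr (- 1 / \<alpha>))"
      unfolding bad_def
    proof (rule X_small_dev)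
      \<comment> \<open>The level is admissible for the time span l, since l < 1 and \<gamma>
        exceeds \<alpha>.\<close>
      show "half_len n powr \<gamma> \<le> half_len n powr \<alpha>" using l \<kappa> by (intro powr_mono') (auto simp: \<gamma>_def)
    qed (use n t01[of n] l in \<open>auto simp: grid_mid_def\<close>)
    also have "- C2 * half_len n * (half_len n powr \<gamma>) powr (- 1 / \<alpha>) = - (C2 * (half_len n powr 1 * half_len n powr (\<gamma> * (- 1 / \<alpha>))))"
      using l by (simp add: powr_powr)
    also have "half_len n powr 1 * half_len n powr (\<gamma> * (- 1 / \<alpha>)) = half_len n powr (- (\<kappa> / \<alpha>))"
      unfolding powr_add[symmetric] using alpha
      by (intro arg_cong[where f="\<lambda>e. half_len n powr e"]) (simp add: \<gamma>_def field_simps)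
    \<comment> \<open>The crude bound exp(-y) at most 1/y already yields a geometric series.\<close>
    also have "exp (- (C2 * half_len n powr (- (\<kappa> / \<alpha>)))) \<le> 1 / (C2 * half_len n powr (- (\<kappa> / \<alpha>)))"
    proof -
      have pos: "0 < C2 * half_len n powr (- (\<kappa> / \<alpha>))" using C2 l by simp
      have "C2 * half_len n powr (- (\<kappa> / \<alpha>)) \<le> exp (C2 * half_len n powr (- (\<kappa> / \<alpha>)))"
        using exp_ge_add_one_self[of "C2 * half_len n powr (- (\<kappa> / \<alpha>))"] by linarith
      then show ?thesis unfolding exp_minus using pos by (simp add: inverse_eq_divide frac_le)
    qed
    also have "1 / (C2 * half_len n powr (- (\<kappa> / \<alpha>))) = (1 / C2) * half_len n powr (\<kappa> / \<alpha>)"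
      by (simp add: powr_minus_divide)
    finally show ?thesis unfolding half_len_powr .
  qed
  have AE_hit: "AE \<omega> in M. \<forall>\<^sub>F n in sequentially. \<omega> \<in> space M - bad n"
  proof (rule borel_cantelli_AE1[OF bad_sets])
    have "\<forall>\<^sub>F n in sequentially. 1 - \<delta> < grid n" using order_tendstoD(1)[OF grid_tendsto, of "1 - \<delta>"] delta by simp
    then have "\<forall>\<^sub>F n in sequentially. norm (prob (bad n)) \<le> (1 / C2) * ((1/4) powr (\<kappa> / \<alpha>) * ((1/2) powr (\<kappa> / \<alpha>)) ^ n)"
      by eventually_elim (use bad_prob in auto)
    moreover have "(1/2::real) powr (\<kappa> / \<alpha>) < 1 powr (\<kappa> / \<alpha>)" using \<kappa> alpha by (intro powr_less_mono2) auto
    then have "summable (\<lambda>n. (1 / C2) * ((1/4) powr (\<kappa> / \<alpha>) * ((1/2) powr (\<kappa> / \<alpha>)) ^ n))"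
      by (intro summable_mult summable_geometric) simp
    ultimately show "summable (\<lambda>n. prob (bad n))" by (rule summable_comparison_test_ev)
  qed (simp add: emeasure_eq_measure)
  show ?thesis
  proof (intro exI[of _ \<psi>] conjI)
    show "adapted F \<psi>" unfolding \<psi>_def[abs_def] by (rule P.integrand_adapted)
    show "AE \<omega> in M. continuous_on {0..<1} (\<lambda>t. \<psi> t \<omega>)"
    proof (rule AE_I2)
      fix \<omega> assume "\<omega> \<in> space M"
      from integrand_continuous[OF alpha alpha1 a'(1,2) \<kappa>_def \<beta>_def \<gamma>_def P.path_holder[OF this]]
      show "continuous_on {0..<1} (\<lambda>t. \<psi> t \<omega>)" unfolding \<psi>_path .
    qed
    show "AE \<omega> in M. has_pathwise_integral \<alpha> 0 1 (\<lambda>t. \<psi> t \<omega>) (\<lambda>t. X t \<omega>) (\<xi> \<omega>)"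
      using AE_hit z_holder z_end AE_space
    proof eventually_elim
      case (elim \<omega>)
      note x = P.path_holder[OF elim(4)]
      note ctx = alpha alpha1 a'(1,2) \<kappa>_def \<beta>_def \<gamma>_def x
      obtain K where K: "\<And>s t. s \<in> {0..1} \<Longrightarrow> t \<in> {0..1} \<Longrightarrow> \<bar>z t \<omega> - z s \<omega>\<bar> \<le> K * \<bar>t - s\<bar> powr a"
        using elim(2) unfolding holder_on_def by blast
      \<comment> \<open>Differences of times are at most 1, so lowering the exponent increases the
        bound; the absolute value is taken because K has no known sign.\<close>
      have z': "\<bar>z u \<omega> - z v \<omega>\<bar> \<le> \<bar>K\<bar> * \<bar>u - v\<bar> powr a'" if "u \<in> {0..1}" "v \<in> {0..1}" for u v
      proof -
        have "\<bar>z u \<omega> - z v \<omega>\<bar> \<le> K * \<bar>u - v\<bar> powr a" using K[of v u] that by simp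
        also have "\<dots> \<le> \<bar>K\<bar> * \<bar>u - v\<bar> powr a'"
          using that a' by (intro mult_mono powr_mono') auto
        finally show ?thesis .
      qed
      have hit: "\<forall>\<^sub>F n in sequentially. \<exists>v\<in>{grid n..grid_mid n}. \<bar>P.path \<omega> v - P.path \<omega> (grid n)\<bar> \<ge> half_len n powr \<gamma>"
        using elim(1)
      proof eventually_elim
        case (elim n)
        have "continuous_on {grid n..grid_mid n} (\<lambda>u. \<bar>X u \<omega> - X (grid n) \<omega>\<bar>)"
          using elim t01[of n] by (intro continuous_intros P.X_continuous) auto
        from continuous_on_SUP_facts(2)[OF this t01(2), of "half_len n powr \<gamma>"] elim
        have "\<not> (\<forall>v\<in>{grid n..grid_mid n}. \<bar>X v \<omega> - X (grid n) \<omega>\<bar> \<le> half_len n powr \<gamma>)" by (simp add: bad_def)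
        then obtain v where "v \<in> {grid n..grid_mid n}" "half_len n powr \<gamma> \<le> \<bar>X v \<omega> - X (grid n) \<omega>\<bar>"
          by force
        then show ?case using t01[of n] by (intro bexI[of _ v]) (auto simp: P.path_eq)
      qed
      note int = integrand_integral[OF ctx z' hit]
      have borel: "integrand \<gamma> (P.path \<omega>) (\<lambda>u. z u \<omega>) \<in> borel_measurable borel"
        by (rule integrand_borel[OF ctx])
      have "has_gls_integral \<beta> 0 1 (\<lambda>t. \<psi> t \<omega>) (P.path \<omega>) (z 1 \<omega>)"
      proof -
        have "gls_val \<beta> (integrand \<gamma> (P.path \<omega>) (\<lambda>u. z u \<omega>)) (P.path \<omega>) = z 1 \<omega>" by (rule int(2))
        moreover have "1 - \<beta> < \<alpha>" "\<beta> < 1" using \<kappa>(2) by auto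
        ultimately show ?thesis
          using has_gls_integral_gls_val[OF borel int(1) x \<kappa>(3)] by (simp only: \<psi>_path)
      qed
      then have "has_gls_integral \<beta> 0 1 (\<lambda>t. \<psi> t \<omega>) (\<lambda>t. X t \<omega>) (\<xi> \<omega>)"
        unfolding elim(3) by (rule has_gls_integral_cong) (auto simp: P.path_eq)
      moreover have "gls_admissible_at \<alpha> \<beta> 0 1 (\<lambda>t. \<psi> t \<omega>)"
        unfolding gls_admissible_at_def \<psi>_path set_borel_measurable_def using borel int(1) \<kappa> by auto
      ultimately show ?case unfolding has_pathwise_integral_def by blast
    qed
  qed
qed

end
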